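(* Let $G$ be a finite irreducible subgroup of $O(7)$ which is imprimitive. Then $G$ is one of the groups $H$ listed in Cases 1--3 below, or $G$ is the direct product of $Z_2$ with one of these groups $H$, obtained by adjoining the matrix $-I_7$. Case 1. The representation is quasi-primitive and $H$ is a simple group isomorphic to $PSL(2,7)$. If the representation is not quasi-primitive, then $H$ has a normal elementary abelian subgroup $A$ of order $8$ or $64$, and, with one exception (the non-split group in Case 2), $H$ is a semidirect product of $A$ by $H/A$. Case 2. $|A|=8$. Then $H/A$ is a subgroup of $PSL(3,2)\cong PSL(2,7)$ whose order is divisible by $7$ and which has a subgroup of index $7$. The possible $H/A$ are: a subgroup of the normalizer of a Sylow $7$-subgroup, of order $7$ or $7\cdot 3$; or the full group $PSL(3,2)$. The extension $H$ of $A$ by $H/A$ is split, except that in the case $H/A\cong PSL(3,2)$ there are two such groups $H$, one split and one non-split. Case 3. $|A|=64$. Then $H/A$ is a subgroup of $\mathrm{Sym}(7)$ whose order is a multiple of $7$ and which has a subgroup of index $7$. The possible $H/A$ are: a subgroup of the normalizer of a Sylow $7$-subgroup of $\mathrm{Sym}(7)$, of order $7$, $7\cdot 2$, $7\cdot 3$ or $42$; or one of $PSL(3,2)$, $\mathrm{Alt}(7)$, $\mathrm{Sym}(7)$. In every case $H$ is a split extension of $A$ by $H/A$. The groups $H/A$ contained in the normalizer of a Sylow $7$-subgroup have a self-centralizing Sylow $7$-subgroup.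
   Context: $O(7)$ is the group of real orthogonal $7\times 7$ matrices. A linear group $G$ acting on $\mathbb{R}^7$ is imprimitive if there is a set of (more than one) linearly independent non-trivial subspaces which together span $\mathbb{R}^7$ (as a direct sum) and which are permuted by $G$. A linear group is quasi-primitive if, for every normal subgroup, the restriction of the representation to that normal subgroup has all its irreducible constituents isomorphic to one another. $Z_2$ is the cyclic group of order $2$. A group $H$ with normal subgroup $A$ is a split extension of $A$ by $H/A$ if it is a semidirect product of $A$ by a subgroup isomorphic to $H/A$. The groups are listed up to isomorphism. *)

theory Defs
  imports
    "HOL-Analysis.Analysis"
    "HOL-Algebra.Sym_Groups"
    "HOL-Algebra.SimpleGroups"
    "HOL-Algebra.Group_Action"
    "HOL-Algebra.Elementary_Groups"
    "HOL-Computational_Algebra.Primes"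
begin

definition orthogonal_group :: "(real^'n^'n) monoid" where
  "orthogonal_group = \<lparr>carrier = {Q. orthogonal_matrix Q}, mult = (**), one = mat 1\<rparr>"

abbreviation matrix_group :: "(real^'n^'n) set \<Rightarrow> (real^'n^'n) monoid" where
  "matrix_group G \<equiv> orthogonal_group\<lparr>carrier := G\<rparr>"

definition irreducible_subrep :: "(real^'n^'n) set \<Rightarrow> (real^'n) set \<Rightarrow> bool" where
  "irreducible_subrep N U \<longleftrightarrow>
     subspace U \<and> U \<noteq> {0} \<and> (\<forall>g\<in>N. (*v) g ` U \<subseteq> U) \<and>
     (\<forall>W. subspace W \<and> W \<subseteq> U \<and> (\<forall>g\<in>N. (*v) g ` W \<subseteq> W) \<longrightarrow> W = {0} \<or> W = U)"

definition irreducible_group :: "(real^'n^'n) set \<Rightarrow> bool" where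
  "irreducible_group G \<longleftrightarrow> irreducible_subrep G UNIV"

definition isomorphic_subreps ::
    "(real^'n^'n) set \<Rightarrow> (real^'n) set \<Rightarrow> (real^'n) set \<Rightarrow> bool" where
  "isomorphic_subreps N U W \<longleftrightarrow>
     (\<exists>f. linear f \<and> bij_betw f U W \<and> (\<forall>g\<in>N. \<forall>u\<in>U. f (g *v u) = g *v f u))"

text \<open>Every representation by orthogonal matrices is completely reducible, so each irreducible
  constituent of the restriction to \<open>N\<close> is isomorphic to an irreducible invariant subspace.\<close>

definition quasi_primitive :: "(real^'n^'n) set \<Rightarrow> bool" where
  "quasi_primitive G \<longleftrightarrow>
     (\<forall>N. N \<lhd> matrix_group G \<longrightarrow>
        (\<forall>U W. irreducible_subrep N U \<and> irreducible_subrep N W \<longrightarrow> isomorphic_subreps N U W))"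

text \<open>Linear independence of a set of subspaces is expressed by each member meeting the span of
  the others trivially; a linearly independent set of nonzero subspaces is automatically finite.\<close>

definition imprimitive :: "(real^'n^'n) set \<Rightarrow> bool" where
  "imprimitive G \<longleftrightarrow>
     (\<exists>S. finite S \<and> card S > 1 \<and>
        (\<forall>V\<in>S. subspace V \<and> V \<noteq> {0} \<and> V \<inter> span (\<Union>(S - {V})) = {0}) \<and>
        span (\<Union>S) = UNIV \<and>
        (\<forall>g\<in>G. (\<lambda>V. (*v) g ` V) ` S = S))"

definition finite_irreducible_imprimitive :: "(real^'n^'n) set \<Rightarrow> bool" where
  "finite_irreducible_imprimitive G \<longleftrightarrow>
     subgroup G orthogonal_group \<and> finite G \<and> irreducible_group G \<and> imprimitive G"

definition centralizer :: "('a, 'b) monoid_scheme \<Rightarrow> 'a set \<Rightarrow> 'a set" where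
  "centralizer G S = {g \<in> carrier G. \<forall>s\<in>S. g \<otimes>\<^bsub>G\<^esub> s = s \<otimes>\<^bsub>G\<^esub> g}"

definition sylow_subgroup :: "nat \<Rightarrow> ('a, 'b) monoid_scheme \<Rightarrow> 'a set \<Rightarrow> bool" where
  "sylow_subgroup p G P \<longleftrightarrow> subgroup P G \<and> card P = p ^ multiplicity p (order G)"

definition elementary_abelian :: "nat \<Rightarrow> ('a, 'b) monoid_scheme \<Rightarrow> bool" where
  "elementary_abelian p G \<longleftrightarrow>
     Factorial_Ring.prime p \<and> comm_group G \<and> (\<forall>x\<in>carrier G. x [^]\<^bsub>G\<^esub> p = \<one>\<^bsub>G\<^esub>)"

definition split_extension :: "('a, 'b) monoid_scheme \<Rightarrow> 'a set \<Rightarrow> bool" where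
  "split_extension G A \<longleftrightarrow> A \<lhd> G \<and>
     (\<exists>C. subgroup C G \<and> A \<inter> C = {\<one>\<^bsub>G\<^esub>} \<and> A <#>\<^bsub>G\<^esub> C = carrier G \<and>
          G\<lparr>carrier := C\<rparr> \<cong> G Mod A)"

definition has_subgroup_of_index :: "('a, 'b) monoid_scheme \<Rightarrow> nat \<Rightarrow> bool" where
  "has_subgroup_of_index G n \<longleftrightarrow> (\<exists>L. subgroup L G \<and> card (rcosets\<^bsub>G\<^esub> L) = n)"

definition embeds_in :: "('a, 'b) monoid_scheme \<Rightarrow> ('c, 'd) monoid_scheme \<Rightarrow> bool" where
  "embeds_in Q G \<longleftrightarrow> (\<exists>K. subgroup K G \<and> Q \<cong> G\<lparr>carrier := K\<rparr>)"

definition embeds_in_sylow_normalizer ::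
    "nat \<Rightarrow> ('a, 'b) monoid_scheme \<Rightarrow> ('c, 'd) monoid_scheme \<Rightarrow> bool" where
  "embeds_in_sylow_normalizer p Q G \<longleftrightarrow>
     (\<exists>P K. sylow_subgroup p G P \<and> subgroup K G \<and> K \<subseteq> normalizer G P \<and>
            Q \<cong> G\<lparr>carrier := K\<rparr>)"

definition self_centralizing_sylow :: "nat \<Rightarrow> ('a, 'b) monoid_scheme \<Rightarrow> bool" where
  "self_centralizing_sylow p G \<longleftrightarrow> (\<forall>P. sylow_subgroup p G P \<longrightarrow> centralizer G P = P)"

definition special_linear_group :: "('a::comm_ring_1^'n^'n) monoid" where
  "special_linear_group = \<lparr>carrier = {M. det M = 1}, mult = (**), one = mat 1\<rparr>"

definition projective_special_linear_group :: "('a::comm_ring_1^'n^'n) set monoid" where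
  "projective_special_linear_group =
     special_linear_group Mod centralizer special_linear_group (carrier special_linear_group)"

text \<open>The numeral types \<open>2\<close> and \<open>7\<close> carry arithmetic modulo 2 and 7, i.e. they are the
  prime fields with 2 and 7 elements.\<close>

abbreviation PSL_3_2 :: "(2^3^3) set monoid" where
  "PSL_3_2 \<equiv> projective_special_linear_group"

abbreviation PSL_2_7 :: "(7^2^2) set monoid" where
  "PSL_2_7 \<equiv> projective_special_linear_group"

definition case1 :: "(real^7^7) set \<Rightarrow> bool" where
  "case1 H \<longleftrightarrow> simple_group (matrix_group H) \<and> matrix_group H \<cong> PSL_2_7"

definition case2 :: "(real^7^7) set \<Rightarrow> (real^7^7) set \<Rightarrow> bool" where
  "case2 H A \<longleftrightarrow>
     A \<lhd> matrix_group H \<and> elementary_abelian 2 (matrix_group A) \<and> card A = 8 \<and>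
     (let Q = matrix_group H Mod A in
        embeds_in Q PSL_3_2 \<and> 7 dvd order Q \<and> has_subgroup_of_index Q 7 \<and>
        (embeds_in_sylow_normalizer 7 Q PSL_3_2 \<and> order Q \<in> {7, 7 * 3} \<or> Q \<cong> PSL_3_2) \<and>
        (\<not> Q \<cong> PSL_3_2 \<longrightarrow> split_extension (matrix_group H) A))"

definition case3 :: "(real^7^7) set \<Rightarrow> (real^7^7) set \<Rightarrow> bool" where
  "case3 H A \<longleftrightarrow>
     A \<lhd> matrix_group H \<and> elementary_abelian 2 (matrix_group A) \<and> card A = 64 \<and>
     (let Q = matrix_group H Mod A in
        embeds_in Q (sym_group 7) \<and> 7 dvd order Q \<and> has_subgroup_of_index Q 7 \<and>
        (embeds_in_sylow_normalizer 7 Q (sym_group 7) \<and> order Q \<in> {7, 7 * 2, 7 * 3, 42} \<or>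
         Q \<cong> PSL_3_2 \<or> Q \<cong> alt_group 7 \<or> Q \<cong> sym_group 7) \<and>
        (embeds_in_sylow_normalizer 7 Q (sym_group 7) \<longrightarrow> self_centralizing_sylow 7 Q) \<and>
        split_extension (matrix_group H) A)"

definition listed :: "(real^7^7) set \<Rightarrow> bool" where
  "listed H \<longleftrightarrow> finite_irreducible_imprimitive H \<and>
     (if quasi_primitive H then case1 H else (\<exists>A. case2 H A \<or> case3 H A))"

definition listed_by :: "(real^7^7) set \<Rightarrow> (real^7^7) set \<Rightarrow> bool" where
  "listed_by H A \<longleftrightarrow> finite_irreducible_imprimitive H \<and> \<not> quasi_primitive H \<and>
     (case2 H A \<or> case3 H A)"

end

theory Submission
  imports Defs "HOL-Algebra.Sylow" "HOL-Algebra.Multiplicative_Group"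
begin

text \<open>A system of imprimitivity of an irreducible group \<open>G\<close> on \<open>\<real>\<^sup>7\<close> is permuted
transitively, so its members have equal dimension and, as 7 is prime, they are seven lines. Hence 7
divides the order of \<open>G\<close>, and an element of order 7 permutes the lines in one cycle. Applying its
powers to a vector on one line gives a basis \<open>v\<close> in which \<open>G\<close> acts by signed permutations and
contains the pure cyclic shift (\<open>monomial_exists\<close>). No further choice of signs is left: \<open>G\<close> is the
faithful image of a set \<open>S\<close> of pairs (permutation, sign vector), and everything is read off from two
invariants of \<open>S\<close>, the permutations that occur (\<open>fst ` S\<close>, the quotient) and the sign vectors over the
identity (\<open>diag_signs S\<close>, the normal 2-subgroup).

The sign vectors form a cyclic binary code of length 7. Modulo 2 the polynomial \<open>x^7 - 1\<close> is the
product of \<open>x - 1\<close> and two cubics which reversal interchanges, so a cyclic code without the all-ones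
word is zero, one of two mirror images of the simplex code (dimension 3), or the even code (dimension 6)
(\<open>cyclic_codes\<close>, \<open>diag_without_ones\<close>). The permutations form a group containing a 7-cycle, hence an affine
group modulo 7, the collineation group of one of two Fano planes, or a group containing the alternating
group (\<open>classification\<close>).

The two invariants constrain each other. If there are no sign changes and the permutation group is
affine or contains the alternating group, then every element of \<open>S\<close> has constant signs and the sum of the
basis spans an invariant line. So only the collineation group remains; it is simple (\<open>Fano_simple\<close>), which
gives Case 1. If the code is the simplex code, the permutations preserve it and are collineations. In the
affine case and for the even code, the elements with constant signs form a complement
(\<open>const_complement\<close>). If \<open>-1\<close> lies in \<open>G\<close>, the subgroup of determinant 1 takes the place of \<open>G\<close>.

An extension of the simplex code by the full collineation group is determined by the signs, modulo the
code, of a lift of one involution. Evaluating two relations leaves two values (\<open>extension_cases\<close>). One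
gives the semidirect product, the other the signed permutations of the imaginary octonion units that
preserve the multiplication; there every lift of a certain element of order 4 has order 8, so that
extension does not split. Finally, \<open>PSL(3,2)\<close> acts on the nonzero vectors over the field with two elements,
and \<open>PSL(2,7)\<close> acts by conjugation on seven quaternion subgroups of \<open>SL(2,7)\<close>; both actions have the
collineation group as image.

Finite verifications are evaluations by rewriting; permutations and sign vectors are therefore stored as
tables.\<close>


section \<open>Permutations of seven points\<close>

datatype pt = P0 | P1 | P2 | P3 | P4 | P5 | P6

text \<open>Permutations of \<open>pt\<close> as tables of values, so that rewriting decides equality and multiplies.\<close>

datatype perm = Perm pt pt pt pt pt pt pt

fun ap :: "perm \<Rightarrow> pt \<Rightarrow> pt" where
  "ap (Perm a b c d e f g) P0 = a"
| "ap (Perm a b c d e f g) P1 = b"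
| "ap (Perm a b c d e f g) P2 = c"
| "ap (Perm a b c d e f g) P3 = d"
| "ap (Perm a b c d e f g) P4 = e"
| "ap (Perm a b c d e f g) P5 = f"
| "ap (Perm a b c d e f g) P6 = g"

definition table :: "(pt \<Rightarrow> pt) \<Rightarrow> perm" where
  "table f = Perm (f P0) (f P1) (f P2) (f P3) (f P4) (f P5) (f P6)"

fun pm :: "perm \<Rightarrow> perm \<Rightarrow> perm" (infixl "\<star>" 70) where
  "p \<star> Perm a b c d e f g = Perm (ap p a) (ap p b) (ap p c) (ap p d) (ap p e) (ap p f) (ap p g)"

definition pid :: perm where "pid = Perm P0 P1 P2 P3 P4 P5 P6"

fun is_perm :: "perm \<Rightarrow> bool" where
  "is_perm (Perm a b c d e f g) = distinct [a, b, c, d, e, f, g]"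

text \<open>The points are the residues modulo 7: \<open>rot k\<close> is addition of \<open>k\<close> and, below, \<open>scale k\<close> is multiplication by \<open>k\<close>.\<close>

fun rot :: "pt \<Rightarrow> perm" where
  "rot P0 = Perm P0 P1 P2 P3 P4 P5 P6"
| "rot P1 = Perm P1 P2 P3 P4 P5 P6 P0"
| "rot P2 = Perm P2 P3 P4 P5 P6 P0 P1"
| "rot P3 = Perm P3 P4 P5 P6 P0 P1 P2"
| "rot P4 = Perm P4 P5 P6 P0 P1 P2 P3"
| "rot P5 = Perm P5 P6 P0 P1 P2 P3 P4"
| "rot P6 = Perm P6 P0 P1 P2 P3 P4 P5"

fun scale :: "pt \<Rightarrow> perm" where
  "scale P0 = Perm P0 P0 P0 P0 P0 P0 P0"
| "scale P1 = Perm P0 P1 P2 P3 P4 P5 P6"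
| "scale P2 = Perm P0 P2 P4 P6 P1 P3 P5"
| "scale P3 = Perm P0 P3 P6 P2 P5 P1 P4"
| "scale P4 = Perm P0 P4 P1 P5 P2 P6 P3"
| "scale P5 = Perm P0 P5 P3 P1 P6 P4 P2"
| "scale P6 = Perm P0 P6 P5 P4 P3 P2 P1"

definition neg :: "pt \<Rightarrow> pt" where "neg k = ap (scale P6) k"

text \<open>The lines of the Fano plane are \<open>{i, i + 1, i + 3}\<close> modulo 7, and \<open>third i j\<close> is the remaining point of
the line through \<open>i\<close> and \<open>j\<close>. With the default \<open>third i i = i\<close> a permutation is a collineation if and only
if it commutes with \<open>third\<close>, without exceptions.\<close>

fun third_row :: "pt \<Rightarrow> perm" where
  "third_row P0 = Perm P0 P3 P6 P1 P5 P4 P2"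
| "third_row P1 = Perm P3 P1 P4 P0 P2 P6 P5"
| "third_row P2 = Perm P6 P4 P2 P5 P1 P3 P0"
| "third_row P3 = Perm P1 P0 P5 P3 P6 P2 P4"
| "third_row P4 = Perm P5 P2 P1 P6 P4 P0 P3"
| "third_row P5 = Perm P4 P6 P3 P2 P0 P5 P1"
| "third_row P6 = Perm P2 P5 P0 P4 P3 P1 P6"

definition third :: "pt \<Rightarrow> pt \<Rightarrow> pt" where "third i j = ap (third_row i) j"

definition pts :: "pt list" where "pts = [P0, P1, P2, P3, P4, P5, P6]"

definition fano :: "perm \<Rightarrow> bool" where
  "fano p \<longleftrightarrow> (\<forall>i\<in>set pts. \<forall>j\<in>set pts. ap p (third i j) = third (ap p i) (ap p j))"

text \<open>Collineations of the mirror image of the plane, with lines \<open>{i, i - 1, i - 3}\<close>.\<close>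

definition fano' :: "perm \<Rightarrow> bool" where "fano' p \<longleftrightarrow> fano (scale P6 \<star> (p \<star> scale P6))"

text \<open>Search and exhaustion in terms of conditionals: the simplifier does not enter the branches of a
conditional before its condition is decided, so evaluation stops at the first witness or failure.\<close>

fun search :: "('a \<Rightarrow> bool) \<Rightarrow> 'a list \<Rightarrow> bool" where
  "search P [] = False"
| "search P (x # xs) = (if P x then True else search P xs)"

fun every :: "('a \<Rightarrow> bool) \<Rightarrow> 'a list \<Rightarrow> bool" where
  "every P [] = True"
| "every P (x # xs) = (if P x then every P xs else False)"

lemma search_iff: "search P xs \<longleftrightarrow> (\<exists>x\<in>set xs. P x)"
  by (induction xs) auto

lemma every_iff: "every P xs \<longleftrightarrow> (\<forall>x\<in>set xs. P x)"
  by (induction xs) auto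

text \<open>The product \<open>rot i\<^sub>1 \<star> g \<star> rot i\<^sub>2 \<star> g \<star> \<dots>\<close>: certificates that an element lies in the group generated by \<open>rot P1\<close> and \<open>g\<close>.\<close>

fun word :: "pt list \<Rightarrow> perm \<Rightarrow> perm" where
  "word [] g = pid"
| "word (i # w) g = rot i \<star> (g \<star> word w g)"

definition square :: "perm \<Rightarrow> perm" where "square p = p \<star> p"

definition others :: "pt list \<Rightarrow> pt list" where "others xs = filter (\<lambda>x. x \<notin> set xs) pts"

text \<open>The stabilizer of \<open>P0\<close>, a set of representatives for the cosets of the rotations.\<close>

definition perms0 :: "perm list" where
  "perms0 = concat (map (\<lambda>a. concat (map (\<lambda>b. concat (map (\<lambda>c. concat (map (\<lambda>d. concat (map (\<lambda>e.
     map (\<lambda>f. Perm P0 a b c d e f) (others [P0,a,b,c,d,e])) (others [P0,a,b,c,d])))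
        (others [P0,a,b,c]))) (others [P0,a,b]))) (others [P0,a]))) (others [P0]))"

definition fixed_pts :: "perm \<Rightarrow> pt list" where "fixed_pts p = filter (\<lambda>i. ap p i = i) pts"

fun len4 :: "'a list \<Rightarrow> bool" where "len4 [a,b,c,d] = True" | "len4 _ = False"

definition moves_three :: "perm \<Rightarrow> bool" where "moves_three p \<longleftrightarrow> len4 (fixed_pts p)"

definition mults :: "perm list" where "mults = map scale [P1,P2,P3,P4,P5,P6]"

definition three_cycle :: "pt \<Rightarrow> pt \<Rightarrow> pt \<Rightarrow> perm" where
  "three_cycle a b c = table (\<lambda>x. if x = a then b else if x = b then c else if x = c then a else x)"

lemma UNIV_pt: "UNIV = set pts"
proof -
  have "x \<in> set pts" for x by (cases x) (auto simp: pts_def)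
  then show ?thesis by auto
qed

lemma in_pts [simp]: "x \<in> set pts"
  using UNIV_pt by auto

instance pt :: finite
  by standard (simp add: UNIV_pt)

lemma card_pt: "card (UNIV :: pt set) = 7"
  by (simp add: UNIV_pt pts_def)

lemma perm_eqI: "(\<And>x. ap p x = ap q x) \<Longrightarrow> p = q"
proof (cases p; cases q)
  fix a b c d e f g a' b' c' d' e' f' g'
  assume h: "\<And>x. ap p x = ap q x" "p = Perm a b c d e f g" "q = Perm a' b' c' d' e' f' g'"
  show "p = q" using h(1)[of P0] h(1)[of P1] h(1)[of P2] h(1)[of P3] h(1)[of P4] h(1)[of P5] h(1)[of P6]
    by (simp add: h(2,3))
qed

lemma inj_ap: "inj ap"
  by (rule injI, rule perm_eqI) simp

instance perm :: finite
proof
  show "finite (UNIV :: perm set)"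
    by (rule finite_imageD[OF finite inj_ap])
qed

lemma ap_table [simp]: "ap (table f) x = f x"
  by (cases x) (simp_all add: table_def)

lemma ap_pm [simp]: "ap (p \<star> q) x = ap p (ap q x)"
  by (cases q; cases x) simp_all

lemma pm_assoc: "p \<star> q \<star> r = p \<star> (q \<star> r)"
  by (rule perm_eqI) simp

lemma ap_pid [simp]: "ap pid x = x"
  by (cases x) (simp_all add: pid_def)

lemma pid_pm [simp]: "pid \<star> p = p" "p \<star> pid = p"
  by (auto intro: perm_eqI)

lemma is_perm_iff: "is_perm p \<longleftrightarrow> inj (ap p)"
proof (cases p)
  case (Perm a b c d e f g)
  have "is_perm p \<longleftrightarrow> distinct (map (ap p) pts)" by (simp add: Perm pts_def)
  also have "\<dots> \<longleftrightarrow> inj_on (ap p) (set pts)"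
    by (subst distinct_map) (simp add: pts_def)
  finally show ?thesis using UNIV_pt by simp
qed

lemma is_perm_bij: "is_perm p \<longleftrightarrow> bij (ap p)"
  using finite_UNIV_inj_surj[of "ap p"] by (auto simp: is_perm_iff bij_def)

lemma is_perm_pm: "is_perm p \<Longrightarrow> is_perm q \<Longrightarrow> is_perm (p \<star> q)"
  unfolding is_perm_iff by (intro injI) (auto dest!: injD)

lemma is_perm_pid [simp]: "is_perm pid"
  by (simp add: pid_def)

lemma is_perm_rot [simp]: "is_perm (rot i)"
  by (cases i) simp_all

lemma is_perm_table: "inj f \<Longrightarrow> is_perm (table f)"
  unfolding is_perm_iff by (intro injI) (auto dest: injD)

definition pinv :: "perm \<Rightarrow> perm" where "pinv p = table (inv_into UNIV (ap p))"

lemma pinv: assumes "is_perm p"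
  shows "is_perm (pinv p)" "pinv p \<star> p = pid" "p \<star> pinv p = pid"
proof -
  have b: "bij (ap p)" using assms is_perm_bij by simp
  show "is_perm (pinv p)" using b unfolding pinv_def by (intro is_perm_table) (simp add: bij_imp_bij_inv bij_is_inj)
  show "pinv p \<star> p = pid" using b by (intro perm_eqI) (simp add: pinv_def bij_is_inj)
  show "p \<star> pinv p = pid" using b by (intro perm_eqI) (simp add: pinv_def bij_is_surj surj_f_inv_f)
qed

definition permgrp :: "perm set \<Rightarrow> bool" where
  "permgrp Q \<longleftrightarrow> (\<forall>p\<in>Q. is_perm p) \<and> pid \<in> Q \<and> (\<forall>p\<in>Q. \<forall>q\<in>Q. p \<star> q \<in> Q)"

lemma permgrpD: assumes "permgrp Q"
  shows "p \<in> Q \<Longrightarrow> is_perm p" "pid \<in> Q" "p \<in> Q \<Longrightarrow> q \<in> Q \<Longrightarrow> p \<star> q \<in> Q"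
  using assms by (auto simp: permgrp_def)

lemma pm_cancel: "is_perm p \<Longrightarrow> p \<star> q = p \<star> r \<Longrightarrow> q = r"
  by (metis pinv(2) pid_pm(1) pm_assoc)

lemma permgrp_pinv: assumes Q: "permgrp Q" and p: "p \<in> Q" shows "pinv p \<in> Q"
proof -
  have okp: "is_perm p" using permgrpD(1)[OF Q p] .
  have "inj_on (\<lambda>q. p \<star> q) Q" using pm_cancel[OF okp] by (auto intro: inj_onI)
  moreover have "(\<lambda>q. p \<star> q) ` Q \<subseteq> Q" using permgrpD(3)[OF Q p] by auto
  ultimately have "(\<lambda>q. p \<star> q) ` Q = Q" by (intro endo_inj_surj) simp_all
  then obtain q where q: "q \<in> Q" "p \<star> q = pid" using permgrpD(2)[OF Q] by (metis imageE)
  have "q = pinv p" by (rule pm_cancel[OF okp]) (simp add: q pinv(3)[OF okp])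
  then show ?thesis using q by simp
qed

lemma rot_add: "rot i \<star> rot j = rot (ap (rot i) j)"
  by (cases i; cases j) simp_all

lemma rot_P0 [simp]: "rot P0 = pid" by (simp add: pid_def)

lemma ap_rot_P0 [simp]: "ap (rot k) P0 = k" by (cases k) simp_all

lemma rot_neg [simp]: "rot (neg k) \<star> rot k = pid" "rot k \<star> rot (neg k) = pid"
  by (cases k; simp add: neg_def pid_def)+

lemma pinv_rot [simp]: "pinv (rot k) = rot (neg k)"
  by (rule pm_cancel[of "rot k"]) (simp_all add: pinv)

lemma rot_induct: assumes "P pid" "\<And>p. P p \<Longrightarrow> P (rot P1 \<star> p)" shows "P (rot k)"
proof -
  have s: "rot P1 \<star> rot P0 = rot P1" "rot P1 \<star> rot P1 = rot P2" "rot P1 \<star> rot P2 = rot P3"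
    "rot P1 \<star> rot P3 = rot P4" "rot P1 \<star> rot P4 = rot P5" "rot P1 \<star> rot P5 = rot P6" by simp_all
  have "P (rot P0)" using assms(1) by (simp add: pid_def)
  from this assms(2)[OF this] show ?thesis
    using assms(2) s by (cases k) metis+
qed

lemma rot_in: assumes Q: "permgrp Q" and c: "rot P1 \<in> Q" shows "rot k \<in> Q"
  by (rule rot_induct) (use permgrpD[OF Q] c in auto)

text \<open>The rotations have prime order.\<close>

lemma rot_gen: assumes Q: "permgrp Q" and c: "rot k \<in> Q" "k \<noteq> P0" shows "rot P1 \<in> Q"
proof -
  have a: "rot k \<star> q \<in> Q" if "q \<in> Q" for q using permgrpD(3)[OF Q c(1) that] .
  note s = a[OF c(1)] a[OF a[OF c(1)]] a[OF a[OF a[OF c(1)]]] a[OF a[OF a[OF a[OF c(1)]]]]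
    a[OF a[OF a[OF a[OF a[OF c(1)]]]]]
  show ?thesis using c(2) c(1) s by (cases k) (simp_all)
qed

lemma word_in: assumes Q: "permgrp Q" and c: "rot P1 \<in> Q" and g: "g \<in> Q" shows "word w g \<in> Q"
  by (induction w) (use permgrpD[OF Q] rot_in[OF Q c] g in auto)

lemma square_in: "permgrp Q \<Longrightarrow> g \<in> Q \<Longrightarrow> square g \<in> Q"
  by (simp add: square_def permgrpD)

lemma set_others: "x \<in> set (others xs) \<longleftrightarrow> x \<notin> set xs"
  by (simp add: others_def)

lemma concat_mapI: "y \<in> set xs \<Longrightarrow> x \<in> set (h y) \<Longrightarrow> x \<in> set (concat (map h xs))"
  by auto

lemma perms0_complete: assumes "is_perm p" "ap p P0 = P0" shows "p \<in> set perms0"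
proof (cases p)
  case (Perm a b c d e f g)
  then have a: "a = P0" and d: "distinct [P0, b, c, d, e, f, g]" using assms by simp_all
  have m: "b \<in> set (others [P0])" "c \<in> set (others [P0,b])" "d \<in> set (others [P0,b,c])"
    "e \<in> set (others [P0,b,c,d])" "f \<in> set (others [P0,b,c,d,e])" "g \<in> set (others [P0,b,c,d,e,f])"
    using d unfolding set_others by auto
  have "Perm P0 b c d e f g \<in> set perms0"
    unfolding perms0_def
    by (rule concat_mapI[OF m(1)], rule concat_mapI[OF m(2)], rule concat_mapI[OF m(3)],
        rule concat_mapI[OF m(4)], rule concat_mapI[OF m(5)]) (simp only: set_map imageI m(6))
  then show ?thesis by (simp add: Perm a)
qed

lemma to_fix0: assumes "is_perm p" obtains k p' where "p = rot k \<star> p'" "is_perm p'" "ap p' P0 = P0" "p' = rot (neg k) \<star> p"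
proof -
  let ?k = "ap p P0" let ?p = "rot (neg ?k) \<star> p"
  have "p = rot ?k \<star> ?p" by (simp add: pm_assoc[symmetric])
  moreover have "is_perm ?p" using assms by (simp add: is_perm_pm)
  moreover have "ap ?p P0 = P0" by (cases ?k) (simp_all add: neg_def)
  ultimately show ?thesis using that by blast
qed

text \<open>The normalizer of the rotations, that is, the maps \<open>x \<mapsto> a * x + b\<close>. Since \<open>p\<close> is a permutation,
\<open>k\<close> cannot be zero.\<close>

definition Affine :: "perm set" where "Affine = {p. is_perm p \<and> (\<exists>k. p \<star> rot P1 = rot k \<star> p)}"
definition Fano :: "perm set" where "Fano = {p. is_perm p \<and> fano p}"
definition Fano' :: "perm set" where "Fano' = {p. is_perm p \<and> fano' p}"

lemma fano_iff: "fano p \<longleftrightarrow> (\<forall>i j. ap p (third i j) = third (ap p i) (ap p j))"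
  by (auto simp: fano_def)

lemma permgrp_Fano: "permgrp Fano"
  by (auto simp: permgrp_def Fano_def is_perm_pm fano_iff)

lemma scale6_scale6: "scale P6 \<star> scale P6 = pid" by (simp add: pid_def)
lemma is_perm_scale6: "is_perm (scale P6)" by simp
lemma scale6_cancel: "scale P6 \<star> (scale P6 \<star> p) = p" by (simp only: pm_assoc[symmetric] scale6_scale6 pid_pm)

text \<open>Conjugation by \<open>x \<mapsto> - x\<close>; it interchanges the two Fano planes.\<close>

definition flip :: "perm \<Rightarrow> perm" where "flip p = scale P6 \<star> p \<star> scale P6"

lemma flip_flip [simp]: "flip (flip p) = p"
  by (simp only: flip_def pm_assoc scale6_scale6 scale6_cancel pid_pm)
lemma flip_pm: "flip (p \<star> q) = flip p \<star> flip q"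
  by (simp only: flip_def pm_assoc scale6_cancel)
lemma flip_pid [simp]: "flip pid = pid" by (simp add: flip_def pid_def)
lemma flip_rot: "flip (rot k) = rot (neg k)" by (cases k) (simp_all add: flip_def neg_def)
lemma is_perm_flip [simp]: "is_perm (flip p) \<longleftrightarrow> is_perm p"
  by (metis flip_def flip_flip is_perm_scale6 is_perm_pm)
lemma fano'_flip: "fano' p \<longleftrightarrow> fano (flip p)" by (simp add: fano'_def flip_def pm_assoc del: pm.simps)

lemma permgrp_flip: assumes "permgrp Q" shows "permgrp (flip ` Q)"
  using assms unfolding permgrp_def
  by (auto simp: flip_pm[symmetric] image_iff) (metis flip_pid)

lemma Fano'_eq: "Fano' = flip ` Fano"
proof -
  have "p \<in> flip ` Fano" if "p \<in> Fano'" for p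
    using that by (intro image_eqI[of _ _ "flip p"]) (auto simp: Fano'_def Fano_def fano'_flip)
  then show ?thesis by (auto simp: Fano'_def Fano_def fano'_flip)
qed

lemma permgrp_Fano': "permgrp Fano'"
  using permgrp_flip[OF permgrp_Fano] by (simp add: Fano'_eq)

lemma rot_Fano: "rot k \<in> Fano"
proof (rule rot_in[OF permgrp_Fano])
  have "fano (rot P1)" by code_simp
  then show "rot P1 \<in> Fano" by (simp add: Fano_def)
qed

lemma rot_Fano': "rot k \<in> Fano'"
proof -
  have "rot k = flip (rot (neg k))" unfolding flip_rot by (cases k) (simp_all add: neg_def)
  then show ?thesis using rot_Fano[of "neg k"] unfolding Fano'_eq by blast
qed

lemma permgrp_Affine: "permgrp Affine"
proof -
  have r: "\<exists>l. p \<star> rot j = rot l \<star> p" if "p \<star> rot P1 = rot k \<star> p" for p k j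
  proof (rule rot_induct[where P="\<lambda>q. \<exists>l. p \<star> q = rot l \<star> p"])
    show "\<exists>l. p \<star> pid = rot l \<star> p" by (rule exI[of _ P0]) (simp only: rot_P0 pid_pm)
    fix q assume "\<exists>l. p \<star> q = rot l \<star> p"
    then obtain l where l: "p \<star> q = rot l \<star> p" by blast
    have "p \<star> (rot P1 \<star> q) = (p \<star> rot P1) \<star> q" by (simp only: pm_assoc)
    also have "\<dots> = rot k \<star> (p \<star> q)" by (simp only: that pm_assoc)
    also have "\<dots> = rot k \<star> rot l \<star> p" by (simp only: l pm_assoc)
    finally show "\<exists>l. p \<star> (rot P1 \<star> q) = rot l \<star> p" by (metis rot_add)
  qed
  have "p \<star> q \<in> Affine" if pq: "p \<in> Affine" "q \<in> Affine" for p q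
  proof -
    obtain k l where k: "p \<star> rot P1 = rot k \<star> p" and l: "q \<star> rot P1 = rot l \<star> q"
      using pq by (auto simp: Affine_def)
    obtain m where m: "p \<star> rot l = rot m \<star> p" using r[OF k] by blast
    have "p \<star> q \<star> rot P1 = p \<star> rot l \<star> q" by (simp only: pm_assoc l)
    also have "\<dots> = rot m \<star> (p \<star> q)" by (simp only: m pm_assoc)
    finally show ?thesis using pq by (auto simp: Affine_def is_perm_pm simp del: pm.simps)
  qed
  moreover have "pid \<in> Affine" using pid_pm unfolding Affine_def by (auto simp del: rot.simps)
  ultimately show ?thesis by (auto simp: permgrp_def Affine_def)
qed

lemma rot_Affine: "rot k \<in> Affine"
  by (rule rot_in[OF permgrp_Affine]) (auto simp: Affine_def simp del: rot.simps)

lemma mults_Affine: "p \<in> set mults \<Longrightarrow> p \<in> Affine"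
proof -
  have "every (\<lambda>p. is_perm p \<and> search (\<lambda>k. p \<star> rot P1 = rot k \<star> p) pts) mults" by code_simp
  then show "p \<in> set mults \<Longrightarrow> p \<in> Affine" by (auto simp: Affine_def every_iff search_iff)
qed

lemma Affine_fix0: "p \<in> Affine \<Longrightarrow> ap p P0 = P0 \<Longrightarrow> p \<in> set mults"
proof -
  assume p: "p \<in> Affine" "ap p P0 = P0"
  then obtain k where k: "p \<star> rot P1 = rot k \<star> p" and is_perm: "is_perm p" by (auto simp: Affine_def)
  have s: "ap p (ap (rot P1) x) = ap (rot k) (ap p x)" for x
    using k ap_pm[of p "rot P1" x] by simp
  have e: "ap p P1 = k" using s[of P0] p(2) by simp
  have "p = scale k"
    using s[of P0] s[of P1] s[of P2] s[of P3] s[of P4] s[of P5] s[of P6] p(2)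
    by (cases p; cases k) simp_all
  moreover have "k \<noteq> P0" using is_perm e p(2) injD[of "ap p" P1 P0] by (auto simp: is_perm_iff) 
  ultimately show ?thesis by (cases k) (simp_all add: mults_def)
qed

section \<open>Transitive permutation groups of degree seven\<close>

text \<open>For every permutation \<open>g\<close> fixing \<open>P0\<close> that is neither affine nor a collineation of one of the two planes, the
fourth power of one of these words in the rotation and \<open>g\<close> is a 3-cycle. (The fourth power turns an
element of cycle type 3, 3+2, 3+2+2 or 3+4 into a 3-cycle.)\<close>

definition three_words :: "pt list list" where
 "three_words = [[P0],[P1],[P3],[P2],[P2,P2,P5],[P0,P3],[P1,P5],[P5],[P0,P0,P3],[P4,P5],[P2,P3,P4],
    [P2,P4,P3],[P0,P0,P1],[P1,P2,P5],[P4,P6,P5],[P2,P5],[P1,P4],[P5,P6]]"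

lemma generic_check: "every (\<lambda>g. if search (\<lambda>w. moves_three (square (square (word w g)))) three_words then True else
    if fano g then True else if fano' g then True else g \<in> set mults) perms0"
  by code_simp

text \<open>Multiplying by a rotation moves the given element into the stabilizer of \<open>P0\<close> without leaving the group or
entering one of the three excluded groups, all of which contain the rotations.\<close>

lemma generic: assumes Q: "permgrp Q" "rot P1 \<in> Q" and g: "g \<in> Q" "g \<notin> Affine" "g \<notin> Fano" "g \<notin> Fano'"
  shows "\<exists>t\<in>Q. moves_three t"
proof -
  obtain k g' where g': "g = rot k \<star> g'" "is_perm g'" "ap g' P0 = P0" "g' = rot (neg k) \<star> g"
    using to_fix0[OF permgrpD(1)[OF Q(1) g(1)]] by blast
  have inQ: "g' \<in> Q" using g' permgrpD(3)[OF Q(1)] rot_in[OF Q] g(1) by simp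
  have "g' \<notin> Affine" using g(2) g'(1) permgrpD(3)[OF permgrp_Affine] rot_Affine by auto
  moreover have "g' \<notin> Fano" using g(3) g'(1) permgrpD(3)[OF permgrp_Fano] rot_Fano by auto
  moreover have "g' \<notin> Fano'" using g(4) g'(1) permgrpD(3)[OF permgrp_Fano'] rot_Fano' by auto
  ultimately have "search (\<lambda>w. moves_three (square (square (word w g')))) three_words"
    using generic_check perms0_complete[OF g'(2,3)] g'(2) mults_Affine
    unfolding every_iff Fano_def Fano'_def by (metis (no_types, lifting) mem_Collect_eq)
  then show ?thesis using square_in[OF Q(1)] word_in[OF Q inQ] unfolding search_iff by blast
qed

text \<open>An involutory collineation which generates the collineation group together with the rotation.\<close>

definition invol :: perm where "invol = Perm P0 P6 P3 P2 P4 P5 P1"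

text \<open>Words for the 24 collineations that fix \<open>P0\<close>.\<close>

definition fano_words :: "pt list list" where "fano_words =
  [[],[P0],[P1,P1],[P2,P5],[P3,P4],[P4,P2],[P5,P3],[P6,P6],[P0,P1,P1],[P0,P3,P4],[P0,P4,P2],
   [P0,P6,P6],[P1,P3,P5],[P1,P4,P4],[P1,P6,P3],[P2,P3,P3],[P2,P6,P1],[P3,P3,P6],[P3,P6,P5],
   [P4,P3,P1],[P4,P6,P2],[P5,P6,P4],[P0,P1,P4,P4],[P0,P3,P6,P5]]"

definition stab0 :: "perm list" where "stab0 = map (\<lambda>w. word w invol) fano_words"

text \<open>Words that recover the involution from any collineation fixing \<open>P0\<close> outside the affine group.\<close>

definition invol_words :: "pt list list" where "invol_words =
  [[P4,P4],[P0],[P6,P2,P3],[P1,P1,P5,P3],[P2,P3,P1,P0],[P3,P0,P5,P0],[P3,P1,P0,P4],[P6,P2,P3,P3],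
   [P6,P2,P6,P2],[P0,P1,P6],[P0,P2,P4],[P1,P5,P4],[P4,P3,P0]]"

lemma stab0_complete_check: "set (filter fano perms0) = set stab0"
  by code_simp
lemma stab0_check: "every (\<lambda>g. if g \<in> set mults then True else search (\<lambda>w. word w g = invol) invol_words) stab0"
  by code_simp
lemma stab0_facts: "every (\<lambda>g. is_perm g \<and> fano g \<and> ap g P0 = P0) stab0" "distinct stab0"
  by code_simp+
lemma fano'_check: "every (\<lambda>g. if fano g then True else
   search (\<lambda>x. search (\<lambda>i. moves_three (square (square (g \<star> (rot i \<star> x))))) pts) stab0) (mults @ filter fano' perms0)"
  by code_simp

lemma Fano_decomp: assumes "p \<in> Fano" obtains k x where "p = rot k \<star> x" "x \<in> set stab0"
proof -
  have "is_perm p" using assms by (simp add: Fano_def)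
  then obtain k x where x: "p = rot k \<star> x" "is_perm x" "ap x P0 = P0" "x = rot (neg k) \<star> p"
    using to_fix0 by blast
  have "x \<in> Fano" using x(4) assms permgrpD(3)[OF permgrp_Fano] rot_Fano by auto
  then have "x \<in> set stab0" using stab0_complete_check perms0_complete[OF x(2,3)]
    by (auto simp: Fano_def)
  then show ?thesis using that x(1) by blast
qed

lemma Fano_gen: assumes Q: "permgrp Q" "rot P1 \<in> Q" "invol \<in> Q" shows "Fano \<subseteq> Q"
proof
  fix p assume "p \<in> Fano"
  then obtain k x where x: "p = rot k \<star> x" "x \<in> set stab0" by (rule Fano_decomp)
  have "x \<in> Q" using x(2) word_in[OF Q] by (auto simp: stab0_def)
  then show "p \<in> Q" using x(1) permgrpD(3)[OF Q(1)] rot_in[OF Q(1,2)] by simp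
qed

lemma invol_Fano: "invol \<in> Fano"
proof -
  have "is_perm invol \<and> fano invol" by code_simp
  then show ?thesis by (simp add: Fano_def)
qed

text \<open>Apart from groups of affine maps, the collineation group has no proper subgroup containing the rotation.\<close>

lemma Fano_sub: assumes Q: "permgrp Q" "rot P1 \<in> Q" and g: "g \<in> Q" "g \<in> Fano" "g \<notin> Affine"
  shows "Fano \<subseteq> Q"
proof -
  obtain k x where x: "g = rot k \<star> x" "x \<in> set stab0" using g(2) by (rule Fano_decomp)
  have "x = rot (neg k) \<star> g" by (simp add: x(1) pm_assoc[symmetric])
  then have xQ: "x \<in> Q" using g(1) permgrpD(3)[OF Q(1)] rot_in[OF Q] by simp
  have "x \<notin> Affine" using g(3) x(1) permgrpD(3)[OF permgrp_Affine] rot_Affine by auto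
  then have "search (\<lambda>w. word w x = invol) invol_words"
    using stab0_check x(2) mults_Affine unfolding every_iff by metis
  then have "invol \<in> Q" using word_in[OF Q xQ] unfolding search_iff by metis
  then show ?thesis using Fano_gen[OF Q] by simp
qed

text \<open>A generic element is covered by \<open>generic\<close>. The affine maps and the collineations of the other plane need a
separate search: there the 3-cycle is a fourth power in the coset of the collineation group.\<close>

lemma Fano_max: assumes Q: "permgrp Q" "rot P1 \<in> Q" "Fano \<subseteq> Q" and h: "h \<in> Q" "h \<notin> Fano"
  shows "\<exists>t\<in>Q. moves_three t"
proof (cases "h \<in> Affine \<or> h \<in> Fano'")
  case False
  then show ?thesis using generic[OF Q(1,2) h(1)] h(2) by blast
next
  case True
  obtain k h' where h': "h = rot k \<star> h'" "is_perm h'" "ap h' P0 = P0" "h' = rot (neg k) \<star> h"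
    using to_fix0[OF permgrpD(1)[OF Q(1) h(1)]] by blast
  have inQ: "h' \<in> Q" using h' permgrpD(3)[OF Q(1)] rot_in[OF Q(1,2)] h(1) by simp
  have n: "h' \<notin> Fano" using h(2) h'(1) permgrpD(3)[OF permgrp_Fano] rot_Fano by auto
  have "h' \<in> Affine \<or> h' \<in> Fano'"
    using True h'(4) permgrpD(3)[OF permgrp_Affine] rot_Affine permgrpD(3)[OF permgrp_Fano'] rot_Fano' by auto
  then have "h' \<in> set mults \<or> fano' h'" using Affine_fix0 h'(3) by (auto simp: Fano'_def)
  moreover have "\<not> fano h'" using n h'(2) by (simp add: Fano_def)
  ultimately have "search (\<lambda>x. search (\<lambda>i. moves_three (square (square (h' \<star> (rot i \<star> x))))) pts) stab0"
    using fano'_check perms0_complete[OF h'(2,3)] unfolding every_iff set_append set_filter by auto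
  then obtain x i where x: "x \<in> set stab0" "moves_three (square (square (h' \<star> (rot i \<star> x))))"
    by (auto simp: search_iff)
  have "x \<in> Q" using x(1) stab0_facts(1) Q(3) by (auto simp: every_iff Fano_def)
  then have "square (square (h' \<star> (rot i \<star> x))) \<in> Q"
    using inQ rot_in[OF Q(1,2)] by (intro square_in[OF Q(1)] permgrpD(3)[OF Q(1)]) auto
  then show ?thesis using x(2) by blast
qed

definition three_reps :: "perm list" where "three_reps =
  [Perm P0 P1 P2 P3 P5 P6 P4, Perm P0 P1 P2 P3 P6 P4 P5, Perm P0 P1 P2 P4 P6 P5 P3,
   Perm P0 P1 P2 P5 P4 P6 P3, Perm P0 P1 P2 P6 P3 P5 P4, Perm P0 P1 P2 P6 P4 P3 P5,
   Perm P0 P1 P3 P6 P4 P5 P2, Perm P0 P1 P4 P3 P6 P5 P2, Perm P0 P1 P6 P2 P4 P5 P3,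
   Perm P0 P1 P6 P3 P2 P5 P4]"
definition three0 :: perm where "three0 = Perm P0 P1 P2 P3 P5 P6 P4"
text \<open>Words that lead from every 3-cycle, up to conjugation by rotations, to \<open>three0\<close>, and back.\<close>

definition to_three0 :: "pt list list" where "to_three0 = [[P0],[P0,P0],[P4,P1,P2,P6],[P0,P6,P2,P1,P4],
  [P0,P4,P1,P4],[P1,P0,P3,P6,P5],[P1,P4,P1,P5,P1],[P2,P1,P3,P3,P1],[P0,P5,P4,P2],[P0,P3,P4,P5,P2]]"
definition from_three0 :: "pt list list" where "from_three0 = [[P0],[P0,P0],[P2,P4],[P1,P2,P3],[P2,P3,P1],
  [P6,P1,P0],[P0,P0,P5,P2],[P0,P0,P6,P1],[P6,P1,P5,P2],[P0,P1,P2,P3,P0]]"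

definition threes :: "perm set" where "threes = {three_cycle a b c | a b c. distinct [a,b,c]}"

definition three_list :: "perm list" where "three_list = concat
  (map (\<lambda>a. concat (map (\<lambda>b. map (three_cycle a b) (others [a,b])) (others [a]))) pts)"

lemma threes_list: "threes = set three_list"
proof
  show "threes \<subseteq> set three_list"
  proof
    fix t assume "t \<in> threes"
    then obtain a b c where t: "t = three_cycle a b c" and d: "distinct [a, b, c]" by (auto simp: threes_def)
    have m: "a \<in> set pts" "b \<in> set (others [a])" "c \<in> set (others [a,b])"
      using d unfolding set_others by auto
    show "t \<in> set three_list" unfolding three_list_def t
      by (rule concat_mapI[OF m(1)], rule concat_mapI[OF m(2)]) (simp only: set_map imageI m(3))
  qed
  show "set three_list \<subseteq> threes"
    unfolding three_list_def threes_def by (auto simp: set_others) (metis)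
qed

lemma threes_reps_check: "every (\<lambda>t. search (\<lambda>k. rot k \<star> (t \<star> rot (neg k)) \<in> set three_reps) pts)
   three_list"
  by code_simp

lemma reps_check: "every (\<lambda>t. search (\<lambda>w. word w t = three0) to_three0 \<and> search (\<lambda>w. word w three0 = t) from_three0) three_reps"
  by code_simp

lemma fix0_three_cycle_check: "every (\<lambda>t. t \<in> set three_list) (filter moves_three perms0)"
  by code_simp

lemma threes_conj: assumes "t \<in> threes" "is_perm p" shows "p \<star> t \<star> pinv p \<in> threes"
proof -
  obtain a b c where t: "t = three_cycle a b c" and d: "distinct [a,b,c]" using assms(1) by (auto simp: threes_def)
  have inj: "inj (ap p)" using assms(2) is_perm_iff by simp
  have "p \<star> t = three_cycle (ap p a) (ap p b) (ap p c) \<star> p"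
    by (rule perm_eqI) (auto simp: t three_cycle_def inj_eq[OF inj])
  then have "p \<star> t \<star> pinv p = three_cycle (ap p a) (ap p b) (ap p c)"
    using assms(2) by (simp only: pm_assoc pinv pid_pm)
  moreover have "distinct [ap p a, ap p b, ap p c]" using d by (auto simp: inj_eq[OF inj])
  ultimately show ?thesis unfolding threes_def by blast
qed

lemma threes_gen1: assumes Q: "permgrp Q" "rot P1 \<in> Q" "three0 \<in> Q" shows "threes \<subseteq> Q"
proof
  fix t assume "t \<in> threes"
  then obtain k where k: "rot k \<star> (t \<star> rot (neg k)) \<in> set three_reps" (is "?r \<in> _")
    using threes_reps_check unfolding threes_list every_iff search_iff by blast
  have "?r \<in> Q" using reps_check k word_in[OF Q] unfolding every_iff search_iff by metis
  moreover have "t = rot (neg k) \<star> ?r \<star> rot k"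
    by (metis pm_assoc pid_pm rot_neg)
  ultimately show "t \<in> Q" using permgrpD(3)[OF Q(1)] rot_in[OF Q(1,2)] by metis
qed

lemma threes_gen: assumes Q: "permgrp Q" "rot P1 \<in> Q" and t: "t \<in> Q" "t \<in> threes" shows "threes \<subseteq> Q"
proof -
  obtain k where k: "rot k \<star> (t \<star> rot (neg k)) \<in> set three_reps" (is "?r \<in> _")
    using threes_reps_check t(2) unfolding threes_list every_iff search_iff by blast
  have r: "?r \<in> Q" using permgrpD(3)[OF Q(1)] rot_in[OF Q(1,2)] t(1) by simp
  have "three0 \<in> Q" using reps_check k word_in[OF Q(1,2) r] unfolding every_iff search_iff by metis
  then show ?thesis by (rule threes_gen1[OF Q(1,2)])
qed

lemma is_three_cycle: assumes "is_perm t" "moves_three t" shows "t \<in> threes"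
proof -
  have "fixed_pts t \<noteq> []" using assms(2) by (auto simp: moves_three_def)
  then obtain i where i: "ap t i = i" by (auto simp: fixed_pts_def filter_empty_conv)
  let ?t = "rot (neg i) \<star> t \<star> rot i"
  have t: "t = rot i \<star> ?t \<star> rot (neg i)" by (metis pm_assoc pid_pm rot_neg)
  have is_perm: "is_perm ?t" using assms(1) by (simp add: is_perm_pm)
  have i0: "ap ?t P0 = P0" using i by simp (cases i; simp add: neg_def)
  have fx: "set (fixed_pts ?t) = ap (rot (neg i)) ` set (fixed_pts t)"
  proof -
    have z: "ap (rot (neg i)) (ap (rot i) x) = x" "ap (rot i) (ap (rot (neg i)) x) = x" for x
      by (metis ap_pm ap_pid rot_neg)+
    show ?thesis by (auto simp: fixed_pts_def image_iff) (metis z)+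
  qed
  have d: "distinct (fixed_pts q)" for q by (simp add: fixed_pts_def pts_def)
  have "inj_on (ap (rot (neg i))) A" for A using is_perm_rot[of "neg i"] by (auto simp: is_perm_iff intro: inj_on_subset)
  then have "card (set (fixed_pts ?t)) = card (set (fixed_pts t))" using fx card_image by metis
  then have l: "length (fixed_pts ?t) = length (fixed_pts t)" using d distinct_card by metis
  have l4: "len4 xs \<longleftrightarrow> length xs = 4" for xs :: "'b list"
    by (induction xs rule: len4.induct) auto
  have "moves_three ?t" using assms(2) l by (simp add: moves_three_def l4)
  then have "?t \<in> threes" using fix0_three_cycle_check perms0_complete[OF is_perm i0]
    unfolding every_iff threes_list by auto
  then have "rot i \<star> ?t \<star> pinv (rot i) \<in> threes" by (rule threes_conj) simp
  then show ?thesis using t by simp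
qed

text \<open>Together with a 7-cycle, one 3-cycle generates all 3-cycles.\<close>

lemma moves_three_threes: assumes Q: "permgrp Q" "rot P1 \<in> Q" "t \<in> Q" "moves_three t" shows "threes \<subseteq> Q"
  using threes_gen[OF Q(1-3) is_three_cycle] Q permgrpD(1) by blast

lemma flip_Affine: "p \<in> Affine \<Longrightarrow> flip p \<in> Affine"
  using permgrpD(3)[OF permgrp_Affine] mults_Affine[of "scale P6"] unfolding flip_def mults_def
  by (simp del: pm.simps scale.simps)

text \<open>If the group contains no 3-cycle, each of its elements is affine or a collineation of one of the planes. As
soon as a non-affine collineation of one plane occurs, the whole collineation group does, and by
maximality nothing else. The second plane follows from the first by reversal.\<close>

theorem classification: assumes Q: "permgrp Q" "rot P1 \<in> Q"
  shows "Q \<subseteq> Affine \<or> Q = Fano \<or> Q = Fano' \<or> threes \<subseteq> Q"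
proof (cases "\<exists>t\<in>Q. moves_three t")
  case True
  then show ?thesis using moves_three_threes[OF Q] by blast
next
  case False
  let ?F = "flip ` Q"
  have F: "permgrp ?F" "rot P1 \<in> ?F"
  proof -
    show "permgrp ?F" by (rule permgrp_flip[OF Q(1)])
    have "flip (rot P6) \<in> ?F" using rot_in[OF Q] by blast
    then show "rot P1 \<in> ?F" by (simp add: flip_rot neg_def del: rot.simps)
  qed
  have noF: "\<not> (\<exists>t\<in>?F. moves_three t)"
  proof
    assume "\<exists>t\<in>?F. moves_three t"
    then obtain t where t: "t \<in> Q" "moves_three (flip t)" by auto
    then have "flip t \<in> threes" using is_three_cycle permgrpD(1)[OF Q(1)] by simp
    then have "scale P6 \<star> flip t \<star> pinv (scale P6) \<in> threes" by (rule threes_conj) simp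
    moreover have "pinv (scale P6) = scale P6"
      by (rule pm_cancel[OF is_perm_scale6]) (simp only: scale6_scale6 pinv(3)[OF is_perm_scale6])
    ultimately have "t \<in> threes" by (simp add: flip_def pm_assoc scale6_scale6 scale6_cancel del: pm.simps scale.simps)
    moreover have "every moves_three three_list"
      by code_simp
    ultimately show False using False t(1) unfolding threes_list every_iff by blast
  qed
  consider (n) "Q \<subseteq> Affine" | (f) g where "g \<in> Q" "g \<in> Fano" "g \<notin> Affine"
    | (f') g where "g \<in> Q" "g \<in> Fano'" "g \<notin> Affine"
    using generic[OF Q] False by blast
  then show ?thesis
  proof cases
    case n then show ?thesis by simp
  next
    case f
    have "Fano \<subseteq> Q" by (rule Fano_sub[OF Q f])
    then show ?thesis using Fano_max[OF Q] False by blast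
  next
    case f'
    have "flip g \<in> ?F" "flip g \<in> Fano" "flip g \<notin> Affine"
      using f' flip_Affine[of "flip g"] by (auto simp: Fano'_def Fano_def fano'_flip)
    then have s: "Fano \<subseteq> ?F" by (rule Fano_sub[OF F])
    then have "?F = Fano" using Fano_max[OF F] noF by blast
    then have "Q = flip ` Fano" by (metis (no_types, lifting) flip_flip image_image image_ident image_cong)
    then show ?thesis by (simp add: Fano'_eq)
  qed
qed


declare rot.simps [simp del] scale.simps [simp del] pm.simps [simp del]

lemma neg_simps [simp]: "neg P0 = P0" "neg P1 = P6" "neg P2 = P5" "neg P3 = P4" "neg P4 = P3" "neg P5 = P2"
  "neg P6 = P1"
  by (simp_all add: neg_def scale.simps)

lemma pinv_pid [simp]: "pinv pid = pid" using pinv_rot[of P0] by simp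

lemma pinv_pm_eq: "is_perm p \<Longrightarrow> p \<star> q = r \<longleftrightarrow> q = pinv p \<star> r"
  by (metis pinv(2) pinv(3) pid_pm(1) pm_assoc)

section \<open>Normal subgroups of transitive groups\<close>

lemma transitive_card: assumes B: "permgrp B" and tr: "\<And>x. \<exists>p\<in>B. ap p P0 = x"
  shows "card B = 7 * card {p\<in>B. ap p P0 = P0}"
proof -
  let ?f = "\<lambda>x. {p\<in>B. ap p P0 = x}"
  have "card (?f x) = card (?f P0)" for x
  proof -
    obtain q where q: "q \<in> B" "ap q P0 = x" using tr by blast
    have okq: "is_perm q" using permgrpD(1)[OF B q(1)] .
    have "bij_betw (\<lambda>p. q \<star> p) (?f P0) (?f x)"
    proof (rule bij_betw_byWitness[where f'="\<lambda>p. pinv q \<star> p"])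
      show "(\<star>) q ` ?f P0 \<subseteq> ?f x" using q permgrpD(3)[OF B] by auto
      have "ap (pinv q) x = P0" using q(2) pinv(2)[OF okq] by (metis ap_pid ap_pm)
      then show "(\<star>) (pinv q) ` ?f x \<subseteq> ?f P0" using permgrp_pinv[OF B q(1)] permgrpD(3)[OF B] by auto
    qed (simp_all add: pm_assoc[symmetric] pinv[OF okq])
    then show ?thesis by (simp add: bij_betw_same_card)
  qed
  moreover have "card B = (\<Sum>x\<in>UNIV. card (?f x))"
  proof -
    have "B = (\<Union>x\<in>UNIV. ?f x)" by auto
    moreover have "card (\<Union>x\<in>UNIV. ?f x) = (\<Sum>x\<in>UNIV. card (?f x))"
      by (rule card_UN_disjoint) auto
    ultimately show ?thesis by simp
  qed
  moreover have "(\<Sum>x\<in>UNIV. card (?f x)) = (\<Sum>x\<in>(UNIV :: pt set). card (?f P0))"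
    using calculation(1) by (intro sum.cong) blast+
  ultimately show ?thesis by (simp add: card_pt)
qed

lemma rot_transitive: assumes "permgrp B" "rot P1 \<in> B" shows "\<exists>p\<in>B. ap p P0 = x"
  using rot_in[OF assms, of x] ap_rot_P0 by blast

text \<open>The orbits of \<open>B\<close> are permuted by the 7-cycle, so that they form blocks of prime degree: some \<open>y\<close> and
\<open>y + k\<close> with \<open>k \<noteq> 0\<close> lie in one orbit, and after a rotation the orbit of \<open>P0\<close> is closed under adding \<open>k\<close>.\<close>

lemma normalized_transitive:
  assumes B: "permgrp B" and n: "\<And>p. p \<in> B \<Longrightarrow> rot P1 \<star> p \<star> rot P6 \<in> B"
    and p: "p \<in> B" "p \<noteq> pid"
  shows "\<exists>q\<in>B. ap q P0 = x"
proof -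
  have nk: "rot k \<star> q \<star> rot (neg k) \<in> B" if q: "q \<in> B" for k q
  proof -
    have "\<forall>q\<in>B. pk \<star> q \<star> pinv pk \<in> B \<and> is_perm pk" if "pk = rot k" for pk k
      unfolding that
    proof (rule rot_induct)
      show "\<forall>q\<in>B. pid \<star> q \<star> pinv pid \<in> B \<and> is_perm pid"
        by simp
      fix r assume h: "\<forall>q\<in>B. r \<star> q \<star> pinv r \<in> B \<and> is_perm r"
      then have okr: "is_perm r" using permgrpD(2)[OF B] by blast
      have ok1: "is_perm (rot P1 \<star> r)" by (rule is_perm_pm[OF is_perm_rot okr])
      have "pinv (rot P1 \<star> r) = pinv r \<star> rot P6"
      proof (rule pm_cancel[OF ok1])
        have "rot P1 \<star> r \<star> (pinv r \<star> rot P6) = rot P1 \<star> (r \<star> pinv r) \<star> rot P6" by (simp only: pm_assoc)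
        also have "\<dots> = pid" using rot_neg(2)[of P1] by (simp add: pinv[OF okr])
        finally show "rot P1 \<star> r \<star> pinv (rot P1 \<star> r) = rot P1 \<star> r \<star> (pinv r \<star> rot P6)"
          using pinv(3)[OF ok1] by simp
      qed
      then have "rot P1 \<star> r \<star> q \<star> pinv (rot P1 \<star> r) = rot P1 \<star> (r \<star> q \<star> pinv r) \<star> rot P6" for q
        by (simp only: pm_assoc)
      then show "\<forall>q\<in>B. rot P1 \<star> r \<star> q \<star> pinv (rot P1 \<star> r) \<in> B \<and> is_perm (rot P1 \<star> r)"
        using h n ok1 by auto
    qed
    then show ?thesis using q pinv_rot by metis
  qed
  obtain y where y: "ap p y \<noteq> y" using p(2) perm_eqI[of p pid] by auto
  define r where "r = rot (neg y) \<star> p \<star> rot (neg (neg y))"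
  have nn: "neg (neg y) = y" by (cases y) simp_all
  have r: "r \<in> B" using nk[OF p(1)] by (simp add: r_def)
  have z: "ap (rot y) (ap (rot (neg y)) x) = x" for x by (metis ap_pm ap_pid rot_neg(2))
  define k where "k = ap r P0"
  have k: "k \<noteq> P0"
  proof
    assume "k = P0"
    then have "ap (rot (neg y)) (ap p y) = P0" by (simp add: k_def r_def nn)
    then have "ap p y = ap (rot y) P0" using z by metis
    then show False using y by simp
  qed
  \<comment> \<open>iterating the step from \<open>P0\<close> reaches all multiples of \<open>k\<close>\<close>
  let ?O = "{x. \<exists>q\<in>B. ap q P0 = x}"
  have step: "ap (rot k) x \<in> ?O" if "x \<in> ?O" for x
  proof -
    obtain q where q: "q \<in> B" "ap q P0 = x" using \<open>x \<in> ?O\<close> by auto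
    let ?q = "rot k \<star> q \<star> rot (neg k)"
    have "?q \<star> r \<in> B" using nk[OF q(1)] r permgrpD(3)[OF B] by blast
    moreover have "ap (rot (neg k)) k = P0" by (cases k) (simp_all add: rot.simps)
    then have "ap (?q \<star> r) P0 = ap (rot k) x" by (simp add: k_def[symmetric] q(2))
    ultimately show ?thesis by blast
  qed
  have "P0 \<in> ?O" using permgrpD(2)[OF B] ap_pid by blast
  note s0 = this step[OF this]
  note s1 = s0(2) step[OF s0(2)]
  note oct_lift = s1(2) step[OF s1(2)]
  note s3 = oct_lift(2) step[OF oct_lift(2)]
  note s4 = s3(2) step[OF s3(2)]
  note s5 = s4(2) step[OF s4(2)]
  have "x \<in> ?O" using k s0(1) s0(2) s1(2) oct_lift(2) s3(2) s4(2) s5(2)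
    by (cases k; cases x) (simp_all only: ap.simps rot.simps simp_thms)
  then show ?thesis by blast
qed

lemma involution_fixes: assumes "is_perm p" "p \<star> p = pid" shows "\<exists>x. ap p x = x"
proof -
  obtain k p' where k: "p = rot k \<star> p'" "is_perm p'" "ap p' P0 = P0" by (rule to_fix0[OF assms(1)])
  have "every (\<lambda>g. every (\<lambda>k. if square (rot k \<star> g) = pid then fixed_pts (rot k \<star> g) \<noteq> [] else True) pts) perms0"
    by code_simp
  then have "fixed_pts p \<noteq> []" using perms0_complete[OF k(2,3)] assms(2) k(1) unfolding every_iff square_def
    by (metis in_pts)
  then show ?thesis by (auto simp: fixed_pts_def filter_empty_conv)
qed

text \<open>A group of exponent 2 is abelian, and an involution fixes one of the seven points. By commutativity it then
fixes the whole orbit of that point, which would be everything.\<close>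

lemma normalized_exponent2:
  assumes B: "permgrp B" and n: "\<And>p. p \<in> B \<Longrightarrow> rot P1 \<star> p \<star> rot P6 \<in> B"
    and e: "\<And>p. p \<in> B \<Longrightarrow> p \<star> p = pid"
  shows "B = {pid}"
proof -
  have com: "p \<star> q = q \<star> p" if "p \<in> B" "q \<in> B" for p q
  proof -
    have "p \<star> (p \<star> q \<star> (p \<star> q)) \<star> q = p \<star> q" using e permgrpD(3)[OF B that] by simp
    moreover have "p \<star> (p \<star> q \<star> (p \<star> q)) \<star> q = (p \<star> p) \<star> (q \<star> p) \<star> (q \<star> q)" by (simp only: pm_assoc)
    ultimately show ?thesis using e that by simp
  qed
  have "p = pid" if p: "p \<in> B" for p
  proof (rule ccontr)
    assume np: "p \<noteq> pid"
    obtain y where y: "ap p y = y" using involution_fixes permgrpD(1)[OF B p] e[OF p] by blast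
    have tr: "\<exists>q\<in>B. ap q P0 = x" for x by (rule normalized_transitive[OF B n p np])
    obtain q0 where q0: "q0 \<in> B" "ap q0 P0 = y" using tr by blast
    have "ap p x = x" for x
    proof -
      obtain q where q: "q \<in> B" "ap q P0 = x" using tr by blast
      define s where "s = q \<star> pinv q0"
      have s: "s \<in> B" using q(1) permgrp_pinv[OF B q0(1)] permgrpD(3)[OF B] by (simp add: s_def)
      have "ap (pinv q0) y = P0" using q0 pinv(2)[OF permgrpD(1)[OF B q0(1)]] by (metis ap_pid ap_pm)
      then have sy: "ap s y = x" by (simp add: s_def q(2))
      have "ap p (ap s y) = ap s (ap p y)" using com[OF p s] by (metis ap_pm)
      then show ?thesis by (simp add: sy y)
    qed
    then show False using np perm_eqI[of p pid] by simp
  qed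
  then show ?thesis using permgrpD(2)[OF B] by blast
qed

lemma card_Fano: "card Fano = 168"
proof -
  have s: "{p\<in>Fano. ap p P0 = P0} = set stab0"
    using stab0_complete_check stab0_facts(1) perms0_complete unfolding Fano_def every_iff by auto
  have "length stab0 = 24" by (simp add: stab0_def fano_words_def)
  then have "card (set stab0) = 24" using distinct_card[OF stab0_facts(2)] by simp
  then show ?thesis using transitive_card[OF permgrp_Fano rot_transitive[OF permgrp_Fano rot_Fano]] s by simp
qed

lemma three0_threes: "three0 \<in> threes"
  by (rule is_three_cycle) (simp_all add: three0_def moves_three_def fixed_pts_def pts_def)

lemma three0_not_Fano: "three0 \<notin> Fano"
proof -
  have "\<not> fano three0" by code_simp
  then show ?thesis by (simp add: Fano_def)
qed

lemma card_Fano': "card Fano' = 168"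
proof -
  have "inj_on flip Fano" by (metis flip_flip inj_onI)
  then show ?thesis by (simp add: Fano'_eq card_image card_Fano)
qed

definition pow12 :: "perm \<Rightarrow> perm" where "pow12 p = (let s = square (square p) in s \<star> (s \<star> s))"

text \<open>Every collineation other than the identity becomes, after multiplication by a suitable nonzero rotation, an element of order dividing 12.\<close>

lemma simple_check: "every (\<lambda>x. every (\<lambda>j. let p = rot j \<star> x in
    if p = pid then True else search (\<lambda>i. pow12 (rot i \<star> p) = pid) [P1,P2,P3,P4,P5,P6]) pts) stab0"
  by code_simp

text \<open>Let \<open>p\<close> be a nontrivial element of the normal subgroup \<open>N\<close>. Modulo \<open>N\<close> the product \<open>rot i \<star> p\<close> equals
\<open>rot i\<close>; if its twelfth power is trivial, then so is \<open>rot i\<close> to the power 12 modulo \<open>N\<close>, and 7 does not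
divide 12. So \<open>N\<close> contains the rotation, and \<open>classification\<close> applies to \<open>N\<close> itself.\<close>

lemma Fano_simple:
  assumes N: "permgrp N" "N \<subseteq> Fano" and n: "\<And>p x. p \<in> N \<Longrightarrow> x \<in> Fano \<Longrightarrow> x \<star> p \<star> pinv x \<in> N"
    and p: "p \<in> N" "p \<noteq> pid"
  shows "N = Fano"
proof -
  have "p \<in> Fano" using N p by blast
  then obtain j x where x: "p = rot j \<star> x" "x \<in> set stab0" by (rule Fano_decomp)
  then have "search (\<lambda>i. pow12 (rot i \<star> p) = pid) [P1,P2,P3,P4,P5,P6]"
    using simple_check p(2) unfolding every_iff Let_def by (metis in_pts)
  then obtain i where i: "i \<noteq> P0" "pow12 (rot i \<star> p) = pid" unfolding search_iff by auto
  \<comment> \<open>modulo N, a product of elements congruent to rotations is congruent to the product\<close>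
  define cg where "cg a k \<longleftrightarrow> (\<exists>u\<in>N. a = u \<star> rot k)" for a k
  have mult: "cg (a \<star> b) (ap (rot k) l)" if ab: "cg a k" "cg b l" for a b k l
  proof -
    obtain u v where uv: "u \<in> N" "a = u \<star> rot k" "v \<in> N" "b = v \<star> rot l" using ab by (auto simp: cg_def)
    have "a \<star> b = u \<star> (rot k \<star> v \<star> pinv (rot k)) \<star> (rot k \<star> rot l)"
      unfolding uv pinv_rot by (metis pm_assoc pid_pm(1) rot_neg(1))
    then show ?thesis using uv n[OF uv(3) rot_Fano] permgrpD(3)[OF N(1)] unfolding cg_def rot_add by blast
  qed
  have "rot i \<star> p = rot i \<star> p \<star> pinv (rot i) \<star> rot i" by (simp only: pm_assoc pinv_rot rot_neg pid_pm)
  then have c1: "cg (rot i \<star> p) i" using n[OF p(1) rot_Fano] unfolding cg_def by blast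
  note c2 = mult[OF c1 c1]
  note c4 = mult[OF c2 c2]
  note c8 = mult[OF c4 c4]
  note c12 = mult[OF c4 c8]
  \<comment> \<open>the index is 12 times \<open>i\<close>, as the sum of 4 times and 8 times \<open>i\<close>\<close>
  obtain k where k: "k \<noteq> P0" "cg pid k"
  proof
    show "cg pid (ap (rot (ap (rot (ap (rot i) i)) (ap (rot i) i))) (ap (rot (ap (rot (ap (rot i) i)) (ap (rot i) i))) (ap (rot (ap (rot i) i)) (ap (rot i) i))))"
      using c12 i(2) by (simp add: pow12_def square_def Let_def)
    show "ap (rot (ap (rot (ap (rot i) i)) (ap (rot i) i))) (ap (rot (ap (rot (ap (rot i) i)) (ap (rot i) i))) (ap (rot (ap (rot i) i)) (ap (rot i) i))) \<noteq> P0"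
      using i(1) by (cases i) (simp_all add: rot.simps)
  qed
  then obtain u where u: "u \<in> N" "pid = u \<star> rot k" by (auto simp: cg_def)
  have oku: "is_perm u" using permgrpD(1)[OF N(1) u(1)] .
  have "rot k = pinv u" using u(2) pinv_pm_eq[OF oku, of "rot k" pid] by simp
  then have "rot k \<in> N" using permgrp_pinv[OF N(1) u(1)] by simp
  then have c: "rot P1 \<in> N" by (rule rot_gen[OF N(1) _ k(1)])
  have h: "invol \<star> rot P1 \<star> pinv invol \<in> N" by (rule n[OF c invol_Fano])
  have nn: "invol \<star> rot P1 \<star> pinv invol \<notin> Affine"
  proof -
    have "invol \<star> invol = pid" by code_simp
    then have g: "pinv invol = invol" using invol_Fano pinv_pm_eq[of invol invol pid] by (simp add: Fano_def)
    define d where "d = rot (neg (ap (invol \<star> rot P1 \<star> invol) P0)) \<star> (invol \<star> rot P1 \<star> invol)"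
    have "ap d P0 = P0 \<and> d \<notin> set mults" unfolding d_def by code_simp
    then have "d \<notin> Affine" using Affine_fix0 by blast
    then show ?thesis unfolding g d_def using permgrpD(3)[OF permgrp_Affine rot_Affine] by blast
  qed
  show ?thesis using classification[OF N(1) c]
  proof (elim disjE)
    assume "N = Fano'"
    then show ?thesis using card_Fano card_Fano' N(2) by (metis card_subset_eq finite)
  next
    assume "threes \<subseteq> N" then show ?thesis using three0_threes three0_not_Fano N(2) by blast
  qed (use h nn in auto)
qed

section \<open>Signed permutations\<close>

text \<open>A pair \<open>(p, b)\<close> stands for the map that sends the basis vector \<open>v i\<close> to \<open>v (p i)\<close>, with a minus sign if \<open>b\<close> is
true at \<open>i\<close>. On sign vectors \<open>sx\<close> is addition modulo 2 with neutral element \<open>sz\<close>, and \<open>sperm b p\<close> is \<open>b\<close>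
composed with \<open>p\<close>.\<close>

datatype signs = Signs bool bool bool bool bool bool bool

fun bt :: "signs \<Rightarrow> pt \<Rightarrow> bool" where
  "bt (Signs a b c d e f g) P0 = a"
| "bt (Signs a b c d e f g) P1 = b"
| "bt (Signs a b c d e f g) P2 = c"
| "bt (Signs a b c d e f g) P3 = d"
| "bt (Signs a b c d e f g) P4 = e"
| "bt (Signs a b c d e f g) P5 = f"
| "bt (Signs a b c d e f g) P6 = g"

definition stable :: "(pt \<Rightarrow> bool) \<Rightarrow> signs" where
  "stable f = Signs (f P0) (f P1) (f P2) (f P3) (f P4) (f P5) (f P6)"

definition sz :: signs where "sz = Signs False False False False False False False"
definition ones :: signs where "ones = Signs True True True True True True True"

fun xor :: "bool \<Rightarrow> bool \<Rightarrow> bool" where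
  "xor True b = (\<not> b)" | "xor False b = b"

lemma xor_iff: "xor a b \<longleftrightarrow> a \<noteq> b" by (cases a) auto

fun sx :: "signs \<Rightarrow> signs \<Rightarrow> signs" where
  "sx (Signs a b c d e f g) (Signs a' b' c' d' e' f' g') =
    Signs (xor a a') (xor b b') (xor c c') (xor d d') (xor e e') (xor f f') (xor g g')"

fun sperm :: "signs \<Rightarrow> perm \<Rightarrow> signs" where
  "sperm b (Perm x0 x1 x2 x3 x4 x5 x6) = Signs (bt b x0) (bt b x1) (bt b x2) (bt b x3) (bt b x4) (bt b x5) (bt b x6)"

type_synonym sp = "perm \<times> signs"

fun smul :: "sp \<Rightarrow> sp \<Rightarrow> sp" (infixl "\<diamondop>" 70) where
  "(p, b) \<diamondop> (q, d) = (p \<star> q, sx d (sperm b q))"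

definition sid :: sp where "sid = (pid, sz)"

lemma signs_eqI: "(\<And>i. bt a i = bt b i) \<Longrightarrow> a = b"
proof (cases a; cases b)
  fix x0 x1 x2 x3 x4 x5 x6 y0 y1 y2 y3 y4 y5 y6
  assume h: "\<And>i. bt a i = bt b i" "a = Signs x0 x1 x2 x3 x4 x5 x6" "b = Signs y0 y1 y2 y3 y4 y5 y6"
  show "a = b" using h(1)[of P0] h(1)[of P1] h(1)[of P2] h(1)[of P3] h(1)[of P4] h(1)[of P5] h(1)[of P6]
    by (simp add: h(2,3))
qed

lemma inj_bt: "inj bt"
  by (rule injI, rule signs_eqI) simp

instance signs :: finite
proof
  show "finite (UNIV :: signs set)"
    by (rule finite_imageD[OF finite inj_bt])
qed

lemma bt_stable [simp]: "bt (stable f) i = f i" by (cases i) (simp_all add: stable_def)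
lemma bt_sx [simp]: "bt (sx a b) i \<longleftrightarrow> bt a i \<noteq> bt b i"
  by (cases a; cases b; cases i) (simp_all add: xor_iff)
lemma bt_sperm [simp]: "bt (sperm b p) i = bt b (ap p i)"
  by (cases p; cases i) simp_all
lemma bt_sz [simp]: "\<not> bt sz i" by (cases i) (simp_all add: sz_def)
lemma bt_ones [simp]: "bt ones i" by (cases i) (simp_all add: ones_def)

declare sx.simps [simp del] sperm.simps [simp del] 

lemma sx_simps [simp]: "sx a a = sz" "sx a sz = a" "sx sz a = a" "sx a (sx a b) = b"
  by (auto intro!: signs_eqI)
lemma sx_comm: "sx a b = sx b a" by (auto intro!: signs_eqI)
lemma sx_assoc: "sx (sx a b) c = sx a (sx b c)" by (auto intro!: signs_eqI)
lemma sperm_simps [simp]: "sperm sz p = sz" "sperm ones p = ones" "sperm b pid = b"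
  "sperm (sx a b) p = sx (sperm a p) (sperm b p)" "sperm (sperm b p) q = sperm b (p \<star> q)"
  by (auto intro!: signs_eqI simp del: pm.simps)

lemma sx_eq_sz: "sx a b = sz \<longleftrightarrow> a = b"
  by (metis sx_simps(1) sx_simps(2) sx_simps(4))

lemma smul_assoc: "x \<diamondop> y \<diamondop> z = x \<diamondop> (y \<diamondop> z)"
  by (cases x; cases y; cases z) (auto simp: pm_assoc sx_assoc simp del: pm.simps)

lemma sid_smul [simp]: "sid \<diamondop> x = x" "x \<diamondop> sid = x"
  by (cases x; simp add: sid_def del: pm.simps)+

lemma fst_smul [simp]: "fst (x \<diamondop> y) = fst x \<star> fst y" by (cases x; cases y) simp
lemma fst_sid [simp]: "fst sid = pid" by (simp add: sid_def)

definition sinv :: "sp \<Rightarrow> sp" where "sinv x = (pinv (fst x), sperm (snd x) (pinv (fst x)))"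

lemma sinv: assumes "is_perm (fst x)"
  shows "is_perm (fst (sinv x))" "sinv x \<diamondop> x = sid" "x \<diamondop> sinv x = sid"
  using assms by (cases x; simp add: sinv_def pinv sid_def)+

lemma smul_cancel: "is_perm (fst x) \<Longrightarrow> x \<diamondop> y = x \<diamondop> z \<Longrightarrow> y = z"
  by (metis sinv(2) sid_smul(1) smul_assoc)

definition spgrp :: "sp set \<Rightarrow> bool" where
  "spgrp S \<longleftrightarrow> (\<forall>x\<in>S. is_perm (fst x)) \<and> sid \<in> S \<and> (\<forall>x\<in>S. \<forall>y\<in>S. x \<diamondop> y \<in> S)"

lemma spgrpD: assumes "spgrp S"
  shows "x \<in> S \<Longrightarrow> is_perm (fst x)" "sid \<in> S" "x \<in> S \<Longrightarrow> y \<in> S \<Longrightarrow> x \<diamondop> y \<in> S"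
  using assms by (auto simp: spgrp_def simp del: smul.simps)

lemma spgrp_sinv: assumes S: "spgrp S" and x: "x \<in> S" shows "sinv x \<in> S"
proof -
  have okx: "is_perm (fst x)" using spgrpD(1)[OF S x] .
  have "inj_on (\<lambda>q. x \<diamondop> q) S" using smul_cancel[OF okx] by (auto intro: inj_onI)
  moreover have "(\<lambda>q. x \<diamondop> q) ` S \<subseteq> S" using spgrpD(3)[OF S x] by auto
  ultimately have "(\<lambda>q. x \<diamondop> q) ` S = S" by (intro endo_inj_surj) simp_all
  then obtain q where q: "q \<in> S" "x \<diamondop> q = sid" using spgrpD(2)[OF S] by (metis imageE)
  have "q = sinv x" by (rule smul_cancel[OF okx]) (simp add: q sinv(3)[OF okx])
  then show ?thesis using q by simp
qed

lemma permgrp_fst: "spgrp S \<Longrightarrow> permgrp (fst ` S)"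
  unfolding permgrp_def using spgrpD[of S] fst_smul fst_sid by (smt (verit) imageE imageI)

text \<open>The pure rotations, those without sign changes.\<close>

definition cyc7 :: "pt \<Rightarrow> sp" where "cyc7 k = (rot k, sz)"

definition diag_signs :: "sp set \<Rightarrow> signs set" where "diag_signs S = {b. (pid, b) \<in> S}"

lemma cyc7_in: assumes S: "spgrp S" "cyc7 P1 \<in> S" shows "cyc7 k \<in> S"
proof -
  have "(rot k, sz) \<in> S"
  proof (rule rot_induct[where P="\<lambda>p. (p, sz) \<in> S"])
    show "(pid, sz) \<in> S" using spgrpD(2)[OF S(1)] by (simp add: sid_def)
    fix p assume "(p, sz) \<in> S"
    then have "cyc7 P1 \<diamondop> (p, sz) \<in> S" using spgrpD(3)[OF S] by blast
    then show "(rot P1 \<star> p, sz) \<in> S" by (simp add: cyc7_def)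
  qed
  then show ?thesis by (simp add: cyc7_def)
qed

lemma diag_signs_sx: assumes S: "spgrp S" and ab: "a \<in> diag_signs S" "b \<in> diag_signs S" shows "sx a b \<in> diag_signs S"
proof -
  have "(pid, b) \<diamondop> (pid, a) \<in> S" using spgrpD(3)[OF S] ab by (simp add: diag_signs_def del: smul.simps)
  then show ?thesis by (simp add: diag_signs_def)
qed

lemma diag_signs_sz: "spgrp S \<Longrightarrow> sz \<in> diag_signs S" using spgrpD(2)[of S] by (simp add: diag_signs_def sid_def)

lemma diag_signs_sperm: assumes S: "spgrp S" and x: "x \<in> S" and b: "b \<in> diag_signs S" shows "sperm b (fst x) \<in> diag_signs S"
proof -
  have okx: "is_perm (fst x)" using spgrpD(1)[OF S x] .
  have "sinv x \<diamondop> ((pid, b) \<diamondop> x) \<in> S"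
    using spgrpD(3)[OF S] spgrp_sinv[OF S x] x b by (simp add: diag_signs_def del: smul.simps)
  moreover have "sinv x \<diamondop> ((pid, b) \<diamondop> x) = (pid, sperm b (fst x))"
    using okx by (cases x) (simp add: sinv_def pinv pm_assoc sx_assoc sx_comm[of "snd x"] del: pm.simps,
       metis sx_assoc sx_comm sx_simps(1) sx_simps(2))
  ultimately show ?thesis by (simp add: diag_signs_def)
qed

lemma same_perm: assumes S: "spgrp S" and xy: "(p, a) \<in> S" "(p, b) \<in> S"
  shows "sx a b \<in> diag_signs S"
proof -
  have okp: "is_perm p" using spgrpD(1)[OF S xy(1)] by simp
  have "sinv (p, a) \<diamondop> (p, b) \<in> S" using spgrpD(3)[OF S] spgrp_sinv[OF S] xy by blast
  then show ?thesis using okp by (simp add: sinv_def pinv diag_signs_def sx_comm del: pm.simps)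
qed

lemma diag_signs_mult: assumes S: "spgrp S" and x: "(p, a) \<in> S" and b: "b \<in> diag_signs S" shows "(p, sx a b) \<in> S"
proof -
  have "(p, a) \<diamondop> (pid, b) \<in> S" using spgrpD(3)[OF S x] b by (simp add: diag_signs_def del: smul.simps)
  then show ?thesis by (simp add: sx_comm)
qed

section \<open>Cyclic binary codes of length seven\<close>

text \<open>The points and 0 form a vector space over the field with two elements, in which distinct \<open>i\<close> and \<open>j\<close> add up to
\<open>third i j\<close>. The words of the simplex code are its linear functionals.\<close>

definition linear_word :: "signs \<Rightarrow> bool" where
  "linear_word b \<longleftrightarrow> (\<forall>i\<in>set pts. \<forall>j\<in>set pts. i \<noteq> j \<longrightarrow> bt b (third i j) = xor (bt b i) (bt b j))"

definition simplex_code :: "signs set" where "simplex_code = {b. linear_word b}"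

definition all_signs :: "signs list" where
  "all_signs = concat (map (\<lambda>a. concat (map (\<lambda>b. concat (map (\<lambda>c. concat (map (\<lambda>d. concat (map (\<lambda>e. concat (map (\<lambda>f.
     map (\<lambda>g. Signs a b c d e f g) [False,True]) [False,True])) [False,True])) [False,True])) [False,True])) [False,True])) [False,True])"

lemma all_signs_complete: "b \<in> set all_signs"
proof (cases b)
  case (Signs a b c d e f g)
  have T: "x \<in> set [False, True]" for x by auto
  show ?thesis
    unfolding all_signs_def Signs
    by (rule concat_mapI[OF T[of a]], rule concat_mapI[OF T[of b]], rule concat_mapI[OF T[of c]],
        rule concat_mapI[OF T[of d]], rule concat_mapI[OF T[of e]], rule concat_mapI[OF T[of f]],
        simp only: set_map, rule imageI, rule T)
qed

fun parity :: "signs \<Rightarrow> bool" where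
  "parity (Signs a b c d e f g) = xor a (xor b (xor c (xor d (xor e (xor f g)))))"

definition evens :: "signs set" where "evens = {b. \<not> parity b}"

definition simplex_code' :: "signs set" where "simplex_code' = (\<lambda>b. sperm b (scale P6)) ` simplex_code"

text \<open>The exponents come from the primitive idempotents of the ring of polynomials modulo \<open>x^7 - 1\<close> over the field with two elements:
\<open>proj\<close> and \<open>proj'\<close> are the projections onto the two simplex codes, \<open>total\<close> onto the repetition code.\<close>

definition proj :: "signs \<Rightarrow> signs" where
  "proj b = sx b (sx (sperm b (rot P1)) (sx (sperm b (rot P2)) (sperm b (rot P4))))"
definition proj' :: "signs \<Rightarrow> signs" where
  "proj' b = sx b (sx (sperm b (rot P6)) (sx (sperm b (rot P5)) (sperm b (rot P3))))"
definition total :: "signs \<Rightarrow> signs" where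
  "total b = sx b (sx (sperm b (rot P1)) (sx (sperm b (rot P2)) (sx (sperm b (rot P3))
     (sx (sperm b (rot P4)) (sx (sperm b (rot P5)) (sperm b (rot P6)))))))"

definition linear_word' :: "signs \<Rightarrow> bool" where "linear_word' b \<longleftrightarrow> linear_word (sperm b (scale P6))"

lemma simplex_code'_iff: "b \<in> simplex_code' \<longleftrightarrow> linear_word' b"
proof -
  have "sperm (sperm b (scale P6)) (scale P6) = b" for b
    by (simp add: scale6_scale6)
  then show ?thesis unfolding simplex_code'_def simplex_code_def linear_word'_def by (auto simp: image_iff)
qed

text \<open>The three idempotents are orthogonal projections with sum 1.\<close>

lemma code_check: "every (\<lambda>b. if linear_word (proj b) then if linear_word' (proj' b) then
    if total b = (if parity b then ones else sz) then
    if sx b (sx (proj b) (proj' b)) = total b then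
    if parity (proj b) then False else \<not> parity (proj' b)
    else False else False else False else False) all_signs" by code_simp

text \<open>A simplex code has seven nonzero words, and they are the rotations of one of them; in particular it contains no smaller cyclic code.\<close>

lemma rotation_check:
  "every (\<lambda>b. if b = sz then True else every (\<lambda>a. search (\<lambda>k. sperm b (rot k) = a) pts)
     (filter (\<lambda>a. a \<noteq> sz) (filter linear_word all_signs))) (filter linear_word all_signs)"
  "every (\<lambda>b. if b = sz then True else every (\<lambda>a. search (\<lambda>k. sperm b (rot k) = a) pts)
     (filter (\<lambda>a. a \<noteq> sz) (filter linear_word' all_signs))) (filter linear_word' all_signs)"
  by code_simp+

lemma code_facts:
  shows "proj b \<in> simplex_code" "proj' b \<in> simplex_code'" "total b = (if parity b then ones else sz)"
    "sx b (sx (proj b) (proj' b)) = total b" "\<not> parity (proj b)" "\<not> parity (proj' b)"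
proof -
  note c = code_check[unfolded every_iff, rule_format, OF all_signs_complete[of b]]
  show "proj b \<in> simplex_code" "proj' b \<in> simplex_code'" "total b = (if parity b then ones else sz)"
    "sx b (sx (proj b) (proj' b)) = total b" "\<not> parity (proj b)" "\<not> parity (proj' b)"
    using c unfolding simplex_code_def simplex_code'_iff mem_Collect_eq by (simp_all split: if_split_asm)
qed

lemma rotation_facts:
  "b \<in> simplex_code \<Longrightarrow> b \<noteq> sz \<Longrightarrow> a \<in> simplex_code \<Longrightarrow> a \<noteq> sz \<Longrightarrow> \<exists>k. sperm b (rot k) = a"
  "b \<in> simplex_code' \<Longrightarrow> b \<noteq> sz \<Longrightarrow> a \<in> simplex_code' \<Longrightarrow> a \<noteq> sz \<Longrightarrow> \<exists>k. sperm b (rot k) = a"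
proof -
  have m: "x \<in> set (filter P all_signs) \<longleftrightarrow> P x" for P x using all_signs_complete by simp
  have m': "x \<in> set (filter (\<lambda>a. a \<noteq> sz) (filter P all_signs)) \<longleftrightarrow> P x \<and> x \<noteq> sz" for P x
    using all_signs_complete by simp
  note c = rotation_check[unfolded every_iff search_iff, rule_format, unfolded m]
  show "b \<in> simplex_code \<Longrightarrow> b \<noteq> sz \<Longrightarrow> a \<in> simplex_code \<Longrightarrow> a \<noteq> sz \<Longrightarrow> \<exists>k. sperm b (rot k) = a"
    using c(1)[of b] all_signs_complete[of a] unfolding simplex_code_def mem_Collect_eq m' by (simp) blast
  show "b \<in> simplex_code' \<Longrightarrow> b \<noteq> sz \<Longrightarrow> a \<in> simplex_code' \<Longrightarrow> a \<noteq> sz \<Longrightarrow> \<exists>k. sperm b (rot k) = a"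
    using c(2)[of b] all_signs_complete[of a] unfolding simplex_code'_iff m' by (simp) blast
qed

lemma simplex_evens: "simplex_code \<subseteq> evens" and simplex'_evens: "simplex_code' \<subseteq> evens"
proof -
  have "every (\<lambda>b. \<not> parity b) (filter linear_word all_signs @ filter linear_word' all_signs)" by code_simp
  then show "simplex_code \<subseteq> evens" "simplex_code' \<subseteq> evens"
    using all_signs_complete unfolding every_iff simplex_code_def simplex_code'_iff evens_def by (auto simp: simplex_code'_iff)
qed

text \<open>A cyclic code is the sum of its projections, and each simplex code is contained in it as soon as the projection to it is nonzero.\<close>

theorem cyclic_codes: assumes S: "spgrp S" "cyc7 P1 \<in> S"
  obtains "diag_signs S \<inter> evens = {sz}" | "diag_signs S \<inter> evens = simplex_code" | "diag_signs S \<inter> evens = simplex_code'" | "evens \<subseteq> diag_signs S"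
proof -
  have r: "sperm b (rot k) \<in> diag_signs S" if "b \<in> diag_signs S" for b k
    using diag_signs_sperm[OF S(1) cyc7_in[OF S] that] by (simp add: cyc7_def)
  have p: "proj b \<in> diag_signs S" "proj' b \<in> diag_signs S" if "b \<in> diag_signs S" for b
    unfolding proj_def proj'_def by (intro diag_signs_sx[OF S(1)] r that)+
  note word = simplex_evens simplex'_evens
  have sz: "sz \<in> evens" using word(1) by (auto simp: simplex_code_def linear_word_def)
  have dec: "b = sx (proj b) (proj' b)" if "b \<in> evens" for b
    using code_facts(3,4)[of b] that by (simp add: evens_def sx_eq_sz)
  have full: "simplex_code \<subseteq> diag_signs S" if b: "b \<in> diag_signs S" "proj b \<noteq> sz" for b
  proof
    fix x assume x: "x \<in> simplex_code"
    show "x \<in> diag_signs S" using rotation_facts(1)[OF code_facts(1)[of b] b(2) x] diag_signs_sz[OF S(1)] r[OF p(1)[OF b(1)]]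
      by (cases "x = sz") auto
  qed
  have full': "simplex_code' \<subseteq> diag_signs S" if b: "b \<in> diag_signs S" "proj' b \<noteq> sz" for b
  proof
    fix x assume x: "x \<in> simplex_code'"
    show "x \<in> diag_signs S" using rotation_facts(2)[OF code_facts(2)[of b] b(2) x] diag_signs_sz[OF S(1)] r[OF p(2)[OF b(1)]]
      by (cases "x = sz") auto
  qed
  consider (z) "\<forall>b\<in>diag_signs S. proj b = sz" "\<forall>b\<in>diag_signs S. proj' b = sz"
    | (a) b where "b \<in> diag_signs S" "proj b \<noteq> sz" "\<forall>b\<in>diag_signs S. proj' b = sz"
    | (a') b where "\<forall>b\<in>diag_signs S. proj b = sz" "b \<in> diag_signs S" "proj' b \<noteq> sz"
    | (e) b b' where "b \<in> diag_signs S" "proj b \<noteq> sz" "b' \<in> diag_signs S" "proj' b' \<noteq> sz"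
    by (cases "\<exists>b\<in>diag_signs S. proj b \<noteq> sz"; cases "\<exists>b\<in>diag_signs S. proj' b \<noteq> sz"; (elim bexE)?) simp_all
  then show ?thesis
  proof cases
    case z
    have "b = sz" if "b \<in> diag_signs S \<inter> evens" for b using dec[of b] that z by simp
    then have "diag_signs S \<inter> evens = {sz}" using diag_signs_sz[OF S(1)] sz by blast
    then show ?thesis using that by blast
  next
    case a
    have "b \<in> simplex_code" if "b \<in> diag_signs S \<inter> evens" for b
      using dec[of b] that a(3) code_facts(1)[of b] by simp
    then have "diag_signs S \<inter> evens = simplex_code" using full[OF a(1,2)] word by blast
    then show ?thesis using that by blast
  next
    case a'
    have "b \<in> simplex_code'" if "b \<in> diag_signs S \<inter> evens" for b
      using dec[of b] that a'(1) code_facts(2)[of b] by simp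
    then have "diag_signs S \<inter> evens = simplex_code'" using full'[OF a'(2,3)] word by blast
    then show ?thesis using that by blast
  next
    case e
    have "x \<in> diag_signs S" if "x \<in> evens" for x
      using full[OF e(1,2)] full'[OF e(3,4)] dec[OF that] code_facts(1,2)[of x] diag_signs_sx[OF S(1)] by (metis subsetD)
    then show ?thesis using that by blast
  qed
qed

text \<open>The sum of all rotations of a word of odd weight is the all-ones word.\<close>

lemma odd_ones: assumes S: "spgrp S" "cyc7 P1 \<in> S" and b: "b \<in> diag_signs S" "parity b" shows "ones \<in> diag_signs S"
proof -
  have r: "sperm b (rot k) \<in> diag_signs S" for k
    using diag_signs_sperm[OF S(1) cyc7_in[OF S] b(1)] by (simp add: cyc7_def)
  have "total b \<in> diag_signs S" unfolding total_def by (intro diag_signs_sx[OF S(1)] r b(1))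
  then show ?thesis using code_facts(3)[of b] b(2) by simp
qed


lemma third_same [simp]: "third i i = i" by (cases i) (simp_all add: third_def)

lemma simplexD: "b \<in> simplex_code \<Longrightarrow> i \<noteq> j \<Longrightarrow> bt b (third i j) \<longleftrightarrow> bt b i \<noteq> bt b j"
  by (simp add: simplex_code_def linear_word_def xor_iff)

lemma simplexI: "(\<And>i j. i \<noteq> j \<Longrightarrow> bt b (third i j) \<longleftrightarrow> bt b i \<noteq> bt b j) \<Longrightarrow> b \<in> simplex_code"
  by (simp add: simplex_code_def linear_word_def xor_iff)

lemma simplex_separates: assumes "u \<noteq> v" shows "\<exists>b\<in>simplex_code. bt b u \<noteq> bt b v"
proof -
  have "every (\<lambda>u. every (\<lambda>v. if u = v then True else
      search (\<lambda>b. xor (bt b u) (bt b v)) (filter linear_word all_signs)) pts) pts" by code_simp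
  then have "search (\<lambda>b. xor (bt b u) (bt b v)) (filter linear_word all_signs)"
    using assms unfolding every_iff by (metis in_pts)
  then show ?thesis unfolding search_iff xor_iff simplex_code_def by auto
qed

lemma simplex_sperm: "b \<in> simplex_code \<Longrightarrow> p \<in> Fano \<Longrightarrow> sperm b p \<in> simplex_code"
  by (rule simplexI) (auto simp: Fano_def fano_iff is_perm_iff simplexD inj_eq)

lemma simplex_sx: "a \<in> simplex_code \<Longrightarrow> b \<in> simplex_code \<Longrightarrow> sx a b \<in> simplex_code"
  by (rule simplexI) (auto simp: simplexD)

lemma sz_simplex: "sz \<in> simplex_code" by (rule simplexI) simp

lemma card_simplex: "card simplex_code = 8"
proof -
  have "simplex_code = set (filter linear_word all_signs)"
    using all_signs_complete by (auto simp: simplex_code_def)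
  also have "\<dots> = set [Signs False False False False False False False,
   Signs False False True False True True True, Signs False True False True True True False,
   Signs False True True True False False True, Signs True False False True False True True,
   Signs True False True True True False False, Signs True True False False True False True,
   Signs True True True False False True False]" by code_simp
  finally have e: "simplex_code = set [Signs False False False False False False False,
   Signs False False True False True True True, Signs False True False True True True False,
   Signs False True True True False False True, Signs True False False True False True True,
   Signs True False True True True False False, Signs True True False False True False True,
   Signs True True True False False True False]" .
  show ?thesis unfolding e by simp
qed

section \<open>Groups determined by their sign changes\<close>

text \<open>Points are separated by functionals, so a permutation that preserves the set of functionals is linear.\<close>

lemma simplex_stabilizer: assumes is_perm: "is_perm p" and s: "\<And>b. b \<in> simplex_code \<Longrightarrow> sperm b p \<in> simplex_code" shows "p \<in> Fano"
proof -
  have "ap p (third i j) = third (ap p i) (ap p j)" if ij: "i \<noteq> j" for i j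
  proof (rule ccontr)
    assume "ap p (third i j) \<noteq> third (ap p i) (ap p j)"
    then obtain b where b: "b \<in> simplex_code" "bt b (ap p (third i j)) \<noteq> bt b (third (ap p i) (ap p j))"
      using simplex_separates by blast
    have "ap p i \<noteq> ap p j" using is_perm ij by (simp add: is_perm_iff inj_eq)
    then show False using b(2) simplexD[OF s[OF b(1)] ij] simplexD[OF b(1)] unfolding bt_sperm by metis
  qed
  then have "fano p" unfolding fano_iff by (metis third_same)
  then show ?thesis using is_perm by (simp add: Fano_def)
qed

lemma diag_simplex_Fano: assumes S: "spgrp S" "diag_signs S = simplex_code" shows "fst ` S \<subseteq> Fano"
proof
  fix p assume "p \<in> fst ` S"
  then obtain x where x: "x \<in> S" "p = fst x" by blast
  show "p \<in> Fano" unfolding x(2)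
    by (rule simplex_stabilizer) (use spgrpD(1)[OF S(1) x(1)] diag_signs_sperm[OF S(1) x(1)] S(2) in auto)
qed

lemma rot_invariant: assumes "sperm b (rot P1) = b" shows "b = sz \<or> b = ones"
proof -
  have h: "bt b (ap (rot P1) i) = bt b i" for i using assms by (metis bt_sperm)
  have "bt b i = bt b P0" for i
    using h[of P0] h[of P1] h[of P2] h[of P3] h[of P4] h[of P5] by (cases i) (simp_all add: rot.simps)
  then show ?thesis by (metis bt_ones bt_sz signs_eqI)
qed

definition const_signs :: "signs set" where "const_signs = {sz, ones}"

lemma const_eqI: "(\<And>i j. bt b i = bt b j) \<Longrightarrow> b \<in> const_signs"
  unfolding const_signs_def by (metis bt_ones bt_sz insert_iff signs_eqI)

text \<open>Compare \<open>x\<close> after the rotation with a suitable rotation after \<open>x\<close>: both lie over the same permutation.\<close>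

lemma Affine_twist: assumes S: "spgrp S" "cyc7 P1 \<in> S" and x: "(p, b) \<in> S" "p \<in> Affine"
  shows "sx b (sperm b (rot P1)) \<in> diag_signs S"
proof -
  obtain k where k: "p \<star> rot P1 = rot k \<star> p" using x(2) by (auto simp: Affine_def)
  have "cyc7 k \<diamondop> (p, b) \<in> S" "(p, b) \<diamondop> cyc7 P1 \<in> S"
    using spgrpD(3)[OF S(1)] cyc7_in[OF S] x(1) by blast+
  then have "(rot k \<star> p, b) \<in> S" "(rot k \<star> p, sperm b (rot P1)) \<in> S" by (simp_all add: cyc7_def k)
  then show ?thesis by (rule same_perm[OF S(1)])
qed

lemma trivial_diag_Affine: assumes S: "spgrp S" "cyc7 P1 \<in> S" "diag_signs S = {sz}" and x: "(p, b) \<in> S" "p \<in> Affine"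
  shows "b \<in> const_signs"
  using Affine_twist[OF S(1,2) x] S(3) rot_invariant by (auto simp: sx_eq_sz const_signs_def)

fun sword :: "pt list \<Rightarrow> sp \<Rightarrow> sp" where
  "sword [] x = sid"
| "sword (i # w) x = cyc7 i \<diamondop> (x \<diamondop> sword w x)"

lemma sword_in: assumes S: "spgrp S" "cyc7 P1 \<in> S" and x: "x \<in> S" shows "sword w x \<in> S"
  by (induction w) (use spgrpD[OF S(1)] cyc7_in[OF S] x in auto)

text \<open>Two relations between the rotation and a 3-cycle show that its lift has no signs (otherwise a nontrivial sign
change would lie over the identity). Hence all 3-cycles lift to pure permutations. Commuting an element
past them shows that its sign vector is invariant under all 3-cycles.\<close>

lemma trivial_diag_threes: assumes S: "spgrp S" "cyc7 P1 \<in> S" "diag_signs S = {sz}" "threes \<subseteq> fst ` S"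
    and x: "(p, b) \<in> S"
  shows "b \<in> const_signs"
proof -
  obtain s where s: "(three0, s) \<in> S" using S(4) three0_threes by force
  have "every (\<lambda>s. if s = sz then True else search (\<lambda>w. let x = sword w (three0, s) in
      if fst x = pid then snd x \<noteq> sz else False) [[P0,P0,P0],[P2,P2,P2]]) all_signs" by code_simp
  moreover have "\<not> (fst (sword w (three0, s)) = pid \<and> snd (sword w (three0, s)) \<noteq> sz)" for w
    using sword_in[OF S(1,2) s, of w] S(3) by (cases "sword w (three0, s)") (auto simp: diag_signs_def)
  ultimately have "s = sz" using all_signs_complete[of s] unfolding every_iff search_iff Let_def
    by (metis (no_types, lifting))
  let ?P = "{p. (p, sz) \<in> S}"
  have P: "permgrp ?P"
    unfolding permgrp_def
  proof (intro conjI ballI)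
    show "pid \<in> ?P" using spgrpD(2)[OF S(1)] by (simp add: sid_def)
    fix p assume p: "p \<in> ?P"
    then show "is_perm p" using spgrpD(1)[OF S(1)] by force
    fix q assume "q \<in> ?P"
    then have "(p, sz) \<diamondop> (q, sz) \<in> S" using p spgrpD(3)[OF S(1)] by blast
    then show "p \<star> q \<in> ?P" by simp
  qed
  have t: "threes \<subseteq> ?P"
    by (rule threes_gen1[OF P]) (use s \<open>s = sz\<close> S(2) in \<open>simp_all add: cyc7_def\<close>)
  have okp: "is_perm p" using spgrpD(1)[OF S(1) x] by simp
  have inv: "sperm b t = b" if transv: "t \<in> threes" for t
  proof -
    have "(p \<star> t \<star> pinv p, sz) \<in> S" "(t, sz) \<in> S" using t threes_conj[OF transv okp] transv by auto
    then have "(p \<star> t \<star> pinv p, sz) \<diamondop> (p, b) \<in> S" "(p, b) \<diamondop> (t, sz) \<in> S"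
      using spgrpD(3)[OF S(1)] x by blast+
    then have "(p \<star> t, b) \<in> S" "(p \<star> t, sperm b t) \<in> S" by (simp_all add: pm_assoc pinv[OF okp])
    from same_perm[OF S(1) this] show ?thesis using S(3) by (simp add: sx_eq_sz)
  qed
  show ?thesis
  proof (rule const_eqI)
    fix i j show "bt b i = bt b j"
    proof (cases "i = j")
      case False
      obtain k where "k \<in> set (others [i, j])" by (cases i; cases j) (auto simp: others_def pts_def)
      then have "distinct [i, j, k]" using False by (auto simp: set_others)
      then have "three_cycle i j k \<in> threes" unfolding threes_def by blast
      from inv[OF this] have "bt b (ap (three_cycle i j k) i) = bt b i" by (metis bt_sperm)
      then show ?thesis by (simp add: three_cycle_def)
    qed simp
  qed
qed

text \<open>The last condition says that \<open>K\<close> and the sign changes together make up all of \<open>S\<close>.\<close>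

definition complements :: "sp set \<Rightarrow> sp set \<Rightarrow> bool" where
  "complements K S \<longleftrightarrow> spgrp K \<and> K \<subseteq> S \<and> (\<forall>x\<in>K. fst x = pid \<longrightarrow> x = sid) \<and> fst ` S \<subseteq> fst ` K"

text \<open>The elements with constant signs form a subgroup, and the only constant sign change other than 0 is excluded.\<close>

lemma const_complement:
  assumes S: "spgrp S" "ones \<notin> diag_signs S" and c: "\<And>p b. (p, b) \<in> S \<Longrightarrow> \<exists>a\<in>diag_signs S. sx b a \<in> const_signs"
  shows "complements {x\<in>S. snd x \<in> const_signs} S" (is "complements ?K S")
proof -
  have "sid \<in> ?K" using spgrpD(2)[OF S(1)] by (simp add: sid_def const_signs_def)
  moreover have "x \<diamondop> y \<in> ?K" if "x \<in> ?K" "y \<in> ?K" for x y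
  proof -
    have "snd (x \<diamondop> y) \<in> const_signs" using that by (cases x; cases y) (auto simp: const_signs_def)
    then show ?thesis using that spgrpD(3)[OF S(1)] by blast
  qed
  ultimately have "spgrp ?K" using spgrpD(1)[OF S(1)] by (auto simp: spgrp_def simp del: smul.simps)
  moreover have "x = sid" if x: "x \<in> ?K" "fst x = pid" for x
  proof -
    have "snd x \<in> diag_signs S" using x by (cases x) (simp add: diag_signs_def)
    then have "snd x = sz" using x(1) S(2) by (auto simp: const_signs_def)
    then show ?thesis using x(2) by (cases x) (simp add: sid_def)
  qed
  moreover have "fst ` S \<subseteq> fst ` ?K"
  proof
    fix p assume "p \<in> fst ` S"
    then obtain b where b: "(p, b) \<in> S" by force
    then obtain a where a: "a \<in> diag_signs S" "sx b a \<in> const_signs" using c by blast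
    have "(p, sx b a) \<in> ?K" using a diag_signs_mult[OF S(1) b a(1)] by simp
    then show "p \<in> fst ` ?K" by force
  qed
  ultimately show ?thesis by (auto simp: complements_def)
qed

lemma ones_odd: "parity ones" by (simp add: ones_def)

lemma parity_card: "parity b \<longleftrightarrow> odd (card {i. bt b i})"
proof -
  have "card {i. bt b i} = (\<Sum>i\<in>UNIV. if bt b i then 1 else 0)"
    by (simp add: sum.If_cases)
  also have "\<dots> = sum_list (map (\<lambda>i. if bt b i then 1 else 0) pts)"
    unfolding UNIV_pt by (rule sum.distinct_set_conv_list) (simp add: pts_def)
  finally show ?thesis by (cases b) (simp add: pts_def xor_iff)
qed

lemma parity_sperm: assumes "is_perm p" shows "parity (sperm b p) = parity b"
proof -
  have "{i. bt b (ap p i)} = ap p -` {i. bt b i}" by auto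
  moreover have "card (ap p -` {i. bt b i}) = card {i. bt b i}"
    using assms by (intro card_vimage_inj) (auto simp: is_perm_bij bij_def)
  ultimately show ?thesis by (simp add: parity_card)
qed

lemma xor_ac: "xor (xor a b) c = xor a (xor b c)" "xor a b = xor b a" "xor a (xor b c) = xor b (xor a c)"
  by (auto simp: xor_iff)

lemma parity_sx: "parity (sx a b) \<longleftrightarrow> parity a \<noteq> parity b"
  unfolding xor_iff[symmetric] by (cases a; cases b) (simp add: sx.simps xor_ac)

lemma evens_complement: assumes S: "spgrp S" "diag_signs S = evens"
  shows "complements {x\<in>S. snd x \<in> const_signs} S"
proof (rule const_complement[OF S(1)])
  show "ones \<notin> diag_signs S" using S(2) ones_odd by (simp add: evens_def)
  fix p b assume "(p, b) \<in> S"
  show "\<exists>a\<in>diag_signs S. sx b a \<in> const_signs"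
  proof (cases "parity b")
    case True
    then have "sx b ones \<in> diag_signs S" using S(2) ones_odd by (simp add: evens_def parity_sx)
    moreover have "sx b (sx b ones) \<in> const_signs" by (simp add: const_signs_def)
    ultimately show ?thesis by blast
  next
    case False
    then have "b \<in> diag_signs S" using S(2) by (simp add: evens_def)
    moreover have "sx b b \<in> const_signs" by (simp add: const_signs_def)
    ultimately show ?thesis by blast
  qed
qed

text \<open>For affine \<open>p\<close> the vector \<open>b + sperm b (rot P1)\<close> lies in the code. On the simplex code \<open>1 + rot\<close> is invertible,
so \<open>b\<close> differs from a code word by a rotation-invariant, hence constant, vector.\<close>

lemma simplex_complement: assumes S: "spgrp S" "cyc7 P1 \<in> S" "diag_signs S = simplex_code" "fst ` S \<subseteq> Affine"
  shows "complements {x\<in>S. snd x \<in> const_signs} S"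
proof (rule const_complement[OF S(1)])
  have "\<not> linear_word ones" by code_simp
  then show "ones \<notin> diag_signs S" using S(3) by (simp add: simplex_code_def)
  fix p b assume x: "(p, b) \<in> S"
  then have "p \<in> Affine" using S(4) by force
  then have "linear_word (sx b (sperm b (rot P1)))"
    using Affine_twist[OF S(1,2) x] S(3) by (simp add: simplex_code_def)
  moreover have "every (\<lambda>b. if linear_word (sx b (sperm b (rot P1))) then search (\<lambda>a. let d = sx b a in
    if d = sz then True else d = ones) (filter linear_word all_signs) else True) all_signs" by code_simp
  ultimately have "search (\<lambda>a. let d = sx b a in if d = sz then True else d = ones) (filter linear_word all_signs)"
    using all_signs_complete[of b] unfolding every_iff by metis
  then show "\<exists>a\<in>diag_signs S. sx b a \<in> const_signs"
    unfolding search_iff S(3) simplex_code_def const_signs_def Let_def by (auto split: if_split_asm)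
qed

lemma diag_without_ones: assumes S: "spgrp S" "cyc7 P1 \<in> S" "ones \<notin> diag_signs S"
  obtains "diag_signs S = {sz}" | "diag_signs S = simplex_code" | "diag_signs S = simplex_code'" | "diag_signs S = evens"
proof -
  have "diag_signs S \<subseteq> evens" using odd_ones[OF S(1,2)] S(3) by (auto simp: evens_def)
  then show ?thesis using cyclic_codes[OF S(1,2)] that
    by (smt (verit) inf.absorb_iff1 subset_antisym)
qed

text \<open>Relabelling the basis by \<open>i \<mapsto> - i\<close> exchanges the two simplex codes and the two Fano planes.\<close>

definition sflip :: "sp \<Rightarrow> sp" where "sflip x = (flip (fst x), sperm (snd x) (scale P6))"

lemma sflip_smul: "sflip (x \<diamondop> y) = sflip x \<diamondop> sflip y"
  by (cases x; cases y) (simp add: sflip_def flip_pm flip_def pm_assoc scale6_cancel)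

lemma sflip_sflip [simp]: "sflip (sflip x) = x"
  by (cases x) (simp add: sflip_def scale6_scale6)

lemma spgrp_sflip: assumes "spgrp S" shows "spgrp (sflip ` S)"
  using assms unfolding spgrp_def
  by (auto simp: sflip_smul[symmetric] sflip_def[of sid] sid_def) (auto simp: sflip_def sid_def image_iff intro!: bexI[of _ "(pid, sz)"])

lemma cyc7_sflip: assumes "spgrp S" "cyc7 P1 \<in> S" shows "cyc7 P1 \<in> sflip ` S"
  using cyc7_in[OF assms, of P6]
  by (intro image_eqI[of _ _ "cyc7 P6"]) (simp_all add: sflip_def cyc7_def flip_rot)

lemma diag_signs_sflip: "diag_signs (sflip ` S) = (\<lambda>b. sperm b (scale P6)) ` diag_signs S"
proof -
  have i: "sperm (sperm b (scale P6)) (scale P6) = b" for b by (simp add: scale6_scale6)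
  have "(pid, b) \<in> sflip ` S \<longleftrightarrow> sflip (pid, b) \<in> S" for b by (metis (no_types, lifting) image_iff sflip_sflip)
  then have "diag_signs (sflip ` S) = {b. sperm b (scale P6) \<in> diag_signs S}" by (simp add: diag_signs_def sflip_def)
  also have "\<dots> = (\<lambda>b. sperm b (scale P6)) ` diag_signs S" 
  proof
    show "{b. sperm b (scale P6) \<in> diag_signs S} \<subseteq> (\<lambda>b. sperm b (scale P6)) ` diag_signs S"
    proof
      fix b assume "b \<in> {b. sperm b (scale P6) \<in> diag_signs S}"
      then show "b \<in> (\<lambda>b. sperm b (scale P6)) ` diag_signs S" using i[of b] by (metis (mono_tags) imageI mem_Collect_eq)
    qed
    show "(\<lambda>b. sperm b (scale P6)) ` diag_signs S \<subseteq> {b. sperm b (scale P6) \<in> diag_signs S}" using i by auto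
  qed
  finally show ?thesis .
qed

lemma simplex_code'_flip: "(\<lambda>b. sperm b (scale P6)) ` simplex_code' = simplex_code"
  by (simp add: simplex_code'_def image_image scale6_scale6)

section \<open>The two extensions by the full collineation group\<close>

definition semidirect :: "signs set \<Rightarrow> perm set \<Rightarrow> sp set" where
  "semidirect A Q = {(p, b). p \<in> Q \<and> b \<in> A}"

text \<open>The octonion units satisfy \<open>e\<^sub>i e\<^sub>j = \<plusminus> e\<^sub>k\<close> with \<open>k = third i j\<close>, where the sign is plus if \<open>(i, j, k)\<close> is a cyclic
permutation of some \<open>(m, m + 1, m + 3)\<close>. The table records the minus signs.\<close>

fun oct_sign :: "pt \<Rightarrow> signs" where
  "oct_sign P0 = Signs False False False True False True True"
| "oct_sign P1 = Signs True False False False True False True"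
| "oct_sign P2 = Signs True True False False False True False"
| "oct_sign P3 = Signs False True True False False False True"
| "oct_sign P4 = Signs True False True True False False False"
| "oct_sign P5 = Signs False True False True True False False"
| "oct_sign P6 = Signs False False True False True True False"

definition octonionic :: "sp \<Rightarrow> bool" where
  "octonionic x \<longleftrightarrow> (\<forall>i\<in>set pts. \<forall>j\<in>set pts. i \<noteq> j \<longrightarrow>
     xor (bt (snd x) (third i j)) (bt (oct_sign i) j) =
     xor (bt (snd x) i) (xor (bt (snd x) j) (bt (oct_sign (ap (fst x) i)) (ap (fst x) j))))"

text \<open>The stabilizer of the octonion multiplication among the signed permutations. Defining it by an invariant makes closure evident and identifies the sign changes in it.\<close>

definition Octo :: "sp set" where "Octo = {x. fst x \<in> Fano \<and> octonionic x}"

lemma octonionic_iff: "octonionic x \<longleftrightarrow> (\<forall>i j. i \<noteq> j \<longrightarrow>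
     (bt (snd x) (third i j) \<noteq> bt (oct_sign i) j) =
     (bt (snd x) i \<noteq> (bt (snd x) j \<noteq> bt (oct_sign (ap (fst x) i)) (ap (fst x) j))))"
  by (simp add: octonionic_def xor_iff UNIV_pt[symmetric])

lemma sign_cocycle: assumes "(dt \<noteq> e) = (di \<noteq> (dj \<noteq> e1))" "(b \<noteq> e1) = (bi \<noteq> (bj \<noteq> e2))"
  shows "((dt \<noteq> b) \<noteq> e) = ((di \<noteq> bi) \<noteq> ((dj \<noteq> bj) \<noteq> e2))"
  using assms by (cases di; cases dj; cases bi; cases bj; cases e1; cases e2; cases b) simp_all

lemma spgrp_Octo: "spgrp Octo"
proof -
  have "octonionic (x \<diamondop> y)" if x: "octonionic x" and y: "octonionic y" "fst y \<in> Fano" for x y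
    unfolding octonionic_iff
  proof (intro allI impI)
    fix i j :: pt assume ij: "i \<noteq> j"
    obtain p b q d where e: "x = (p, b)" "y = (q, d)" by fastforce
    have q: "ap q (third i j) = third (ap q i) (ap q j)" "ap q i \<noteq> ap q j"
      using y(2) ij by (auto simp: e Fano_def fano_iff is_perm_iff inj_eq)
    show "(bt (snd (x \<diamondop> y)) (third i j) \<noteq> bt (oct_sign i) j) =
     (bt (snd (x \<diamondop> y)) i \<noteq> (bt (snd (x \<diamondop> y)) j \<noteq> bt (oct_sign (ap (fst (x \<diamondop> y)) i)) (ap (fst (x \<diamondop> y)) j)))"
      using sign_cocycle[OF y(1)[unfolded octonionic_iff e fst_conv snd_conv, rule_format, OF ij]
          x[unfolded octonionic_iff e fst_conv snd_conv, rule_format, OF q(2)]]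
      unfolding e smul.simps fst_conv snd_conv bt_sx bt_sperm ap_pm q(1) .
  qed
  moreover have "octonionic sid" by (simp add: octonionic_iff sid_def)
  ultimately show ?thesis
    unfolding spgrp_def Octo_def mem_Collect_eq fst_smul fst_sid
    using permgrpD[OF permgrp_Fano] by blast
qed

lemma cyc7_Octo: "cyc7 P1 \<in> Octo"
proof -
  have "octonionic (cyc7 P1)" by code_simp
  then show ?thesis using rot_Fano by (simp add: Octo_def cyc7_def)
qed

text \<open>For a pure sign change the octonion signs cancel, and preserving the multiplication means being a linear functional.\<close>

lemma diag_Octo: "diag_signs Octo = simplex_code"
proof -
  have "every (\<lambda>b. octonionic (pid, b) = linear_word b) all_signs" by code_simp
  then show ?thesis using all_signs_complete permgrpD(2)[OF permgrp_Fano]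
    unfolding every_iff diag_signs_def Octo_def simplex_code_def by auto
qed

definition oct_lift :: signs where "oct_lift = Signs False False False True False False True"

lemma fst_contains_Fano: assumes S: "spgrp S" "cyc7 P1 \<in> S" "(invol, s) \<in> S" shows "Fano \<subseteq> fst ` S"
proof (rule Fano_gen[OF permgrp_fst[OF S(1)]])
  show "rot P1 \<in> fst ` S" using S(2) by (force simp: cyc7_def)
  show "invol \<in> fst ` S" using S(3) by force
qed

lemma Octo_invol: "(invol, oct_lift) \<in> Octo"
proof -
  have "octonionic (invol, oct_lift)" by code_simp
  then show ?thesis using invol_Fano by (simp add: Octo_def)
qed

lemma fst_Octo: "fst ` Octo = Fano"
  using fst_contains_Fano[OF spgrp_Octo cyc7_Octo Octo_invol] by (auto simp: Octo_def)

lemma spgrp_semidirect: assumes "permgrp Q" "sz \<in> A" "\<And>a b. a \<in> A \<Longrightarrow> b \<in> A \<Longrightarrow> sx a b \<in> A"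
    "\<And>b q. b \<in> A \<Longrightarrow> q \<in> Q \<Longrightarrow> sperm b q \<in> A"
  shows "spgrp (semidirect A Q)"
  using assms permgrpD[OF assms(1)] by (auto simp: spgrp_def semidirect_def sid_def)

lemma diag_semidirect: "permgrp Q \<Longrightarrow> diag_signs (semidirect A Q) = A"
  by (auto simp: diag_signs_def semidirect_def permgrp_def)

lemma fst_semidirect: "a \<in> A \<Longrightarrow> fst ` semidirect A Q = Q"
  by (force simp: semidirect_def)

lemma cyc7_semidirect: "sz \<in> A \<Longrightarrow> rot P1 \<in> Q \<Longrightarrow> cyc7 P1 \<in> semidirect A Q"
  by (simp add: semidirect_def cyc7_def)

lemma spgrp_simplex: "permgrp Q \<Longrightarrow> Q \<subseteq> Fano \<Longrightarrow> spgrp (semidirect simplex_code Q)"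
  using simplex_sperm simplex_sx sz_simplex by (intro spgrp_semidirect) auto

lemma spgrp_evens: "permgrp Q \<Longrightarrow> spgrp (semidirect evens Q)"
  by (rule spgrp_semidirect) (auto simp: evens_def parity_sx parity_sperm permgrp_def sz_def)

lemma spgrp_Int: "spgrp S \<Longrightarrow> spgrp T \<Longrightarrow> spgrp (S \<inter> T)"
  by (auto simp: spgrp_def simp del: smul.simps)

text \<open>Two elements over one permutation differ by a sign change.\<close>

lemma spgrp_subset_eq: assumes S: "spgrp S" and T: "spgrp T" and d: "diag_signs S = diag_signs T" and q: "fst ` S \<subseteq> fst ` (S \<inter> T)"
  shows "S \<subseteq> T"
proof
  fix x assume x: "x \<in> S"
  then have "fst x \<in> fst ` (S \<inter> T)" using q by blast
  then obtain y where y: "y \<in> S" "y \<in> T" "fst y = fst x" by auto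
  obtain p a b where e: "x = (p, a)" "y = (p, b)" using y(3) by (cases x; cases y) auto
  have "sx b a \<in> diag_signs T" using same_perm[OF S, of p b a] x y e d by auto
  then have "(p, sx b (sx b a)) \<in> T" using y(2) unfolding e by (intro diag_signs_mult[OF T])
  then show "x \<in> T" by (simp add: e)
qed

lemma extension_eq: assumes S: "spgrp S" "cyc7 P1 \<in> S" "diag_signs S = simplex_code" "fst ` S = Fano"
    and T: "spgrp T" "cyc7 P1 \<in> T" "diag_signs T = simplex_code" "fst ` T = Fano"
    and s: "(invol, s) \<in> S" "(invol, s) \<in> T"
  shows "S = T"
proof -
  have "Fano \<subseteq> fst ` (S \<inter> T)" by (rule fst_contains_Fano[OF spgrp_Int[OF S(1) T(1)]]) (use S T s in auto)
  then show ?thesis using spgrp_subset_eq[OF S(1) T(1)] spgrp_subset_eq[OF T(1) S(1)] S T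
    by (simp add: Int_commute)
qed

text \<open>Of the sixteen classes of sign vectors modulo the code, all but two violate one of two relations of the
collineation group: the involution has order 2, and its product with the rotation \<open>rot P2\<close> has order 3.\<close>

lemma lift_check: "every (\<lambda>s. if linear_word s then True else if linear_word (sx s oct_lift) then True else
   search (\<lambda>w. let x = sword w (invol, s) in if fst x = pid then \<not> linear_word (snd x) else False)
     [[P0,P0],[P2,P2,P2]]) all_signs" by code_simp

text \<open>The pure rotation and one lift of the involution generate everything modulo the code, so the sign class of that lift determines \<open>S\<close>.\<close>

theorem extension_cases: assumes S: "spgrp S" "cyc7 P1 \<in> S" "diag_signs S = simplex_code" "fst ` S = Fano"
  shows "S = semidirect simplex_code Fano \<or> S = Octo"
proof -
  obtain s where s: "(invol, s) \<in> S" using S(4) invol_Fano by force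
  have "\<not> (fst (sword w (invol, s)) = pid \<and> \<not> linear_word (snd (sword w (invol, s))))" for w
    using sword_in[OF S(1,2) s, of w] S(3) by (cases "sword w (invol, s)") (auto simp: diag_signs_def simplex_code_def)
  then have "linear_word s \<or> linear_word (sx s oct_lift)"
    using lift_check all_signs_complete[of s] unfolding every_iff search_iff Let_def
    by (metis (no_types, lifting))
  then show ?thesis
  proof
    assume "linear_word s"
    then have "(invol, s) \<in> semidirect simplex_code Fano" using invol_Fano by (simp add: semidirect_def simplex_code_def)
    then have "S = semidirect simplex_code Fano"
      using permgrp_Fano rot_Fano sz_simplex
      by (intro extension_eq[OF S _ _ _ _ s]) (simp_all add: spgrp_simplex cyc7_semidirect diag_semidirect fst_semidirect)
    then show ?thesis by simp
  next
    assume "linear_word (sx s oct_lift)"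
    then have "(invol, sx oct_lift (sx s oct_lift)) \<in> Octo"
      using diag_signs_mult[OF spgrp_Octo Octo_invol] diag_Octo by (simp add: simplex_code_def)
    then have "(invol, s) \<in> Octo" by (simp add: sx_comm[of s])
    then have "S = Octo" by (intro extension_eq[OF S spgrp_Octo cyc7_Octo diag_Octo fst_Octo s])
    then show ?thesis by simp
  qed
qed

definition ssq :: "sp \<Rightarrow> sp" where "ssq x = x \<diamondop> x"
text \<open>A collineation of order 4 all of whose lifts to \<open>Octo\<close> have order 8.\<close>

definition order4 :: perm where "order4 = Perm P0 P2 P3 P6 P5 P4 P1"

lemma order4_facts: "order4 \<in> Fano" "square (square order4) = pid"
proof -
  have "is_perm order4 \<and> fano order4" "square (square order4) = pid" by code_simp+
  then show "order4 \<in> Fano" "square (square order4) = pid" by (simp_all add: Fano_def)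
qed

lemma Octo_order8: "(order4, s) \<in> Octo \<Longrightarrow> ssq (ssq (order4, s)) \<noteq> sid \<and> ssq (ssq (ssq (order4, s))) = sid"
proof -
  have "every (\<lambda>s. if octonionic (order4, s) then let x = ssq (ssq (order4, s)) in
     if x = sid then False else ssq x = sid else True) all_signs" by code_simp
  then show "(order4, s) \<in> Octo \<Longrightarrow> ssq (ssq (order4, s)) \<noteq> sid \<and> ssq (ssq (ssq (order4, s))) = sid"
    using all_signs_complete[of s] unfolding every_iff Octo_def Let_def by (auto split: if_split_asm)
qed

text \<open>A complement would contain a lift of \<open>order4\<close> whose fourth power is trivial.\<close>

lemma Octo_nonsplit: "\<not> complements K Octo"
proof
  assume K: "complements K Octo"
  then have k: "spgrp K" "K \<subseteq> Octo" "\<And>x. x \<in> K \<Longrightarrow> fst x = pid \<Longrightarrow> x = sid" "order4 \<in> fst ` K"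
    using order4_facts(1) fst_Octo by (auto simp: complements_def)
  then obtain s where s: "(order4, s) \<in> K" by force
  have "ssq (ssq (order4, s)) \<in> K" unfolding ssq_def using s spgrpD(3)[OF k(1)] by blast
  moreover have "fst (ssq (ssq (order4, s))) = pid" using order4_facts(2) by (simp only: ssq_def fst_smul square_def fst_conv)
  ultimately show False using k(2,3) Octo_order8[of s] s by blast
qed

text \<open>Distinguishes the split extension from \<open>Octo\<close> up to abstract isomorphism.\<close>

lemma semidirect_no_order8: assumes "x \<in> semidirect simplex_code Fano" "ssq (ssq (ssq x)) = sid" shows "ssq (ssq x) = sid"
proof -
  obtain p b where x: "x = (p, b)" "p \<in> Fano" "b \<in> simplex_code" using assms(1) by (auto simp: semidirect_def)
  obtain k y where y: "p = rot k \<star> y" "y \<in> set stab0" using x(2) by (rule Fano_decomp)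
  have "every (\<lambda>y. every (\<lambda>k. let p = rot k \<star> y in if square (square (square p)) = pid then every (\<lambda>b.
      let x = ssq (ssq (p, b)) in if x = sid then True else ssq x \<noteq> sid) (filter linear_word all_signs) else True) pts) stab0"
    by code_simp
  then have c: "square (square (square p)) = pid \<Longrightarrow> ssq (ssq x) = sid \<or> ssq (ssq (ssq x)) \<noteq> sid"
    using y x(3) all_signs_complete[of b] unfolding every_iff Let_def x(1) simplex_code_def by auto
  have "square (square (square p)) = fst (ssq (ssq (ssq x)))" by (simp only: ssq_def fst_smul square_def fst_conv x(1))
  then show ?thesis using c assms(2) by simp
qed

lemma simplex_Fano_complement: "complements {x \<in> semidirect simplex_code Fano. snd x \<in> const_signs} (semidirect simplex_code Fano)"
proof (rule const_complement)
  show "spgrp (semidirect simplex_code Fano)" by (rule spgrp_simplex[OF permgrp_Fano]) simp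
  have "\<not> linear_word ones" by code_simp
  then show "ones \<notin> diag_signs (semidirect simplex_code Fano)" by (simp add: diag_semidirect permgrp_Fano simplex_code_def)
  fix p b assume "(p, b) \<in> semidirect simplex_code Fano"
  then have "b \<in> simplex_code" by (simp add: semidirect_def)
  then have "b \<in> diag_signs (semidirect simplex_code Fano)" by (simp add: diag_semidirect permgrp_Fano)
  moreover have "sx b b \<in> const_signs" by (simp add: const_signs_def)
  ultimately show "\<exists>a\<in>diag_signs (semidirect simplex_code Fano). sx b a \<in> const_signs" by blast
qed

section \<open>The twisted copy of the collineation group\<close>

text \<open>The involution carries the signs of a code word, but generates with the pure rotation a group without sign changes.
It is a second complement in the split extension; its action on the lines is monomial with the sign
character of the stabilizer of a line.\<close>

definition twist_gen :: sp where "twist_gen = (invol, Signs True False True True True False False)"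

definition twisted_list :: "sp list" where
  "twisted_list = concat (map (\<lambda>i. map (\<lambda>w. cyc7 i \<diamondop> sword w twist_gen) fano_words) pts)"

fun sprod :: "sp list \<Rightarrow> sp" where "sprod [] = sid" | "sprod (x # xs) = x \<diamondop> sprod xs"

definition Twisted :: "sp set" where "Twisted = {sprod xs | xs. set xs \<subseteq> {cyc7 P1, twist_gen}}"

lemma sprod_append: "sprod (xs @ ys) = sprod xs \<diamondop> sprod ys"
  by (induction xs) (simp_all add: smul_assoc del: smul.simps)

lemma Twisted_sub: "Twisted \<subseteq> set twisted_list"
proof -
  have c: "every (\<lambda>x. if cyc7 P1 \<diamondop> x \<in> set twisted_list then twist_gen \<diamondop> x \<in> set twisted_list else False) twisted_list"
    "sid \<in> set twisted_list" by code_simp+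
  have "sprod xs \<in> set twisted_list" if "set xs \<subseteq> {cyc7 P1, twist_gen}" for xs
    using that
  proof (induction xs)
    case (Cons a xs)
    then show ?case using c(1) unfolding every_iff by (auto split: if_split_asm simp del: smul.simps)
  qed (simp add: c(2))
  then show ?thesis by (auto simp: Twisted_def)
qed

lemma spgrp_Twisted: "spgrp Twisted"
proof -
  have "sid \<in> Twisted" unfolding Twisted_def by (rule CollectI, rule exI[of _ "[]"]) simp
  moreover have "x \<diamondop> y \<in> Twisted" if "x \<in> Twisted" "y \<in> Twisted" for x y
  proof -
    obtain xs ys where "x = sprod xs" "y = sprod ys" "set (xs @ ys) \<subseteq> {cyc7 P1, twist_gen}"
      using \<open>x \<in> Twisted\<close> \<open>y \<in> Twisted\<close> by (auto simp: Twisted_def)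
    then show ?thesis unfolding Twisted_def sprod_append[symmetric] by (metis (mono_tags, lifting) mem_Collect_eq sprod_append)
  qed
  moreover have "is_perm (fst x)" if "x \<in> Twisted" for x
  proof -
    have "is_perm (fst (sprod xs))" if "set xs \<subseteq> {cyc7 P1, twist_gen}" for xs
      using that by (induction xs) (use invol_Fano in \<open>auto simp: is_perm_pm cyc7_def twist_gen_def Fano_def simp del: smul.simps\<close>)
    then show ?thesis using that by (auto simp: Twisted_def)
  qed
  ultimately show ?thesis by (auto simp: spgrp_def simp del: smul.simps)
qed

lemma Twisted_gens: "cyc7 P1 \<in> Twisted" "twist_gen \<in> Twisted"
  unfolding Twisted_def by (rule CollectI, rule exI[of _ "[cyc7 P1]"], simp del: smul.simps, 
    rule CollectI, rule exI[of _ "[twist_gen]"], simp del: smul.simps)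

lemma diag_Twisted: "diag_signs Twisted = {sz}"
proof -
  have "every (\<lambda>x. if fst x = pid then snd x = sz else True) twisted_list" by code_simp
  then have "snd x = sz" if "x \<in> Twisted" "fst x = pid" for x
    using Twisted_sub that unfolding every_iff by (metis subsetD)
  then show ?thesis using diag_signs_sz[OF spgrp_Twisted] by (auto simp: diag_signs_def)
qed

text \<open>A Klein four-group that fixes the vector \<open>v P0\<close> and whose sum annihilates the other basis vectors.\<close>

lemma Twisted_klein:
  "(Perm P0 P1 P6 P3 P5 P4 P2, Signs False True True True False False True) \<in> Twisted"
  "(Perm P0 P3 P6 P1 P4 P5 P2, Signs False True False True True True False) \<in> Twisted"
  "(Perm P0 P3 P2 P1 P5 P4 P6, Signs False False True False True True True) \<in> Twisted"
proof -
  have m: "sword w twist_gen \<in> Twisted" for w by (rule sword_in[OF spgrp_Twisted Twisted_gens])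
  have "search (\<lambda>w. sword w twist_gen = (Perm P0 P1 P6 P3 P5 P4 P2, Signs False True True True False False True)) fano_words"
   "search (\<lambda>w. sword w twist_gen = (Perm P0 P3 P6 P1 P4 P5 P2, Signs False True False True True True False)) fano_words"
   "search (\<lambda>w. sword w twist_gen = (Perm P0 P3 P2 P1 P5 P4 P6, Signs False False True False True True True)) fano_words"
    by code_simp+
  then show "(Perm P0 P1 P6 P3 P5 P4 P2, Signs False True True True False False True) \<in> Twisted"
  "(Perm P0 P3 P6 P1 P4 P5 P2, Signs False True False True True True False) \<in> Twisted"
  "(Perm P0 P3 P2 P1 P5 P4 P6, Signs False False True False True True True) \<in> Twisted"
    unfolding search_iff using m by metis+
qed

section \<open>Affine groups\<close>

definition affine_list :: "pt list \<Rightarrow> perm list" where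
  "affine_list K = concat (map (\<lambda>i. map (\<lambda>k. rot i \<star> scale k) K) pts)"

lemma affine_grp: assumes "K \<in> set [[P1],[P1,P6],[P1,P2,P4],[P1,P2,P3,P4,P5,P6]]"
  shows "permgrp (set (affine_list K))" "rot P1 \<in> set (affine_list K)" "card (set (affine_list K)) = 7 * length K"
proof -
  have "every (\<lambda>K. let A = affine_list K in if every is_perm A then if pid \<in> set A then if rot P1 \<in> set A then
      if distinct A then every (\<lambda>p. every (\<lambda>q. p \<star> q \<in> set A) A) A else False else False else False else False)
    [[P1],[P1,P6],[P1,P2,P4],[P1,P2,P3,P4,P5,P6]]" by code_simp
  note c = this[unfolded every_iff Let_def, rule_format, OF assms]
  show "permgrp (set (affine_list K))" "rot P1 \<in> set (affine_list K)"
    using c unfolding permgrp_def by (simp_all split: if_split_asm)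
  have "length (affine_list K) = 7 * length K" by (simp add: affine_list_def pts_def)
  then show "card (set (affine_list K)) = 7 * length K"
    using c distinct_card[of "affine_list K"] by (simp split: if_split_asm)
qed

lemma affine_Fano: "K \<in> set [[P1],[P1,P2,P4]] \<Longrightarrow> set (affine_list K) \<subseteq> Fano"
proof -
  have "every (\<lambda>K. every (\<lambda>p. if is_perm p then fano p else False) (affine_list K)) [[P1],[P1,P2,P4]]" by code_simp
  then show "K \<in> set [[P1],[P1,P2,P4]] \<Longrightarrow> set (affine_list K) \<subseteq> Fano"
    unfolding every_iff Fano_def by (auto split: if_split_asm)
qed


section \<open>Monomial matrices\<close>

definition basis7 :: "(pt \<Rightarrow> real^7) \<Rightarrow> bool" where
  "basis7 v \<longleftrightarrow> inj v \<and> independent (range v)"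

definition sg :: "bool \<Rightarrow> real" where "sg b = (if b then -1 else 1)"

lemma sg_simps [simp]: "sg True = -1" "sg False = 1" by (simp_all add: sg_def)
lemma sg_nz [simp]: "sg b \<noteq> 0" by (simp add: sg_def)
lemma sg_eq [simp]: "sg a = sg b \<longleftrightarrow> a = b" by (simp add: sg_def)
lemma sg_sq [simp]: "sg b * sg b = 1" by (simp add: sg_def)

definition Mat :: "(pt \<Rightarrow> real^7) \<Rightarrow> sp \<Rightarrow> real^7^7" where
  "Mat v x = (SOME A. \<forall>i. A *v v i = sg (bt (snd x) i) *\<^sub>R v (ap (fst x) i))"

lemma basis7_span: assumes "basis7 v" shows "span (range v) = UNIV"
proof -
  have "card (range v) = 7" using assms by (simp add: basis7_def card_image card_pt)
  then have "(UNIV :: (real^7) set) \<subseteq> span (range v)"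
    using assms by (intro card_ge_dim_independent) (simp_all add: basis7_def)
  then show ?thesis by blast
qed

lemma Mat: assumes "basis7 v"
  shows "Mat v x *v v i = sg (bt (snd x) i) *\<^sub>R v (ap (fst x) i)"
proof -
  have inj: "inj v" and ind: "independent (range v)" using assms by (auto simp: basis7_def)
  obtain g where g: "linear g" "\<forall>w\<in>range v. g w = sg (bt (snd x) (inv_into UNIV v w)) *\<^sub>R v (ap (fst x) (inv_into UNIV v w))"
    using linear_independent_extend[OF ind, of "\<lambda>w. sg (bt (snd x) (inv_into UNIV v w)) *\<^sub>R v (ap (fst x) (inv_into UNIV v w))"]
    by blast
  have "\<forall>i. matrix g *v v i = sg (bt (snd x) i) *\<^sub>R v (ap (fst x) i)"
    using g inj by (simp add: matrix_works)
  then have "\<forall>i. Mat v x *v v i = sg (bt (snd x) i) *\<^sub>R v (ap (fst x) i)"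
    unfolding Mat_def by (rule someI)
  then show ?thesis by blast
qed

lemma basis7_eqI: assumes "basis7 v" "\<And>i. A *v v i = B *v v i" shows "A = B"
proof -
  have "A *v x = B *v x" for x
  proof -
    have "x \<in> span (range v)" using basis7_span[OF assms(1)] by simp
    then show ?thesis
      by (rule linear_eq_on_span[OF matrix_vector_mul_linear matrix_vector_mul_linear, rotated]) (use assms(2) in auto)
  qed
  then show ?thesis by (simp add: matrix_eq)
qed

lemma sg_xor: "sg (a \<noteq> b) = sg a * sg b" by (cases a; cases b) simp_all

lemma Mat_smul: assumes v: "basis7 v" shows "Mat v (x \<diamondop> y) = Mat v x ** Mat v y"
proof (rule basis7_eqI[OF v])
  fix i
  obtain p b q d where e: "x = (p, b)" "y = (q, d)" by fastforce
  have "(Mat v x ** Mat v y) *v v i = Mat v x *v (Mat v y *v v i)" by (simp add: matrix_vector_mul_assoc)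
  also have "\<dots> = (sg (bt d i) * sg (bt b (ap q i))) *\<^sub>R v (ap p (ap q i))"
    by (simp add: Mat[OF v] e matrix_vector_mult_scaleR)
  finally show "Mat v (x \<diamondop> y) *v v i = (Mat v x ** Mat v y) *v v i"
    by (simp only: Mat[OF v] e smul.simps fst_conv snd_conv bt_sx bt_sperm sg_xor ap_pm)
qed

lemma Mat_sid: assumes v: "basis7 v" shows "Mat v sid = mat 1"
  by (rule basis7_eqI[OF v]) (simp add: Mat[OF v] sid_def)

lemma Mat_ones: assumes v: "basis7 v" shows "Mat v (pid, ones) = - mat 1"
proof (rule basis7_eqI[OF v])
  fix i
  have "(- mat 1 :: real^7^7) *v v i = - (mat 1 *v v i)"
    using matrix_vector_mult_diff_rdistrib[of 0 "mat 1 :: real^7^7" "v i"] by simp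
  then show "Mat v (pid, ones) *v v i = - mat 1 *v v i" by (simp add: Mat[OF v])
qed

lemma basis7_indep: assumes v: "basis7 v" and e: "a *\<^sub>R v i = b *\<^sub>R v j" "a \<noteq> 0" shows "i = j" "a = b"
proof -
  have d: "v k \<notin> span (range v - {v k})" for k using v by (auto simp: basis7_def dependent_def)
  show "i = j"
  proof (rule ccontr)
    assume "i \<noteq> j"
    then have "v j \<in> range v - {v i}" using v by (auto simp: basis7_def inj_eq)
    then have "(inverse a * b) *\<^sub>R v j \<in> span (range v - {v i})" by (intro span_scale span_base)
    moreover have "(inverse a * b) *\<^sub>R v j = v i" using e by (metis (no_types, lifting) left_inverse scaleR_one scaleR_scaleR)
    ultimately show False using d by simp
  qed
  then show "a = b" using e d[of i] span_zero[of "range v - {v i}"] by (metis scaleR_cancel_right)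
qed

lemma basis7_nz: "basis7 v \<Longrightarrow> v i \<noteq> 0"
  using dependent_zero by (metis basis7_def rangeI)

lemma Mat_inj: assumes v: "basis7 v" and e: "Mat v x = Mat v y" shows "x = y"
proof -
  have "sg (bt (snd x) i) *\<^sub>R v (ap (fst x) i) = sg (bt (snd y) i) *\<^sub>R v (ap (fst y) i)" for i
    using Mat[OF v, of x i] Mat[OF v, of y i] e by simp
  from basis7_indep[OF v this] have "ap (fst x) i = ap (fst y) i" "sg (bt (snd x) i) = sg (bt (snd y) i)" for i by auto
  then have "fst x = fst y" "snd x = snd y"
    by (auto intro!: perm_eqI signs_eqI)
  then show ?thesis by (simp add: prod_eq_iff)
qed

lemma basis7_coords: assumes "basis7 v" obtains c where "w = (\<Sum>i\<in>UNIV. c i *\<^sub>R v i)"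
proof -
  have "w \<in> span (range v)" using basis7_span[OF assms] by simp
  then obtain u where "w = (\<Sum>x\<in>range v. u x *\<^sub>R x)" by (auto simp: span_finite)
  also have "\<dots> = (\<Sum>i\<in>UNIV. u (v i) *\<^sub>R v i)"
    using assms by (subst sum.reindex) (auto simp: basis7_def)
  finally show ?thesis by (rule that)
qed

lemma mv_sum: "(A :: real^7^7) *v (\<Sum>i\<in>I. f i) = (\<Sum>i\<in>I. A *v f i)"
  using linear_sum[OF matrix_vector_mul_linear] by blast

definition stable_sub :: "(pt \<Rightarrow> real^7) \<Rightarrow> sp set \<Rightarrow> (real^7) set \<Rightarrow> bool" where
  "stable_sub v S W \<longleftrightarrow> subspace W \<and> (\<forall>x\<in>S. \<forall>w\<in>W. Mat v x *v w \<in> W)"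

lemma irreducible_iff: "irreducible_group (Mat v ` S) \<longleftrightarrow> (\<forall>W. stable_sub v S W \<longrightarrow> W = {0} \<or> W = UNIV)"
proof -
  have "(UNIV :: (real^7) set) \<noteq> {0}" by (metis UNIV_I axis_eq_0_iff singletonD zero_neq_one)
  then show ?thesis
    unfolding irreducible_group_def irreducible_subrep_def stable_sub_def
    by (auto simp: image_subset_iff)
qed

lemma stable_sub_all: assumes v: "basis7 v" and S: "spgrp S" "cyc7 P1 \<in> S" and W: "stable_sub v S W" "v i \<in> W"
  shows "W = UNIV"
proof -
  have "v j \<in> W" for j
  proof -
    obtain k where k: "ap (rot k) i = j"
    proof
      show "ap (rot (ap (rot j) (neg i))) i = j" by (cases i; cases j) (simp_all add: rot.simps)
    qed
    have "Mat v (cyc7 k) *v v i \<in> W" using W cyc7_in[OF S] by (auto simp: stable_sub_def)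
    then show ?thesis by (simp add: Mat[OF v] cyc7_def k)
  qed
  then have "span (range v) \<subseteq> W" using W by (intro span_minimal) (auto simp: stable_sub_def)
  then show ?thesis using basis7_span[OF v] by blast
qed

text \<open>In a nonzero invariant subspace take a vector with few nonzero coordinates. If two of them are nonzero, a
sign change that separates them produces a vector in which one of them has disappeared. So a basis vector lies in the
subspace, and the rotation yields the others.\<close>

lemma irreducible_diagonal:
  assumes v: "basis7 v" and S: "spgrp S" "cyc7 P1 \<in> S" "simplex_code \<subseteq> diag_signs S"
  shows "irreducible_group (Mat v ` S)"
  unfolding irreducible_iff
proof (intro allI impI)
  fix W assume W: "stable_sub v S W"
  then have sub: "subspace W" and inv: "\<And>x w. x \<in> S \<Longrightarrow> w \<in> W \<Longrightarrow> Mat v x *v w \<in> W"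
    by (auto simp: stable_sub_def)
  let ?vec = "\<lambda>c. \<Sum>i\<in>UNIV. c i *\<^sub>R v i"
  have key: "\<exists>i. v i \<in> W" if "?vec c \<in> W" "c \<noteq> (\<lambda>_. 0)" for c
    using that
  proof (induction "card {i. c i \<noteq> 0}" arbitrary: c rule: less_induct)
    case less
    then obtain i where i: "c i \<noteq> 0" by auto
    show ?case
    proof (cases "\<exists>j. j \<noteq> i \<and> c j \<noteq> 0")
      case False
      then have "?vec c = (\<Sum>k\<in>UNIV. if k = i then c i *\<^sub>R v i else 0)" by (intro sum.cong) auto
      then have "c i *\<^sub>R v i \<in> W" using less.prems(1) by simp
      then have "inverse (c i) *\<^sub>R (c i *\<^sub>R v i) \<in> W" by (rule subspace_scale[OF sub])
      then show ?thesis using i by auto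
    next
      case True
      then obtain j where j: "j \<noteq> i" "c j \<noteq> 0" by blast
      obtain b where b: "b \<in> simplex_code" "bt b i \<noteq> bt b j" using simplex_separates j(1) by metis
      then have x: "(pid, b) \<in> S" using S(3) by (auto simp: diag_signs_def)
      \<comment> \<open>add or subtract the image under the sign change so that coordinate \<open>i\<close> doubles and \<open>j\<close> cancels\<close>
      define d where "d k = c k + sg (bt b i) * sg (bt b k) * c k" for k
      have "Mat v (pid, b) *v ?vec c = ?vec (\<lambda>k. sg (bt b k) * c k)"
        by (simp add: mv_sum Mat[OF v] matrix_vector_mult_scaleR mult.commute)
      then have "?vec d = ?vec c + sg (bt b i) *\<^sub>R (Mat v (pid, b) *v ?vec c)"
        by (simp add: d_def scaleR_add_left sum.distrib scaleR_sum_right mult.assoc)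
      then have "?vec d \<in> W"
        using inv[OF x less.prems(1)] less.prems(1) sub by (simp add: subspace_add subspace_scale)
      moreover have "{k. d k \<noteq> 0} \<subseteq> {k. c k \<noteq> 0}" by (auto simp: d_def)
      moreover have "d j = 0" using b(2) by (auto simp: d_def sg_def)
      ultimately have "card {k. d k \<noteq> 0} < card {k. c k \<noteq> 0}" using j(2) by (intro psubset_card_mono) auto
      moreover have "d i = 2 * c i" by (simp add: d_def)
      then have "d \<noteq> (\<lambda>_. 0)" using i by auto
      ultimately show ?thesis using less.hyps \<open>?vec d \<in> W\<close> by blast
    qed
  qed
  show "W = {0} \<or> W = UNIV"
  proof (cases "W = {0}")
    case False
    then obtain w where w: "w \<in> W" "w \<noteq> 0" using subspace_0[OF sub] by blast
    obtain c where c: "w = ?vec c" by (rule basis7_coords[OF v])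
    have "c \<noteq> (\<lambda>_. 0)" using w(2) c by auto
    then show ?thesis using key w(1) c stable_sub_all[OF v S(1,2) W] by blast
  qed simp
qed

text \<open>After a rotation the coordinate at \<open>P0\<close> is nonzero, and the sum over the Klein four-group multiplies that coordinate by 4 and kills the others.\<close>

lemma irreducible_Twisted: assumes v: "basis7 v" shows "irreducible_group (Mat v ` Twisted)"
  unfolding irreducible_iff
proof (intro allI impI)
  fix W assume W: "stable_sub v Twisted W"
  then have sub: "subspace W" and inv: "\<And>x w. x \<in> Twisted \<Longrightarrow> w \<in> W \<Longrightarrow> Mat v x *v w \<in> W"
    by (auto simp: stable_sub_def)
  let ?vec = "\<lambda>c. \<Sum>i\<in>UNIV. c i *\<^sub>R v i"
  show "W = {0} \<or> W = UNIV"
  proof (cases "W = {0}")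
    case False
    then obtain w where w: "w \<in> W" "w \<noteq> 0" using subspace_0[OF sub] by blast
    obtain c where c: "w = ?vec c" by (rule basis7_coords[OF v])
    then obtain j where j: "c j \<noteq> 0" using w(2) by (metis (no_types, lifting) scaleR_zero_left sum.neutral)
    define w' where "w' = Mat v (cyc7 (neg j)) *v w"
    have w': "w' \<in> W" using inv[OF cyc7_in[OF spgrp_Twisted Twisted_gens(1)] w(1)] by (simp add: w'_def)
    define d where "d k = c (ap (rot j) k)" for k
    have "w' = (\<Sum>i\<in>UNIV. c i *\<^sub>R v (ap (rot (neg j)) i))"
      by (simp add: w'_def c mv_sum Mat[OF v] matrix_vector_mult_scaleR cyc7_def)
    also have "\<dots> = (\<Sum>i\<in>UNIV. c (ap (rot j) i) *\<^sub>R v (ap (rot (neg j)) (ap (rot j) i)))"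
      by (rule sum.reindex_bij_betw[symmetric]) (use is_perm_rot[of j] is_perm_bij in auto)
    also have "\<dots> = ?vec d" by (simp add: d_def ap_pm[symmetric] del: ap_pm)
    finally have wd: "?vec d \<in> W" using w' by simp
    have d0: "d P0 \<noteq> 0" using j by (simp add: d_def)
    define E where "E = ?vec d + (Mat v (Perm P0 P1 P6 P3 P5 P4 P2, Signs False True True True False False True) *v ?vec d)
      + (Mat v (Perm P0 P3 P6 P1 P4 P5 P2, Signs False True False True True True False) *v ?vec d)
      + (Mat v (Perm P0 P3 P2 P1 P5 P4 P6, Signs False False True False True True True) *v ?vec d)"
    have "E \<in> W" unfolding E_def using inv[OF Twisted_klein(1) wd] inv[OF Twisted_klein(2) wd] inv[OF Twisted_klein(3) wd]
      by (intro subspace_add[OF sub] wd)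
    moreover have "E = (4 * d P0) *\<^sub>R v P0"
    proof -
      have s: "(\<Sum>i\<in>UNIV. f i) = f P0 + (f P1 + (f P2 + (f P3 + (f P4 + (f P5 + f P6)))))" for f :: "pt \<Rightarrow> real^7"
        by (simp add: UNIV_pt pts_def)
      show ?thesis unfolding E_def mv_sum s
        by (simp add: Mat[OF v] matrix_vector_right_distrib matrix_vector_mult_scaleR vec_eq_iff)
    qed
    ultimately have "inverse (4 * d P0) *\<^sub>R ((4 * d P0) *\<^sub>R v P0) \<in> W" using subspace_scale[OF sub] by metis
    then have "v P0 \<in> W" using d0 by simp
    then show ?thesis using stable_sub_all[OF v spgrp_Twisted Twisted_gens(1) W] by blast
  qed simp
qed

lemma sum_fixed_reducible: assumes v: "basis7 v" and S: "spgrp S" and c: "\<And>p b. (p, b) \<in> S \<Longrightarrow> b \<in> const_signs"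
  shows "\<not> irreducible_group (Mat v ` S)"
proof
  assume irr: "irreducible_group (Mat v ` S)"
  let ?u = "\<Sum>i\<in>UNIV. v i"
  have act: "Mat v x *v ?u = sg (bt (snd x) P0) *\<^sub>R ?u" if x: "x \<in> S" for x
  proof -
    have is_perm: "bij (ap (fst x))" using spgrpD(1)[OF S x] by (simp add: is_perm_bij)
    have cs: "bt (snd x) i = bt (snd x) P0" for i using c[of "fst x" "snd x"] x by (auto simp: const_signs_def)
    have "Mat v x *v ?u = (\<Sum>i\<in>UNIV. sg (bt (snd x) P0) *\<^sub>R v (ap (fst x) i))"
      unfolding mv_sum Mat[OF v] 
    proof (rule sum.cong[OF refl])
      fix i show "sg (bt (snd x) i) *\<^sub>R v (ap (fst x) i) = sg (bt (snd x) P0) *\<^sub>R v (ap (fst x) i)"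
        by (simp only: cs[of i])
    qed
    also have "\<dots> = sg (bt (snd x) P0) *\<^sub>R (\<Sum>i\<in>UNIV. v (ap (fst x) i))" by (simp add: scaleR_sum_right)
    also have "(\<Sum>i\<in>UNIV. v (ap (fst x) i)) = ?u" by (rule sum.reindex_bij_betw[OF is_perm])
    finally show ?thesis .
  qed
  have "stable_sub v S (span {?u})"
    unfolding stable_sub_def
  proof (intro conjI ballI)
    fix x w assume "x \<in> S" "w \<in> span {?u}"
    then obtain k where "w = k *\<^sub>R ?u" by (auto simp: span_singleton)
    then have "Mat v x *v w = (k * sg (bt (snd x) P0)) *\<^sub>R ?u"
      using act[OF \<open>x \<in> S\<close>] by (simp add: matrix_vector_mult_scaleR)
    then show "Mat v x *v w \<in> span {?u}" by (simp add: span_base span_scale)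
  qed simp
  then have "span {?u} = {0} \<or> span {?u} = UNIV" using irr unfolding irreducible_iff by blast
  moreover have d: "dim (span {?u}) \<le> 1" using dim_le_card[of "span {?u}" "{?u}"] by simp
  have "span {?u} \<noteq> UNIV"
  proof
    assume e: "span {?u} = UNIV"
    have "dim (UNIV :: (real^7) set) \<le> 1" using d unfolding e .
    then show False by simp
  qed
  ultimately have "span {?u} = {0}" by blast
  then have "?u = 0" using span_base[of ?u "{?u}"] by simp
  moreover have "(\<Sum>x\<in>range v. 1 *\<^sub>R x) = ?u" using v by (subst sum.reindex) (auto simp: basis7_def)
  ultimately have "(1::real) = 0" using v independentD[of "range v" "range v" "\<lambda>_. 1" "v P0"]
    by (auto simp: basis7_def)
  then show False by simp
qed

section \<open>Systems of imprimitivity in prime dimension\<close>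

lemma group_orthogonal: "group (orthogonal_group :: (real^'n^'n) monoid)"
proof (rule groupI)
  fix x :: "real^'n^'n" assume x: "x \<in> carrier orthogonal_group"
  then have "transpose x \<in> carrier orthogonal_group" "transpose x \<otimes>\<^bsub>orthogonal_group\<^esub> x = \<one>\<^bsub>orthogonal_group\<^esub>"
    by (simp_all add: orthogonal_group_def orthogonal_matrix_def)
  then show "\<exists>y\<in>carrier orthogonal_group. y \<otimes>\<^bsub>orthogonal_group\<^esub> x = \<one>\<^bsub>orthogonal_group\<^esub>" by blast
qed (auto simp: orthogonal_group_def orthogonal_matrix_mul matrix_mul_assoc orthogonal_matrix_id)

lemma orth_simps [simp]: "mult orthogonal_group = (**)" "one orthogonal_group = mat 1"
  "carrier orthogonal_group = {Q. orthogonal_matrix Q}"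
  by (simp_all add: orthogonal_group_def)

lemma finite_orth_subgroupI: assumes "G \<subseteq> {Q :: real^'n^'n. orthogonal_matrix Q}" "finite G" "mat 1 \<in> G" "\<And>x y. x \<in> G \<Longrightarrow> y \<in> G \<Longrightarrow> x ** y \<in> G"
  shows "subgroup G orthogonal_group"
proof -
  interpret group "orthogonal_group :: (real^'n^'n) monoid" by (rule group_orthogonal)
  show ?thesis
  proof (rule subgroupI)
    fix a assume a: "a \<in> G"
    then have oa: "orthogonal_matrix a" using assms(1) by blast
    have "inj_on (\<lambda>x. a ** x) G"
    proof (rule inj_onI)
      fix x y assume "a ** x = a ** y"
      then have "transpose a ** a ** x = transpose a ** a ** y" by (metis matrix_mul_assoc)
      then show "x = y" using oa by (simp add: orthogonal_matrix_def)
    qed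
    then have "(\<lambda>x. a ** x) ` G = G" using assms(2,4) a by (intro endo_inj_surj) auto
    then obtain x where x: "x \<in> G" "a ** x = mat 1" using assms(3) by (metis imageE)
    then have "inv\<^bsub>orthogonal_group\<^esub> a = x" using assms(1) a by (intro inv_equality[OF _ _ ]) (auto simp: matrix_left_right_inverse)
    then show "inv\<^bsub>orthogonal_group\<^esub> a \<in> G" using x by simp
  qed (use assms in auto)
qed

definition monomial_rep :: "(real^7^7) set \<Rightarrow> (pt \<Rightarrow> real^7) \<Rightarrow> sp set \<Rightarrow> bool" where
  "monomial_rep G v S \<longleftrightarrow> basis7 v \<and> spgrp S \<and> cyc7 P1 \<in> S \<and> G = Mat v ` S"


lemma transpose_group: assumes G: "subgroup G (orthogonal_group :: (real^'n^'n) monoid)" and g: "g \<in> G"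
  shows "orthogonal_matrix g" "transpose g \<in> G" "transpose g ** g = mat 1" "g ** transpose g = mat 1"
proof -
  interpret group "orthogonal_group :: (real^'n^'n) monoid" by (rule group_orthogonal)
  show o: "orthogonal_matrix g" using subgroup.subset[OF G] g by auto
  then show t: "transpose g ** g = mat 1" "g ** transpose g = mat 1" by (auto simp: orthogonal_matrix_def)
  have "inv\<^bsub>orthogonal_group\<^esub> g = transpose g" using o t by (intro inv_equality) simp_all
  then show "transpose g \<in> G" using subgroup.m_inv_closed[OF G g] by simp
qed

lemma subgroup_orth: assumes G: "subgroup G (orthogonal_group :: (real^'n^'n) monoid)"
  shows "mat 1 \<in> G" "x \<in> G \<Longrightarrow> y \<in> G \<Longrightarrow> x ** y \<in> G"
  using subgroup.one_closed[OF G] subgroup.m_closed[OF G] by auto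

lemma orth_inj: "orthogonal_matrix g \<Longrightarrow> inj ((*v) (g :: real^'n^'n))"
  by (rule injI) (metis matrix_vector_mul_assoc matrix_vector_mul_lid orthogonal_matrix_def)

definition act :: "real^'n^'n \<Rightarrow> (real^'n) set \<Rightarrow> (real^'n) set" where "act g V = (*v) g ` V"

lemma act_mult: "act (g ** h) V = act g (act h V)"
  by (auto simp: act_def image_image matrix_vector_mul_assoc)

lemma act_1 [simp]: "act (mat 1) V = V" by (simp add: act_def)

lemma act_span: "span (act g A) = act g (span A)"
  unfolding act_def using linear_span_image[OF matrix_vector_mul_linear] .

lemma act_Union: "act g (\<Union>F) = \<Union>(act g ` F)" by (auto simp: act_def)

locale permuted_family =
  fixes G :: "(real^'n^'n) set" and F :: "(real^'n) set set"
  assumes G: "subgroup G orthogonal_group" "finite G" "irreducible_group G"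
    and F: "finite F" "card F > 1" "\<And>V. V \<in> F \<Longrightarrow> subspace V" "\<And>V. V \<in> F \<Longrightarrow> V \<noteq> {0}"
      "\<And>V. V \<in> F \<Longrightarrow> V \<inter> span (\<Union>(F - {V})) = {0}"
      "span (\<Union>F) = UNIV" "\<And>g. g \<in> G \<Longrightarrow> act g ` F = F"
begin

lemma act_in: "g \<in> G \<Longrightarrow> V \<in> F \<Longrightarrow> act g V \<in> F" using F(7) by blast

text \<open>The span of an orbit is invariant, so it is everything, and linear independence leaves no room for a member outside the orbit.\<close>

lemma transitive: assumes V: "V \<in> F" and W: "W \<in> F" shows "\<exists>g\<in>G. act g V = W"
proof (rule ccontr)
  assume no: "\<not> (\<exists>g\<in>G. act g V = W)"
  let ?O = "(\<lambda>g. act g V) ` G"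
  have O: "?O \<subseteq> F - {W}" using no act_in V by blast
  have inv: "act h (span (\<Union>?O)) \<subseteq> span (\<Union>?O)" if h: "h \<in> G" for h
  proof -
    have "act h ` ?O \<subseteq> ?O"
    proof (clarify)
      fix g assume "g \<in> G"
      then have "h ** g \<in> G" using subgroup_orth(2)[OF G(1) h] by blast
      then show "act h (act g V) \<in> ?O" by (metis act_mult imageI)
    qed
    then show ?thesis unfolding act_span[symmetric] act_Union by (intro span_mono Union_mono)
  qed
  have "V \<in> ?O" using subgroup_orth(1)[OF G(1)] by (metis act_1 imageI)
  moreover obtain v where "v \<in> V" "v \<noteq> 0" using F(3,4)[OF V] subspace_0 by blast
  ultimately have "span (\<Union>?O) \<noteq> {0}" using span_base[of v "\<Union>?O"] by blast
  moreover have "\<And>U. subspace U \<Longrightarrow> (\<forall>g\<in>G. (*v) g ` U \<subseteq> U) \<Longrightarrow> U = {0} \<or> U = UNIV"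
    using G(3) unfolding irreducible_group_def irreducible_subrep_def by blast
  ultimately have "span (\<Union>?O) = UNIV" 
    using inv unfolding act_def by (meson subspace_span)
  then have "span (\<Union>(F - {W})) = UNIV" using O by (metis Union_mono span_mono top.extremum_uniqueI)
  then show False using F(4,5)[OF W] by simp
qed

lemma dim_eq: assumes V: "V \<in> F" and W: "W \<in> F" shows "dim V = dim W"
proof -
  obtain g where g: "g \<in> G" "act g V = W" using transitive[OF V W] by blast
  have "inj_on ((*v) g) (span V)" using orth_inj[OF transpose_group(1)[OF G(1) g(1)]] by (rule inj_on_subset) simp
  then have "dim (act g V) = dim V" unfolding act_def by (intro dim_image_eq) auto
  then show ?thesis using g by simp
qed

text \<open>The dimension of a direct sum.\<close>

lemma dim_span_Union: "T \<subseteq> F \<Longrightarrow> dim (span (\<Union>T)) = (\<Sum>V\<in>T. dim V)"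
proof (induction T rule: infinite_finite_induct)
  case (infinite T)
  then show ?case using F(1) finite_subset by blast
next
  case empty
  then show ?case by simp
next
  case (insert V T)
  let ?T = "span (\<Union>T)"
  have V: "V \<in> F" using insert by blast
  have "V \<inter> ?T \<subseteq> {0}"
  proof -
    have "?T \<subseteq> span (\<Union>(F - {V}))" using insert by (intro span_mono Union_mono) blast
    then show ?thesis using F(5)[OF V] by blast
  qed
  then have z: "dim (V \<inter> ?T) = 0" using dim_eq_0 by blast
  have "span (\<Union>(insert V T)) = {x + y |x y. x \<in> V \<and> y \<in> ?T}"
    using F(3)[OF V] by (simp add: span_Un span_eq_iff[THEN iffD2] Setcompr_eq_image)
  then have "dim (span (\<Union>(insert V T))) = dim V + dim ?T"
    using dim_sums_Int[OF F(3)[OF V] subspace_span[of "\<Union>T"]] z by simp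
  then show ?case using insert by simp
qed

end

locale permuted_family7 = permuted_family G F for G :: "(real^7^7) set" and F
begin

lemma lines: "card F = 7" "V \<in> F \<Longrightarrow> dim V = 1"
proof -
  obtain V0 where V0: "V0 \<in> F" using F(2) by fastforce
  have "dim (span (\<Union>F)) = (\<Sum>V\<in>F. dim V0)" unfolding dim_span_Union[OF subset_refl]
    by (rule sum.cong[OF refl]) (rule dim_eq[OF _ V0])
  then have "7 = card F * dim V0" using F(6) by simp
  then have "card F dvd 7" by (metis dvd_triv_left)
  moreover have "Factorial_Ring.prime (7::nat)" by simp
  ultimately have c: "card F = 7" using F(2) by (metis less_numeral_extra(4) prime_nat_iff)
  then show "card F = 7" .
  have "7 = 7 * dim V0" using \<open>7 = card F * dim V0\<close> unfolding c .
  then have "dim V0 = 1" by linarith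
  then show "V \<in> F \<Longrightarrow> dim V = 1" using dim_eq V0 by metis
qed

text \<open>Orbit and stabilizer: the elements taking a fixed line to a given one form a coset of its stabilizer.\<close>

lemma seven_dvd_card: "7 dvd card G"
proof -
  obtain V0 where V0: "V0 \<in> F" using F(2) by fastforce
  let ?f = "\<lambda>V. {g\<in>G. act g V0 = V}"
  have "card (?f V) = card (?f V0)" if V: "V \<in> F" for V
  proof -
    obtain h where h: "h \<in> G" "act h V0 = V" using transitive[OF V0 V] by blast
    note t = transpose_group[OF G(1) h(1)]
    have th: "act (transpose h) V = V0" using t(3) h(2) by (metis act_1 act_mult)
    have "bij_betw (\<lambda>g. h ** g) (?f V0) (?f V)"
    proof (rule bij_betw_byWitness[where f'="\<lambda>g. transpose h ** g"])
      show "(**) h ` ?f V0 \<subseteq> ?f V" using h subgroup_orth(2)[OF G(1)] by (auto simp: act_mult)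
      show "(**) (transpose h) ` ?f V \<subseteq> ?f V0" using t(2) th subgroup_orth(2)[OF G(1)] by (auto simp: act_mult)
    qed (simp_all add: matrix_mul_assoc t)
    then show ?thesis by (simp add: bij_betw_same_card)
  qed
  then have "(\<Sum>V\<in>F. card (?f V)) = 7 * card (?f V0)" using lines(1) by simp
  moreover have "card (\<Union>V\<in>F. ?f V) = (\<Sum>V\<in>F. card (?f V))"
    by (rule card_UN_disjoint) (use F(1) G(2) in auto)
  moreover have "(\<Union>V\<in>F. ?f V) = G" using act_in V0 by blast
  ultimately show ?thesis by simp
qed

primrec mpow :: "real^7^7 \<Rightarrow> nat \<Rightarrow> real^7^7" where
  "mpow C 0 = mat 1"
| "mpow C (Suc n) = C ** mpow C n"

lemma mpow_in: "C \<in> G \<Longrightarrow> mpow C n \<in> G"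
  by (induction n) (auto simp: subgroup_orth[OF G(1)])

lemma mpow_add: "mpow C (m + n) = mpow C m ** mpow C n"
  by (induction m) (simp_all add: matrix_mul_assoc)

lemma order_7: obtains C where "C \<in> G" "mpow C 7 = mat 1" "C \<noteq> mat 1"
proof -
  interpret O: group "orthogonal_group :: (real^7^7) monoid" by (rule group_orthogonal)
  interpret M: group "matrix_group G" using O.subgroup_imp_group[OF G(1)] .
  obtain m where m: "card G = 7 ^ 1 * m" using seven_dvd_card by (auto elim: dvdE)
  have "\<exists>H. subgroup H (matrix_group G) \<and> card H = 7 ^ 1"
    by (rule sylow_thm[OF _ M.is_group, of 7 1 m]) (use m G(2) in \<open>simp_all add: order_def\<close>)
  then obtain H where H: "subgroup H (matrix_group G)" "card H = 7" by auto
  have "\<not> H \<subseteq> {mat 1}" using H(2) card_mono[of "{mat 1}" H] by auto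
  then obtain C where C: "C \<in> H" "C \<noteq> mat 1" by blast
  have CG: "C \<in> G" using subgroup.subset[OF H(1)] C(1) by auto
  interpret HH: group "matrix_group G\<lparr>carrier := H\<rparr>" using M.subgroup_imp_group[OF H(1)] .
  have p: "C [^]\<^bsub>matrix_group G\<lparr>carrier := H\<rparr>\<^esub> n = mpow C n" for n
  proof (induction n)
    case (Suc n)
    have "C [^]\<^bsub>matrix_group G\<lparr>carrier := H\<rparr>\<^esub> Suc n = mpow C n ** C" using Suc by simp
    also have "\<dots> = mpow C (n + 1)" unfolding mpow_add by simp
    finally show ?case by simp
  qed simp
  have "C [^]\<^bsub>matrix_group G\<lparr>carrier := H\<rparr>\<^esub> order (matrix_group G\<lparr>carrier := H\<rparr>) = \<one>\<^bsub>matrix_group G\<lparr>carrier := H\<rparr>\<^esub>"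
    by (rule HH.pow_order_eq_1) (use C in simp)
  then have "mpow C 7 = mat 1" unfolding p by (simp add: order_def H(2))
  then show ?thesis using that CG C(2) by blast
qed

lemma line_span: assumes "V \<in> F" "v \<in> V" "v \<noteq> 0" shows "V = span {v}"
proof -
  have "{v} \<subseteq> V" "independent {v}" "dim V \<le> card {v}" using assms lines(2) by auto
  then have "V \<subseteq> span {v}" using card_ge_dim_independent by metis
  moreover have "span {v} \<subseteq> V" using assms F(3) by (intro span_minimal) auto
  ultimately show ?thesis by blast
qed

end

fun pn :: "pt \<Rightarrow> nat" where
  "pn P0 = 0" | "pn P1 = 1" | "pn P2 = 2" | "pn P3 = 3" | "pn P4 = 4" | "pn P5 = 5" | "pn P6 = 6"

lemma pn_less: "pn i < 7" by (cases i) simp_all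
lemma inj_pn: "pn i = pn j \<longleftrightarrow> i = j" by (cases i; cases j) simp_all

context permuted_family7
begin

text \<open>On a fixed line an element of order 7 acts by a real seventh root of unity, which is 1.\<close>

lemma moved_line: assumes C: "C \<in> G" "mpow C 7 = mat 1" "C \<noteq> mat 1" obtains V where "V \<in> F" "act C V \<noteq> V"
proof -
  have "\<exists>V\<in>F. act C V \<noteq> V"
  proof (rule ccontr)
    assume "\<not> ?thesis"
    then have fx: "\<And>V. V \<in> F \<Longrightarrow> act C V = V" by blast
    have fixed: "C *v v = v" if v: "v \<in> V" "V \<in> F" for v V
    proof (cases "v = 0")
      case False
      have "C *v v \<in> span {v}" using fx[OF v(2)] v line_span[OF v(2,1) False] by (auto simp: act_def)
      then obtain k where k: "C *v v = k *\<^sub>R v" by (auto simp: span_singleton)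
      have "mpow C n *v v = k ^ n *\<^sub>R v" for n
        by (induction n) (simp_all add: matrix_vector_mul_assoc[symmetric] k matrix_vector_mult_scaleR mult.commute)
      from this[of 7] have "(k ^ 7) *\<^sub>R v = 1 *\<^sub>R v" using C(2) by simp
      then have "k ^ 7 = 1 ^ 7" using False by (metis one_power2 power_one scaleR_cancel_right)
      then have k7: "k ^ 7 = 1" by simp
      have "k = root 7 (k ^ 7)" by (rule odd_real_root_power_cancel[symmetric]) simp
      then have "k = 1" using k7 by simp
      then show ?thesis using k by simp
    qed simp
    have "C *v x = mat 1 *v x" if "x \<in> span (\<Union>F)" for x
      using that
      by (rule linear_eq_on_span[OF matrix_vector_mul_linear matrix_vector_mul_linear, rotated]) (use fixed in auto)
    then have "C = mat 1" using F(6) by (simp add: matrix_eq)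
    then show False using C(3) by simp
  qed
  then show ?thesis using that by blast
qed

text \<open>If the power \<open>n\<close> fixes \<open>V\<close>, then so does \<open>C\<close> itself, because \<open>n\<close> is invertible modulo 7.\<close>

lemma orbit_period:
  assumes C: "mpow C 7 = mat 1" and n: "act (mpow C n) V = V" "0 < n" "n < 7"
  shows "act C V = V"
proof -
  have m: "act (mpow C (k * n)) V = V" for k
    by (induction k) (simp_all add: mpow_add act_mult n(1))
  have s: "mpow C (7 * j + 1) = C" for j
  proof (induction j)
    case (Suc j)
    have "mpow C (7 * Suc j + 1) = mpow C 7 ** mpow C (7 * j + 1)" unfolding mpow_add[symmetric] by (simp add: algebra_simps)
    then show ?case using Suc C by simp
  qed simp
  have "n \<in> {1,2,3,4,5,6}" using n by auto
  then obtain k j where "k * n = 7 * j + 1"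
  proof (elim insertE emptyE)
    show "n = 1 \<Longrightarrow> thesis" using that[of 1 0] by simp
    show "n = 2 \<Longrightarrow> thesis" using that[of 4 1] by simp
    show "n = 3 \<Longrightarrow> thesis" using that[of 5 2] by simp
    show "n = 4 \<Longrightarrow> thesis" using that[of 2 1] by simp
    show "n = 5 \<Longrightarrow> thesis" using that[of 3 2] by simp
    show "n = 6 \<Longrightarrow> thesis" using that[of 6 5] by simp
  qed
  then show ?thesis using m[of k] s[of j] by simp
qed

text \<open>The basis consists of the images of one vector under the powers of \<open>C\<close>. They have equal length, so an orthogonal matrix that permutes the lines multiplies them by 1 or -1.\<close>

theorem monomial: "\<exists>v S. monomial_rep G v S"
proof -
  obtain C where C: "C \<in> G" "mpow C 7 = mat 1" "C \<noteq> mat 1" by (rule order_7)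
  obtain V where V: "V \<in> F" "act C V \<noteq> V" by (rule moved_line[OF C])
  obtain v0 where v0: "v0 \<in> V" "v0 \<noteq> 0" using F(3,4)[OF V(1)] subspace_0 by blast
  define v where "v i = mpow C (pn i) *v v0" for i
  define L where "L i = act (mpow C (pn i)) V" for i
  have LF: "L i \<in> F" for i unfolding L_def using act_in mpow_in C(1) V(1) by blast
  have orth: "orthogonal_matrix g" if "g \<in> G" for g using transpose_group(1)[OF G(1) that] .
  have nrm: "norm (g *v x) = norm x" if "g \<in> G" for g x
    using orth[OF that] orthogonal_transformation_matrix[of "(*v) g"] orthogonal_transformation_norm
    by (metis matrix_of_matrix_vector_mul matrix_vector_mul_linear)
  have vL: "v i \<in> L i" for i using v0 by (auto simp: v_def L_def act_def)
  have vn: "norm (v i) = norm v0" for i unfolding v_def by (rule nrm[OF mpow_in[OF C(1)]])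
  have vnz: "v i \<noteq> 0" for i using vn[of i] v0(2) by auto
  have Lv: "L i = span {v i}" for i by (rule line_span[OF LF vL vnz])
  have ne: "L i \<noteq> L j" if lt: "pn i < pn j" for i j
  proof
    assume e: "L i = L j"
    let ?n = "pn j - pn i"
    have "pn j = pn i + ?n" using lt by simp
    then have "mpow C (pn j) = mpow C (pn i) ** mpow C ?n" by (metis mpow_add)
    then have "act (mpow C (pn i)) V = act (mpow C (pn i)) (act (mpow C ?n) V)" using e by (simp add: L_def act_mult)
    then have "V = act (mpow C ?n) V"
      unfolding act_def[of "mpow C (pn i)"] using inj_image_eq_iff[OF orth_inj[OF orth[OF mpow_in[OF C(1)]]]] by blast
    then have "act C V = V" using lt pn_less[of j] by (intro orbit_period[OF C(2), of ?n]) auto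
    then show False using V(2) by simp
  qed
  then have injL: "inj L" by (metis injI inj_pn linorder_neqE_nat)
  have rL: "range L = F"
    by (rule card_subset_eq[OF F(1)]) (use LF in \<open>auto simp: card_image[OF injL] card_pt lines(1)\<close>)
  have injv: "inj v" using injL Lv by (metis injD injI)
  have ind: "independent (range v)"
    unfolding dependent_def
  proof (clarify)
    fix i assume "v i \<in> span (range v - {v i})"
    moreover have "range v - {v i} \<subseteq> \<Union>(F - {L i})"
    proof
      fix x assume "x \<in> range v - {v i}"
      then obtain j where j: "x = v j" "j \<noteq> i" by blast
      then show "x \<in> \<Union>(F - {L i})" using LF[of j] vL[of j] injD[OF injL, of j i] by blast
    qed
    ultimately have "v i \<in> L i \<inter> span (\<Union>(F - {L i}))" using vL span_mono by blast
    then show False using F(5)[OF LF[of i]] vnz by blast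
  qed
  have bas: "basis7 v" using injv ind by (simp add: basis7_def)
  have mon: "\<exists>x. is_perm (fst x) \<and> g = Mat v x" if g: "g \<in> G" for g
  proof -
    have "\<exists>j b. g *v v i = sg b *\<^sub>R v j" for i
    proof -
      have "act g (L i) \<in> F" by (rule act_in[OF g LF])
      then obtain j where j: "act g (L i) = L j" using rL by (metis imageE)
      have "g *v v i \<in> L j" using j vL[of i] by (auto simp: act_def)
      then obtain k where k: "g *v v i = k *\<^sub>R v j" unfolding Lv[of j] by (auto simp: span_singleton)
      have "\<bar>k\<bar> * norm v0 = norm v0" using nrm[OF g, of "v i"] unfolding k norm_scaleR vn .
      then have "k = 1 \<or> k = -1" using v0(2) by auto
      then have "k = sg (k = -1)" by auto
      then show ?thesis using k by metis
    qed
    then obtain f b where fb: "\<And>i. g *v v i = sg (b i) *\<^sub>R v (f i)" by metis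
    have "inj f"
    proof (rule injI)
      fix i j assume e: "f i = f j"
      have "g *v (sg (b i) *\<^sub>R v i) = (sg (b i) * sg (b i)) *\<^sub>R v (f i)" by (simp only: matrix_vector_mult_scaleR fb scaleR_scaleR)
      also have "\<dots> = (sg (b j) * sg (b j)) *\<^sub>R v (f j)" by (simp only: e sg_sq)
      also have "\<dots> = g *v (sg (b j) *\<^sub>R v j)" by (simp only: matrix_vector_mult_scaleR fb scaleR_scaleR)
      finally have "sg (b i) *\<^sub>R v i = sg (b j) *\<^sub>R v j" using orth_inj[OF orth[OF g]] by (simp add: inj_eq)
      then show "i = j" using basis7_indep(1)[OF bas] sg_nz by blast
    qed
    then have "is_perm (fst (table f, stable b))" by (simp add: is_perm_table)
    moreover have "g = Mat v (table f, stable b)" by (rule basis7_eqI[OF bas]) (simp add: Mat[OF bas] fb)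
    ultimately show ?thesis by blast
  qed
  define S where "S = {x. is_perm (fst x) \<and> Mat v x \<in> G}"
  have "spgrp S" unfolding spgrp_def S_def using subgroup_orth[OF G(1)]
    by (auto simp: Mat_smul[OF bas] Mat_sid[OF bas] is_perm_pm simp del: smul.simps)
  moreover have "cyc7 P1 \<in> S"
  proof -
    have sv: "C *v v i = v (ap (rot P1) i)" for i
    proof -
      have s: "C *v (mpow C n *v v0) = mpow C (Suc n) *v v0" for n by (simp add: matrix_vector_mul_assoc)
      have s7: "mpow C (Suc 6) = mpow C 0" using C(2) by (simp add: numeral_eq_Suc)
      have "mpow C (Suc (pn i)) = mpow C (pn (ap (rot P1) i))"
      proof (cases "i = P6")
        case True
        then show ?thesis using s7 by (simp only: rot.simps ap.simps pn.simps)
      next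
        case False
        then have "pn (ap (rot P1) i) = Suc (pn i)" by (cases i) (simp_all add: rot.simps)
        then show ?thesis by simp
      qed
      then show ?thesis unfolding v_def s by simp
    qed
    have "Mat v (cyc7 P1) = C" by (rule basis7_eqI[OF bas]) (simp add: Mat[OF bas] cyc7_def sv)
    then show ?thesis using C(1) by (simp add: S_def cyc7_def)
  qed
  moreover have "G = Mat v ` S" 
  proof
    show "G \<subseteq> Mat v ` S" using mon unfolding S_def by blast
    show "Mat v ` S \<subseteq> G" unfolding S_def by blast
  qed
  ultimately show ?thesis using bas unfolding monomial_rep_def by blast
qed

end

theorem monomial_exists: assumes "finite_irreducible_imprimitive (G :: (real^7^7) set)"
  obtains v S where "monomial_rep G v S"
proof -
  have g: "subgroup G orthogonal_group" "finite G" "irreducible_group G" "imprimitive G"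
    using assms by (auto simp: finite_irreducible_imprimitive_def)
  obtain F where F: "finite F" "card F > 1" "\<forall>V\<in>F. subspace V \<and> V \<noteq> {0} \<and> V \<inter> span (\<Union>(F - {V})) = {0}"
    "span (\<Union>F) = UNIV" "\<forall>g\<in>G. (\<lambda>V. (*v) g ` V) ` F = F"
    using g(4) unfolding imprimitive_def by blast
  have F3: "V \<in> F \<Longrightarrow> subspace V" "V \<in> F \<Longrightarrow> V \<noteq> {0}" "V \<in> F \<Longrightarrow> V \<inter> span (\<Union>(F - {V})) = {0}" for V
    using F(3) by blast+
  interpret permuted_family7 G F
  proof (rule permuted_family7.intro, rule permuted_family.intro)
    show "\<And>g. g \<in> G \<Longrightarrow> act g ` F = F" using F(5) unfolding act_def[abs_def] by blast
  qed (rule g F(1,2,4) F3; assumption?)+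
  show ?thesis using monomial that by blast
qed


lemma (in group_hom) FactGroup_image_iso: "G Mod (kernel G H h) \<cong> H\<lparr>carrier := h ` carrier G\<rparr>"
proof -
  interpret I: group_hom G "H\<lparr>carrier := h ` carrier G\<rparr>" h
  proof (intro group_hom.intro group_hom_axioms.intro)
    show "group (H\<lparr>carrier := h ` carrier G\<rparr>)" by (rule H.subgroup_imp_group[OF img_is_subgroup])
    show "h \<in> hom G (H\<lparr>carrier := h ` carrier G\<rparr>)" by (rule homI) auto
  qed (rule G.group_axioms)
  have "kernel G (H\<lparr>carrier := h ` carrier G\<rparr>) h = kernel G H h" by (simp add: kernel_def)
  then show ?thesis using I.FactGroup_iso by simp
qed

section \<open>Projective special linear groups as collineation groups\<close>

definition permG :: "perm monoid" where
  "permG = \<lparr>carrier = {p. is_perm p}, mult = (\<star>), one = pid\<rparr>"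

lemma permG_simps [simp]: "carrier permG = {p. is_perm p}" "mult permG = (\<star>)" "one permG = pid"
  by (simp_all add: permG_def)

lemma group_permG: "group permG"
proof (rule groupI)
  fix x assume "x \<in> carrier permG"
  then show "\<exists>y\<in>carrier permG. y \<otimes>\<^bsub>permG\<^esub> x = \<one>\<^bsub>permG\<^esub>"
    by (intro bexI[of _ "pinv x"]) (simp_all add: pinv)
qed (auto simp: is_perm_pm pm_assoc)

lemma subgroup_permG: "subgroup Q permG \<longleftrightarrow> permgrp Q"
proof
  assume "subgroup Q permG"
  then show "permgrp Q" unfolding permgrp_def using subgroup.subset subgroup.one_closed subgroup.m_closed by fastforce
next
  assume Q: "permgrp Q"
  interpret group permG by (rule group_permG)
  show "subgroup Q permG"
  proof (rule subgroupI)
    fix a assume a: "a \<in> Q"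
    have "inv\<^bsub>permG\<^esub> a = pinv a" using pinv permgrpD(1)[OF Q a] by (intro inv_equality) simp_all
    then show "inv\<^bsub>permG\<^esub> a \<in> Q" using permgrp_pinv[OF Q a] by simp
  qed (use permgrpD[OF Q] in auto)
qed

text \<open>A transitive abelian group is its own centralizer.\<close>

lemma rot_centralizer: assumes "is_perm z" "z \<star> rot P1 = rot P1 \<star> z" shows "z = rot (ap z P0)"
proof -
  let ?k = "ap z P0"
  have r: "z \<star> rot j = rot j \<star> z" for j
    by (rule rot_induct[where P="\<lambda>q. z \<star> q = q \<star> z"]) (simp, metis assms(2) pm_assoc)
  have "ap z j = ap (rot ?k) j" for j
  proof -
    have "ap z j = ap (z \<star> rot j) P0" by simp
    also have "\<dots> = ap (rot j) ?k" by (simp add: r)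
    also have "\<dots> = ap (rot ?k) j" by (cases j; cases ?k) (simp_all add: rot.simps)
    finally show ?thesis .
  qed
  then show ?thesis by (rule perm_eqI)
qed

lemma Fano_center: assumes "is_perm z" "\<And>x. x \<in> Fano \<Longrightarrow> z \<star> x = x \<star> z" shows "z = pid"
proof -
  define k where "k = ap z P0"
  have z: "z = rot k" unfolding k_def by (rule rot_centralizer[OF assms(1) assms(2)[OF rot_Fano]])
  have "rot k \<star> invol = invol \<star> rot k" using assms(2)[OF invol_Fano] z by simp
  moreover have "every (\<lambda>k. if rot k \<star> invol = invol \<star> rot k then k = P0 else True) pts" by code_simp
  ultimately have "k = P0" unfolding every_iff by (metis in_pts)
  then show ?thesis using z by simp
qed

text \<open>Since the collineation group has trivial centre, the centre of the linear group lies in the kernel of any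
homomorphism onto it; so it suffices that the kernel is central.\<close>

lemma psl_iso:
  fixes \<psi> :: "'a::comm_ring_1^'n^'n \<Rightarrow> perm"
  assumes grp: "group (special_linear_group :: ('a^'n^'n) monoid)"
    and hom: "\<psi> \<in> hom special_linear_group permG"
    and im: "\<psi> ` carrier special_linear_group = Fano"
    and ker: "\<And>M. M \<in> carrier special_linear_group \<Longrightarrow> \<psi> M = pid \<Longrightarrow>
      M \<in> centralizer special_linear_group (carrier special_linear_group)"
  shows "(projective_special_linear_group :: ('a^'n^'n) set monoid) \<cong> permG\<lparr>carrier := Fano\<rparr>"
    "group (projective_special_linear_group :: ('a^'n^'n) set monoid)"
proof -
  interpret group_hom "special_linear_group :: ('a^'n^'n) monoid" permG \<psi>
    by (intro group_hom.intro group_hom_axioms.intro grp group_permG hom)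
  let ?S = "special_linear_group :: ('a^'n^'n) monoid"
  have "centralizer ?S (carrier ?S) = kernel ?S permG \<psi>"
  proof
    show "kernel ?S permG \<psi> \<subseteq> centralizer ?S (carrier ?S)" using ker by (auto simp: kernel_def)
    show "centralizer ?S (carrier ?S) \<subseteq> kernel ?S permG \<psi>"
    proof
      fix z assume "z \<in> centralizer ?S (carrier ?S)"
      then have z: "z \<in> carrier ?S" "\<And>x. x \<in> carrier ?S \<Longrightarrow> z \<otimes>\<^bsub>?S\<^esub> x = x \<otimes>\<^bsub>?S\<^esub> z"
        by (auto simp: centralizer_def)
      have "\<psi> z = pid"
      proof (rule Fano_center)
        show "is_perm (\<psi> z)" using hom_closed[OF z(1)] by simp
        fix y assume "y \<in> Fano"
        then obtain x where x: "x \<in> carrier ?S" "y = \<psi> x" using im by blast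
        have "\<psi> (z \<otimes>\<^bsub>?S\<^esub> x) = \<psi> (x \<otimes>\<^bsub>?S\<^esub> z)" using z(2)[OF x(1)] by simp
        then show "\<psi> z \<star> y = y \<star> \<psi> z" using z(1) x by simp
      qed
      then show "z \<in> kernel ?S permG \<psi>" using z(1) by (simp add: kernel_def)
    qed
  qed
  then have e: "projective_special_linear_group = ?S Mod kernel ?S permG \<psi>"
    by (simp add: projective_special_linear_group_def)
  show "(projective_special_linear_group :: ('a^'n^'n) set monoid) \<cong> permG\<lparr>carrier := Fano\<rparr>"
    unfolding e using FactGroup_image_iso unfolding im .
  show "group (projective_special_linear_group :: ('a^'n^'n) set monoid)"
    unfolding e by (rule normal.factorgroup_is_group[OF normal_kernel])
qed

lemma SL_simps [simp]: "mult special_linear_group = (**)" "one special_linear_group = mat 1"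
  "carrier special_linear_group = {M. det M = 1}"
  by (simp_all add: special_linear_group_def)

lemma SL_group: assumes "\<And>A :: 'a::comm_ring_1^'n^'n. det A = 1 \<Longrightarrow> \<exists>B. B ** A = mat 1"
  shows "group (special_linear_group :: ('a^'n^'n) monoid)"
proof (rule groupI)
  fix A :: "'a^'n^'n" assume "A \<in> carrier special_linear_group"
  then have A: "det A = 1" by simp
  then obtain B where B: "B ** A = mat 1" using assms by blast
  then have "det B * det A = 1" by (metis det_I det_mul)
  then show "\<exists>y\<in>carrier special_linear_group. y \<otimes>\<^bsub>special_linear_group\<^esub> A = \<one>\<^bsub>special_linear_group\<^esub>"
    using A B by auto
qed (auto simp: det_mul matrix_mul_assoc)

lemma UNIV_2: "x = 0 \<or> x = 1" for x :: 2
proof -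
  have "card {0, 1 :: 2} = CARD(2)" by simp
  then have "{0, 1 :: 2} = UNIV" by (intro card_subset_eq) auto
  then show ?thesis by auto
qed

lemma UNIV_7: "x \<in> {0, 1, 2, 3, 4, 5, 6}" for x :: 7
proof -
  have "card {0, 1, 2, 3, 4, 5, 6 :: 7} = CARD(7)" by simp
  then have "{0, 1, 2, 3, 4, 5, 6 :: 7} = UNIV" by (intro card_subset_eq) auto
  then show ?thesis by auto
qed

definition v3 :: "'a \<Rightarrow> 'a \<Rightarrow> 'a \<Rightarrow> 'a::comm_ring_1^3" where "v3 a b c = vector [a, b, c]"

lemma v3_nth [simp]: "v3 a b c $ 1 = a" "v3 a b c $ 2 = b" "v3 a b c $ 3 = c"
  by (simp_all add: v3_def vector_3)

lemma v3_eq: "x = v3 (x $ 1) (x $ 2) (x $ 3)" by (simp add: vec_eq_iff forall_3)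

definition adj3 :: "'a::comm_ring_1^3^3 \<Rightarrow> 'a^3^3" where
  "adj3 A = vector [
     v3 (A$2$2*A$3$3 - A$2$3*A$3$2) (A$1$3*A$3$2 - A$1$2*A$3$3) (A$1$2*A$2$3 - A$1$3*A$2$2),
     v3 (A$2$3*A$3$1 - A$2$1*A$3$3) (A$1$1*A$3$3 - A$1$3*A$3$1) (A$1$3*A$2$1 - A$1$1*A$2$3),
     v3 (A$2$1*A$3$2 - A$2$2*A$3$1) (A$1$2*A$3$1 - A$1$1*A$3$2) (A$1$1*A$2$2 - A$1$2*A$2$1)]"

lemma adj3: "det A = 1 \<Longrightarrow> adj3 A ** A = mat 1" for A :: "'a::comm_ring_1^3^3"
  by (simp add: vec_eq_iff forall_3 matrix_matrix_mult_def sum_3 adj3_def vector_3 mat_def det_3 algebra_simps)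

section \<open>The group PSL(3,2) and the nonzero vectors\<close>

text \<open>The coordinates of a point are the values there of three independent code words; collinear points add up to zero.\<close>

fun pvec :: "pt \<Rightarrow> 2^3" where
  "pvec P0 = v3 0 0 1" | "pvec P1 = v3 0 1 0" | "pvec P2 = v3 1 0 0" | "pvec P3 = v3 0 1 1"
| "pvec P4 = v3 1 1 0" | "pvec P5 = v3 1 1 1" | "pvec P6 = v3 1 0 1"

lemma v3_inject: "v3 a b c = v3 a' b' c' \<longleftrightarrow> a = a' \<and> b = b' \<and> c = c'"
  by (simp add: vec_eq_iff forall_3)

lemma v3_add: "v3 a b c + v3 a' b' c' = v3 (a + a') (b + b') (c + c')"
  by (simp add: vec_eq_iff forall_3)

lemma inj_pvec: "pvec i = pvec j \<longleftrightarrow> i = j"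
  by (cases i; cases j) (simp_all add: v3_inject)

lemma v3_zero: "v3 0 0 0 = 0" by (simp add: vec_eq_iff forall_3)

lemma pvec_nz: "pvec i \<noteq> 0"
  unfolding v3_zero[symmetric] by (cases i) (simp_all add: v3_inject)

lemma pvec_surj: assumes "x \<noteq> 0" shows "\<exists>i. x = pvec i"
proof -
  obtain a b c where x: "x = v3 a b c" using v3_eq by blast
  have "a = 0 \<or> a = 1" "b = 0 \<or> b = 1" "c = 0 \<or> c = 1" by (rule UNIV_2)+
  then show ?thesis using assms unfolding x v3_zero[symmetric]
    by (metis pvec.simps)
qed

lemma pvec_third: assumes "i \<noteq> j" shows "pvec (third i j) = pvec i + pvec j"
  using assms by (cases i; cases j) (simp_all add: third_def v3_add v3_inject)

definition acts3 :: "2^3^3 \<Rightarrow> perm \<Rightarrow> bool" where "acts3 M p \<longleftrightarrow> (\<forall>i. M *v pvec i = pvec (ap p i))"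

lemma acts3_unique: "acts3 M p \<Longrightarrow> acts3 M q \<Longrightarrow> p = q"
  by (rule perm_eqI) (metis acts3_def inj_pvec)

lemma acts3_mult: "acts3 M p \<Longrightarrow> acts3 N q \<Longrightarrow> acts3 (M ** N) (p \<star> q)"
  by (simp add: acts3_def matrix_vector_mul_assoc[symmetric])

lemma acts3_id: assumes "acts3 M pid" shows "M = mat 1"
proof -
  have m: "M *v pvec i = pvec i" for i using assms by (simp add: acts3_def)
  have "M *v x = mat 1 *v x" for x
  proof (cases "x = 0")
    case False
    then show ?thesis using pvec_surj m by fastforce
  qed simp
  then show ?thesis by (simp add: matrix_eq)
qed

lemma acts3_Fano: assumes M: "acts3 M p" and is_perm: "is_perm p" shows "p \<in> Fano"
proof -
  have "ap p (third i j) = third (ap p i) (ap p j)" for i j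
  proof (cases "i = j")
    case False
    have ne: "ap p i \<noteq> ap p j" using is_perm False by (simp add: is_perm_iff inj_eq)
    have "pvec (ap p (third i j)) = M *v pvec (third i j)" using M by (simp add: acts3_def)
    also have "\<dots> = M *v (pvec i + pvec j)" by (simp only: pvec_third[OF False])
    also have "\<dots> = pvec (ap p i) + pvec (ap p j)" using M by (simp add: acts3_def matrix_vector_right_distrib)
    also have "\<dots> = pvec (third (ap p i) (ap p j))" using pvec_third[OF ne] by simp
    finally show ?thesis by (simp add: inj_pvec)
  qed simp
  then show ?thesis using is_perm by (simp add: Fano_def fano_iff)
qed

lemma acts3_det: assumes "det M = 1" shows "\<exists>p. is_perm p \<and> acts3 M p"
proof -
  have inj: "M *v x = M *v y \<Longrightarrow> x = y" for x y
    using adj3[OF assms] by (metis matrix_vector_mul_assoc matrix_vector_mul_lid)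
  have "\<exists>j. M *v pvec i = pvec j" for i
    using pvec_surj[of "M *v pvec i"] inj[of "pvec i" 0] pvec_nz by auto
  then obtain f where f: "\<And>i. M *v pvec i = pvec (f i)" by metis
  have "inj f" by (rule injI) (metis f inj inj_pvec)
  then show ?thesis using f by (intro exI[of _ "table f"]) (simp add: is_perm_table acts3_def)
qed

text \<open>The points \<open>P2\<close>, \<open>P1\<close>, \<open>P0\<close> are the standard basis, and the others are reached from them by \<open>third\<close>.\<close>

lemma acts3_ex: assumes p: "p \<in> Fano" shows "\<exists>M. acts3 M p"
proof -
  define M :: "2^3^3" where "M = transpose (vector [pvec (ap p P2), pvec (ap p P1), pvec (ap p P0)])"
  have is_perm: "is_perm p" using p by (simp add: Fano_def)
  have th: "pvec (ap p (third i j)) = pvec (ap p i) + pvec (ap p j)" if "i \<noteq> j" for i j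
  proof -
    have "ap p i \<noteq> ap p j" using is_perm that by (simp add: is_perm_iff inj_eq)
    then show ?thesis using p pvec_third by (simp add: Fano_def fano_iff)
  qed
  have b: "M *v pvec P0 = pvec (ap p P0)" "M *v pvec P1 = pvec (ap p P1)" "M *v pvec P2 = pvec (ap p P2)"
    by (simp_all add: M_def vec_eq_iff forall_3 matrix_vector_mult_def sum_3 transpose_def vector_3)
  have st: "M *v pvec (third i j) = pvec (ap p (third i j))"
    if "M *v pvec i = pvec (ap p i)" "M *v pvec j = pvec (ap p j)" "i \<noteq> j" for i j
    using that by (simp add: th pvec_third matrix_vector_right_distrib)
  have "third P0 P1 = P3" "third P1 P2 = P4" "third P0 P2 = P6" "third P0 P4 = P5"
    by (simp_all add: third_def)
  then have b2: "M *v pvec P3 = pvec (ap p P3)" "M *v pvec P4 = pvec (ap p P4)" "M *v pvec P6 = pvec (ap p P6)"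
    using st[OF b(1,2)] st[OF b(2,3)] st[OF b(1,3)] by auto
  then have "M *v pvec P5 = pvec (ap p P5)" using st[OF b(1) b2(2)] \<open>third P0 P4 = P5\<close> by auto
  then have "M *v pvec i = pvec (ap p i)" for i using b b2 by (cases i) auto
  then show ?thesis unfolding acts3_def by blast
qed

theorem PSL_3_2_Fano: "PSL_3_2 \<cong> permG\<lparr>carrier := Fano\<rparr>" "group PSL_3_2"
proof -
  define \<psi> where "\<psi> M = (THE p. acts3 M p)" for M
  have psi: "acts3 M p \<Longrightarrow> \<psi> M = p" for M p unfolding \<psi>_def using acts3_unique by blast
  have psi': "acts3 M (\<psi> M)" "is_perm (\<psi> M)" if "det M = 1" for M
    using acts3_det[OF that] psi by metis+
  have grp: "group (special_linear_group :: (2^3^3) monoid)" using adj3 by (intro SL_group) blast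
  have hom: "\<psi> \<in> hom special_linear_group permG"
    proof (rule homI)
      fix x y :: "2^3^3" assume "x \<in> carrier special_linear_group" "y \<in> carrier special_linear_group"
      then show "\<psi> (x \<otimes>\<^bsub>special_linear_group\<^esub> y) = \<psi> x \<otimes>\<^bsub>permG\<^esub> \<psi> y"
        using psi[OF acts3_mult[OF psi'(1) psi'(1)]] by simp
    qed (simp add: psi')
  have im: "\<psi> ` carrier special_linear_group = Fano"
    proof
      show "\<psi> ` carrier special_linear_group \<subseteq> Fano" using acts3_Fano psi' by auto
      show "Fano \<subseteq> \<psi> ` carrier special_linear_group"
      proof
        fix p assume p: "p \<in> Fano"
        obtain M where M: "acts3 M p" using acts3_ex[OF p] by blast
        have okp: "is_perm p" using p by (simp add: Fano_def)
        obtain N where N: "acts3 N (pinv p)" using acts3_ex[OF permgrp_pinv[OF permgrp_Fano p]] by blast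
        have "M ** N = mat 1" using acts3_mult[OF M N] pinv(3)[OF okp] by (intro acts3_id) simp
        then have "det M * det N = 1" by (metis det_I det_mul)
        then have "det M = 1" using UNIV_2[of "det M"] by auto
        then show "p \<in> \<psi> ` carrier special_linear_group" using psi[OF M] by force
      qed
    qed
  have ker: "M \<in> centralizer special_linear_group (carrier special_linear_group)"
    if "M \<in> carrier special_linear_group" "\<psi> M = pid" for M :: "2^3^3"
  proof -
    have "M = mat 1" using acts3_id psi'(1) that by force
    then show ?thesis by (simp add: centralizer_def)
  qed
  show "PSL_3_2 \<cong> permG\<lparr>carrier := Fano\<rparr>" "group PSL_3_2" using psl_iso[OF grp hom im ker] by blast+
qed

section \<open>The group PSL(2,7) and seven quaternion groups\<close>

definition m2 :: "'a \<Rightarrow> 'a \<Rightarrow> 'a \<Rightarrow> 'a \<Rightarrow> 'a::comm_ring_1^2^2" where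
  "m2 a b c d = (\<chi> i j. if i = 1 then if j = 1 then a else b else if j = 1 then c else d)"

lemma m2_mult: "m2 a b c d ** m2 a' b' c' d' = m2 (a*a' + b*c') (a*b' + b*d') (c*a' + d*c') (c*b' + d*d')"
  by (simp add: vec_eq_iff forall_2 matrix_matrix_mult_def sum_2 m2_def)

lemma m2_inject: "m2 a b c d = m2 a' b' c' d' \<longleftrightarrow> a = a' \<and> b = b' \<and> c = c' \<and> d = d'"
  by (auto simp: vec_eq_iff forall_2 m2_def)

lemma m2_ex: "\<exists>a b c d. M = m2 a b c d" for M :: "'a::comm_ring_1^2^2"
  by (rule exI[of _ "M$1$1"], rule exI[of _ "M$1$2"], rule exI[of _ "M$2$1"], rule exI[of _ "M$2$2"])
    (simp add: vec_eq_iff forall_2 m2_def)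

lemma det_m2: "det (m2 a b c d) = a * d - b * c" by (simp add: det_2 m2_def)

lemma m2_1: "mat 1 = m2 1 0 0 1" by (simp add: vec_eq_iff forall_2 m2_def mat_def)
lemma m2_neg: "- m2 a b c d = m2 (-a) (-b) (-c) (-d)" by (simp add: vec_eq_iff forall_2 m2_def)

lemma adj2: "det M = 1 \<Longrightarrow> \<exists>B. B ** M = mat 1" for M :: "'a::comm_ring_1^2^2"
proof -
  assume "det M = 1"
  moreover obtain a b c d where M: "M = m2 a b c d" using m2_ex by blast
  ultimately have "m2 d (-b) (-c) a ** M = mat 1"
    by (simp add: m2_mult m2_1 m2_inject det_m2 algebra_simps)
  then show ?thesis by blast
qed

text \<open>\<open>SL(2,7)\<close> has quaternion subgroups of order 8. Half of the six elements of order 4 of one of them are listed for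
\<open>P0\<close>; the other frames are its conjugates by powers of the transvection \<open>transv 1\<close>, which thus acts as the
rotation.\<close>

fun frame_half :: "pt \<Rightarrow> (7^2^2) list" where
  "frame_half P0 = [m2 0 1 6 0, m2 2 3 3 5, m2 3 5 5 4]"
| "frame_half P1 = [m2 1 1 5 6, m2 1 5 1 6, m2 2 4 4 5]"
| "frame_half P2 = [m2 1 4 3 6, m2 1 6 2 6, m2 2 2 1 5]"
| "frame_half P3 = [m2 3 1 4 4, m2 3 2 2 4, m2 3 4 1 4]"
| "frame_half P4 = [m2 0 2 3 0, m2 2 6 5 5, m2 3 3 6 4]"
| "frame_half P5 = [m2 0 3 2 0, m2 2 5 6 5, m2 3 6 3 4]"
| "frame_half P6 = [m2 1 2 6 6, m2 1 3 4 6, m2 2 1 2 5]"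

definition frame :: "pt \<Rightarrow> (7^2^2) set" where
  "frame i = set (frame_half i) \<union> uminus ` set (frame_half i)"

lemma frames_disjoint: assumes "X \<in> frame i" "X \<in> frame j" shows "i = j"
proof -
  have "\<forall>X\<in>frame i. X \<in> frame j \<longrightarrow> i = j"
    by (cases i; cases j) (simp_all add: frame_def m2_neg m2_inject)
  then show ?thesis using assms by blast
qed

text \<open>Conjugation by \<open>M\<close> permutes the frames as \<open>p\<close> does; writing it with products avoids inverse matrices.\<close>

definition acts2 :: "7^2^2 \<Rightarrow> perm \<Rightarrow> bool" where
  "acts2 M p \<longleftrightarrow> det M = 1 \<and> (\<forall>i. \<forall>X\<in>frame i. \<exists>Y\<in>frame (ap p i). M ** X = Y ** M)"

lemma mat_neg_mult: "(- A) ** B = - (A ** B)" "A ** (- B) = - (A ** B)" for A B :: "'a::comm_ring_1^'n^'n"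
  by (simp_all add: vec_eq_iff matrix_matrix_mult_def sum_negf)

lemma acts2I: assumes "det M = 1" "\<And>i X. X \<in> set (frame_half i) \<Longrightarrow> \<exists>Y\<in>set (frame_half (ap p i)). M ** X = Y ** M \<or> M ** X = - (Y ** M)"
  shows "acts2 M p"
  unfolding acts2_def
proof (intro conjI allI ballI)
  fix i X assume "X \<in> frame i"
  then obtain Z where Z: "Z \<in> set (frame_half i)" "X = Z \<or> X = - Z" by (auto simp: frame_def)
  obtain Y where Y: "Y \<in> set (frame_half (ap p i))" "M ** Z = Y ** M \<or> M ** Z = - (Y ** M)"
    using assms(2)[OF Z(1)] by blast
  have "Y \<in> frame (ap p i)" "- Y \<in> frame (ap p i)" using Y(1) by (auto simp: frame_def)
  moreover have "M ** X = Y ** M \<or> M ** X = (- Y) ** M" using Y(2) Z(2) by (auto simp: mat_neg_mult)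
  ultimately show "\<exists>Y\<in>frame (ap p i). M ** X = Y ** M" by blast
qed (rule assms(1))

lemma acts2_mult: assumes "acts2 M p" "acts2 N q" shows "acts2 (M ** N) (p \<star> q)"
  unfolding acts2_def
proof (intro conjI allI ballI)
  show "det (M ** N) = 1" using assms by (simp add: acts2_def det_mul)
  fix i X assume "X \<in> frame i"
  then obtain Y where Y: "Y \<in> frame (ap q i)" "N ** X = Y ** N" using assms(2) by (auto simp: acts2_def)
  then obtain Z where Z: "Z \<in> frame (ap p (ap q i))" "M ** Y = Z ** M" using assms(1) by (auto simp: acts2_def)
  have "M ** N ** X = Z ** (M ** N)" by (metis Y(2) Z(2) matrix_mul_assoc)
  then show "\<exists>Y\<in>frame (ap (p \<star> q) i). M ** N ** X = Y ** (M ** N)" using Z(1) by auto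
qed

lemma acts2_neg: "acts2 M p \<Longrightarrow> acts2 (- M) p"
proof -
  obtain a b c d where M: "M = m2 a b c d" using m2_ex by blast
  show "acts2 M p \<Longrightarrow> acts2 (- M) p"
    unfolding acts2_def by (simp add: mat_neg_mult) (simp add: M m2_neg det_m2)
qed

lemma frame_nonempty: "\<exists>X. X \<in> frame i" by (cases i) (auto simp: frame_def)

lemma acts2_unique: assumes "acts2 M p" "acts2 M q" shows "p = q"
proof (rule perm_eqI)
  fix i
  obtain X where X: "X \<in> frame i" using frame_nonempty by blast
  obtain Y Z where YZ: "Y \<in> frame (ap p i)" "Z \<in> frame (ap q i)" "M ** X = Y ** M" "M ** X = Z ** M"
    using assms X unfolding acts2_def by metis
  interpret group "special_linear_group :: (7^2^2) monoid" using adj2 by (rule SL_group)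
  have "det M = 1" using assms(1) by (simp add: acts2_def)
  then obtain N where N: "M ** N = mat 1" using r_inv_ex[of M] by auto
  have "Y = Y ** M ** N" "Z = Z ** M ** N" by (metis N matrix_mul_assoc matrix_mul_rid)+
  then have "Y = Z" using YZ by metis
  then show "ap p i = ap q i" using YZ frames_disjoint by blast
qed

lemma acts2_1: "acts2 (mat 1) pid" by (simp add: acts2_def)

definition transv :: "7 \<Rightarrow> 7^2^2" where "transv x = m2 1 x 0 1"

lemma acts2_T: "acts2 (transv 1) (rot P1)"
proof (rule acts2I)
  fix i X show "X \<in> set (frame_half i) \<Longrightarrow> \<exists>Y\<in>set (frame_half (ap (rot P1) i)). transv 1 ** X = Y ** transv 1 \<or> transv 1 ** X = - (Y ** transv 1)"
    by (cases i) (auto simp: rot.simps transv_def m2_mult m2_neg m2_inject)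
qed (simp add: transv_def det_m2)

text \<open>The fifth power is the inverse in the field with seven elements, so these are the matrices of determinant 1 with zero diagonal.\<close>

definition weyl :: "7 \<Rightarrow> 7^2^2" where "weyl c = m2 0 (- (c ^ 5)) c 0"

definition weyl_perm :: "nat \<Rightarrow> perm" where
  "weyl_perm n = (if n = 1 then Perm P0 P1 P6 P3 P5 P4 P2 else if n = 2 then Perm P4 P6 P2 P3 P0 P5 P1 else Perm P5 P2 P1 P3 P4 P0 P6)"

lemma acts2_weyl_small: "acts2 (weyl 1) (weyl_perm 1)" "acts2 (weyl 2) (weyl_perm 2)" "acts2 (weyl 3) (weyl_perm 3)"
proof -
  show "acts2 (weyl 1) (weyl_perm 1)"
  proof (rule acts2I)
    fix i X show "X \<in> set (frame_half i) \<Longrightarrow> \<exists>Y\<in>set (frame_half (ap (weyl_perm 1) i)). weyl 1 ** X = Y ** weyl 1 \<or> weyl 1 ** X = - (Y ** weyl 1)"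
      by (cases i) (auto simp: weyl_perm_def weyl_def m2_mult m2_neg m2_inject)
  qed (simp add: weyl_def det_m2)
  show "acts2 (weyl 2) (weyl_perm 2)"
  proof (rule acts2I)
    fix i X show "X \<in> set (frame_half i) \<Longrightarrow> \<exists>Y\<in>set (frame_half (ap (weyl_perm 2) i)). weyl 2 ** X = Y ** weyl 2 \<or> weyl 2 ** X = - (Y ** weyl 2)"
      by (cases i) (auto simp: weyl_perm_def weyl_def m2_mult m2_neg m2_inject)
  qed (simp add: weyl_def det_m2)
  show "acts2 (weyl 3) (weyl_perm 3)"
  proof (rule acts2I)
    fix i X show "X \<in> set (frame_half i) \<Longrightarrow> \<exists>Y\<in>set (frame_half (ap (weyl_perm 3) i)). weyl 3 ** X = Y ** weyl 3 \<or> weyl 3 ** X = - (Y ** weyl 3)"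
      by (cases i) (auto simp: weyl_perm_def weyl_def m2_mult m2_neg m2_inject)
  qed (simp add: weyl_def det_m2)
qed

lemma transv_add: "transv x ** transv y = transv (x + y)" by (simp add: transv_def m2_mult m2_inject add.commute)

lemma acts2_transv: "\<exists>k. acts2 (transv x) (rot k) \<and> (k = P0 \<longrightarrow> x = 0)"
proof -
  have r: "rot P1 \<star> rot P1 = rot P2" "rot P1 \<star> rot P2 = rot P3" "rot P1 \<star> rot P3 = rot P4"
    "rot P1 \<star> rot P4 = rot P5" "rot P1 \<star> rot P5 = rot P6" by (simp_all add: rot_add) (simp_all add: rot.simps)
  have three0: "acts2 (transv 0) (rot P0)" using acts2_1 by (simp add: transv_def m2_1)
  note t2 = acts2_mult[OF acts2_T acts2_T, unfolded r transv_add]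
  note t3 = acts2_mult[OF acts2_T t2, unfolded r transv_add]
  note t4 = acts2_mult[OF acts2_T t3, unfolded r transv_add]
  note t5 = acts2_mult[OF acts2_T t4, unfolded r transv_add]
  note t6 = acts2_mult[OF acts2_T t5, unfolded r transv_add]
  have "x = 0 \<or> x = 1 \<or> x = 1 + 1 \<or> x = 1 + (1 + 1) \<or> x = 1 + (1 + (1 + 1)) \<or> x = 1 + (1 + (1 + (1 + 1)))
      \<or> x = 1 + (1 + (1 + (1 + (1 + 1))))"
    using UNIV_7[of x] by simp
  then show ?thesis using three0 acts2_T t2 t3 t4 t5 t6 by (metis pt.distinct(1,3,5,7,9,11))
qed

lemma power_6: "c \<noteq> 0 \<Longrightarrow> c ^ 6 = 1" for c :: 7
  using UNIV_7[of c] by (auto simp: power_numeral_reduce)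

lemma weyl_neg: "weyl (- c) = - weyl c" by (simp add: weyl_def m2_neg)

lemma acts2_weyl: assumes "c \<noteq> 0" shows "\<exists>n\<in>{1,2,3}. acts2 (weyl c) (weyl_perm n)"
proof -
  have "c = 1 \<or> c = 2 \<or> c = 3 \<or> c = - 1 \<or> c = - 2 \<or> c = - 3"
    using UNIV_7[of c] assms by auto
  then show ?thesis using acts2_weyl_small acts2_neg weyl_neg by (metis insertCI)
qed

lemma weyl_perm_facts: "n \<in> {1,2,3} \<Longrightarrow> weyl_perm n \<in> Fano" "n \<in> {1,2,3} \<Longrightarrow> weyl_perm n \<noteq> rot k" "weyl_perm 1 \<notin> Affine"
proof -
  have "is_perm (weyl_perm 1) \<and> fano (weyl_perm 1)" "is_perm (weyl_perm 2) \<and> fano (weyl_perm 2)" "is_perm (weyl_perm 3) \<and> fano (weyl_perm 3)"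
    unfolding weyl_perm_def by code_simp+
  then show "n \<in> {1,2,3} \<Longrightarrow> weyl_perm n \<in> Fano" by (auto simp: Fano_def)
  show "n \<in> {1,2,3} \<Longrightarrow> weyl_perm n \<noteq> rot k" by (cases k) (auto simp: weyl_perm_def rot.simps pid_def)
  show "weyl_perm 1 \<notin> Affine" using Affine_fix0[of "weyl_perm 1"] by (auto simp: weyl_perm_def mults_def scale.simps)
qed

text \<open>Matrices with nonzero lower left entry, in Bruhat normal form.\<close>

lemma bruhat: assumes "det M = 1" "M = m2 a b c d" "c \<noteq> 0"
  shows "M = transv (a * c ^ 5) ** weyl c ** transv (d * c ^ 5)"
proof -
  have c: "c ^ 5 * c = 1" using power_6[OF assms(3)] by (simp add: power_numeral_reduce mult.commute mult.left_commute)
  have ad: "a * d = 1 + b * c" using assms(1,2) by (simp add: det_m2 algebra_simps)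
  have "a * c ^ 5 * c = a" "c * (d * c ^ 5) = d" using c by (simp_all add: mult.assoc mult.left_commute[of c] mult.commute[of c])
  moreover have "a * (d * c ^ 5) - c ^ 5 = b"
  proof -
    have "a * (d * c ^ 5) - c ^ 5 = (a * d - 1) * c ^ 5" by (simp add: algebra_simps)
    also have "\<dots> = b * (c ^ 5 * c)" by (simp add: ad)
    finally show ?thesis by (simp add: c)
  qed
  ultimately show ?thesis by (simp add: assms(2) transv_def weyl_def m2_mult m2_inject)
qed

text \<open>A matrix with zero lower left entry is moved into the big cell by multiplying with \<open>weyl 1\<close>.\<close>

lemma acts2_cases: assumes M: "det M = 1"
  shows "(\<exists>k l n. n \<in> {1,2,3} \<and> acts2 M (rot k \<star> weyl_perm n \<star> rot l)) \<or>
    (\<exists>k l m n. m \<in> {1,2,3} \<and> n \<in> {1,2,3} \<and> acts2 M (rot k \<star> weyl_perm m \<star> rot l \<star> weyl_perm n))"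
proof -
  have c: "\<exists>k l n. n \<in> {1,2,3} \<and> acts2 N (rot k \<star> weyl_perm n \<star> rot l)" if N: "det N = 1" "N = m2 a b c d" "c \<noteq> 0" for N a b c d
  proof -
    obtain k l n where "acts2 (transv (a * c ^ 5)) (rot k)" "acts2 (transv (d * c ^ 5)) (rot l)" "n \<in> {1,2,3}" "acts2 (weyl c) (weyl_perm n)"
      using acts2_transv acts2_weyl[OF N(3)] by metis
    then have "acts2 N (rot k \<star> weyl_perm n \<star> rot l)" unfolding bruhat[OF N] by (intro acts2_mult)
    then show ?thesis using \<open>n \<in> {1,2,3}\<close> by blast
  qed
  obtain a b c d where m: "M = m2 a b c d" using m2_ex by blast
  show ?thesis
  proof (cases "c = 0")
    case False
    then show ?thesis using c[OF M m] by blast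
  next
    case True
    then have ad: "a * d = 1" using M by (simp add: m det_m2)
    then have d: "d \<noteq> 0" by auto
    let ?N = "M ** weyl 1"
    have N: "?N = m2 b (- a) d 0" by (simp add: m True weyl_def m2_mult)
    have "det ?N = 1" using acts2_weyl_small(1) M by (simp add: det_mul acts2_def)
    then obtain k l n where n: "n \<in> {1,2,3}" "acts2 ?N (rot k \<star> weyl_perm n \<star> rot l)" using c[OF _ N d] by blast
    have "weyl 1 ** (- weyl 1) = mat 1" by (simp add: weyl_def m2_neg m2_mult m2_1)
    then have "M = ?N ** (- weyl 1)" by (metis matrix_mul_assoc matrix_mul_rid)
    then have "acts2 M (rot k \<star> weyl_perm n \<star> rot l \<star> weyl_perm 1)" using acts2_mult[OF n(2) acts2_neg[OF acts2_weyl_small(1)]] by simp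
    then show ?thesis using n(1) by blast
  qed
qed

text \<open>No matrix of the kernel has a nonzero lower left entry, because \<open>weyl_perm n\<close> is not a rotation. The same holds for
its conjugates in \<open>SL(2,7)\<close>, and this makes the matrix scalar.\<close>

lemma acts2_kernel: assumes "acts2 M pid" shows "M = mat 1 \<or> M = - mat 1"
proof -
  obtain a b c d where m: "M = m2 a b c d" using m2_ex by blast
  have M: "det M = 1" using assms by (simp add: acts2_def)
  have no: "\<not> acts2 N pid" if N: "det N = 1" "N = m2 a b c d" "c \<noteq> 0" for N a b c d
  proof
    assume p: "acts2 N pid"
    obtain k l n where h: "acts2 (transv (a * c ^ 5)) (rot k)" "acts2 (transv (d * c ^ 5)) (rot l)" "n \<in> {1,2,3}" "acts2 (weyl c) (weyl_perm n)"
      using acts2_transv acts2_weyl[OF N(3)] by metis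
    then have "acts2 N (rot k \<star> weyl_perm n \<star> rot l)" unfolding bruhat[OF N] by (intro acts2_mult)
    then have e: "rot k \<star> weyl_perm n \<star> rot l = pid" using p acts2_unique by blast
    have "weyl_perm n = rot (neg k) \<star> (rot k \<star> weyl_perm n \<star> rot l) \<star> rot (neg l)"
      by (metis pid_pm pm_assoc rot_neg)
    then have "weyl_perm n = rot (neg k) \<star> rot (neg l)" using e by simp
    then show False using weyl_perm_facts(2)[OF h(3)] unfolding rot_add by blast
  qed
  have c0: "c = 0" using no[OF M m] assms by blast
  then have ad: "a * d = 1" using M by (simp add: m det_m2)
  have conj: "acts2 (P ** M ** P') pid" if P: "det P = 1" "det P' = 1" "P ** P' = mat 1" for P P'
  proof -
    obtain q q' where q: "acts2 P q" "acts2 P' q'" using acts2_cases[OF P(1)] acts2_cases[OF P(2)] by blast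
    have "q \<star> q' = pid" using acts2_unique[OF acts2_mult[OF q], of pid] acts2_1 P(3) by simp
    then show ?thesis using acts2_mult[OF acts2_mult[OF q(1) assms] q(2)] by simp
  qed
  have det0: "det (P ** M ** P') = 1" if "det P = 1" "det P' = 1" for P P' using M that by (simp add: det_mul)
  have b0: "b = 0"
  proof (rule ccontr)
    assume "b \<noteq> 0"
    \<comment> \<open>this conjugation moves \<open>- b\<close> into the lower left corner\<close>
    let ?P = "m2 0 (-1) 1 0 :: 7^2^2" and ?P' = "m2 0 1 (-1) 0 :: 7^2^2"
    have P: "det ?P = 1" "det ?P' = 1" "?P ** ?P' = mat 1" by (simp_all add: det_m2 m2_mult m2_1)
    have "?P ** M ** ?P' = m2 d 0 (- b) a" by (simp add: m c0 m2_mult)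
    then show False using no[OF det0[OF P(1,2)], of d 0 "- b" a] conj[OF P] \<open>b \<noteq> 0\<close> by simp
  qed
  have ad': "a = d"
  proof (rule ccontr)
    assume "a \<noteq> d"
    \<comment> \<open>this conjugation moves \<open>a - d\<close> into the lower left corner\<close>
    let ?P = "m2 1 0 1 1 :: 7^2^2" and ?P' = "m2 1 0 (-1) 1 :: 7^2^2"
    have P: "det ?P = 1" "det ?P' = 1" "?P ** ?P' = mat 1" by (simp_all add: det_m2 m2_mult m2_1)
    have "?P ** M ** ?P' = m2 a 0 (a - d) d" by (simp add: m c0 b0 m2_mult)
    then show False using no[OF det0[OF P(1,2)], of a 0 "a - d" d] conj[OF P] \<open>a \<noteq> d\<close> by simp
  qed
  have "a = 1 \<or> a = - 1" using ad UNIV_7[of d] unfolding ad' by auto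
  then show ?thesis by (auto simp: m c0 b0 ad' m2_1 m2_neg m2_inject)
qed

theorem PSL_2_7_Fano: "PSL_2_7 \<cong> permG\<lparr>carrier := Fano\<rparr>" "group PSL_2_7"
proof -
  define \<psi> where "\<psi> M = (THE p. acts2 M p)" for M
  have psi: "acts2 M p \<Longrightarrow> \<psi> M = p" for M p unfolding \<psi>_def using acts2_unique by blast
  have psi': "acts2 M (\<psi> M)" "\<psi> M \<in> Fano" if M: "det M = 1" for M
  proof -
    have "\<exists>p\<in>Fano. acts2 M p"
      using acts2_cases[OF M] permgrpD(3)[OF permgrp_Fano] rot_Fano weyl_perm_facts(1) by metis
    then show "acts2 M (\<psi> M)" "\<psi> M \<in> Fano" using psi by metis+
  qed
  let ?S = "special_linear_group :: (7^2^2) monoid"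
  have grp: "group ?S" using adj2 by (rule SL_group)
  have hom: "\<psi> \<in> hom ?S permG"
    proof (rule homI)
      fix x y assume "x \<in> carrier ?S" "y \<in> carrier ?S"
      then show "\<psi> (x \<otimes>\<^bsub>?S\<^esub> y) = \<psi> x \<otimes>\<^bsub>permG\<^esub> \<psi> y"
        using psi[OF acts2_mult[OF psi'(1) psi'(1)]] by simp
    qed (use psi' in \<open>auto simp: Fano_def\<close>)
  have im: "\<psi> ` carrier ?S = Fano"
    proof
      show "\<psi> ` carrier ?S \<subseteq> Fano" using psi' by auto
      interpret group_hom ?S permG \<psi>
        by (intro group_hom.intro group_hom_axioms.intro grp group_permG hom)
      have g: "permgrp (\<psi> ` carrier ?S)" using img_is_subgroup subgroup_permG by blast
      have "rot P1 \<in> \<psi> ` carrier ?S" "weyl_perm 1 \<in> \<psi> ` carrier ?S"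
        using psi[OF acts2_T] psi[OF acts2_weyl_small(1)] acts2_T acts2_weyl_small(1) unfolding acts2_def by force+
      then show "Fano \<subseteq> \<psi> ` carrier ?S" using Fano_sub[OF g, of "weyl_perm 1"] weyl_perm_facts by simp
    qed
  have ker: "M \<in> centralizer ?S (carrier ?S)" if M: "M \<in> carrier ?S" "\<psi> M = pid" for M
  proof -
    have "M = mat 1 \<or> M = - mat 1" using acts2_kernel psi'(1) M by force
    then show ?thesis using M(1) by (auto simp: centralizer_def mat_neg_mult)
  qed
  show "PSL_2_7 \<cong> permG\<lparr>carrier := Fano\<rparr>" "group PSL_2_7" using psl_iso[OF grp hom im ker] by blast+
qed

theorem PSL_3_2_PSL_2_7: "PSL_3_2 \<cong> PSL_2_7"
  using iso_trans[OF PSL_3_2_Fano(1) group.iso_sym[OF PSL_2_7_Fano(2,1)]] .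


section \<open>Permutation groups of degree seven as quotients\<close>

abbreviation perms_on :: "perm set \<Rightarrow> perm monoid" where "perms_on Q \<equiv> permG\<lparr>carrier := Q\<rparr>"

lemma group_perms_on: "permgrp Q \<Longrightarrow> group (perms_on Q)"
  using group.subgroup_imp_group[OF group_permG] subgroup_permG by blast

lemma subgroup_perms_on: assumes Q: "permgrp Q" and L: "permgrp L" "L \<subseteq> Q" shows "subgroup L (perms_on Q)"
  using group.subgroup_incl[OF group_permG] subgroup_permG assms by blast

lemma subgroup_perms_on_permgrp: assumes "permgrp Q" "subgroup L (perms_on Q)" shows "permgrp L" "L \<subseteq> Q"
  using group.incl_subgroup[OF group_permG] subgroup_permG assms subgroup.subset by fastforce+

lemma card_dvd: assumes Q: "permgrp Q" and L: "permgrp L" "L \<subseteq> Q" shows "card L dvd card Q"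
  using group.lagrange[OF group_perms_on[OF Q] subgroup_perms_on[OF assms]] by (metis dvd_triv_right order_def partial_object.select_convs(1) partial_object.update_convs(1) permG_def)

definition num :: "pt \<Rightarrow> nat" where "num i = Suc (pn i)"
definition pt_of :: "nat \<Rightarrow> pt" where "pt_of = inv_into UNIV num"
definition tosym :: "perm \<Rightarrow> nat \<Rightarrow> nat" where
  "tosym p n = (if n \<in> range num then num (ap p (pt_of n)) else n)"

lemma inj_num: "inj num" by (rule injI) (simp add: num_def inj_pn)
lemma pt_of_num [simp]: "pt_of (num i) = i" by (simp add: pt_of_def inj_num)
lemma num_mem: "num i \<in> {1..7}" using pn_less[of i] by (simp add: num_def)
lemma range_num: "range num = {1..7}"
  by (rule card_subset_eq) (use num_mem in \<open>auto simp: card_image[OF inj_num] card_pt\<close>)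
lemma num_pt_of: "n \<in> {1..7} \<Longrightarrow> num (pt_of n) = n"
  using f_inv_into_f[of n num UNIV] by (simp add: pt_of_def range_num)

lemma tosym_num [simp]: "tosym p (num i) = num (ap p i)"
  by (simp add: tosym_def)

lemma tosym_other: "n \<notin> {1..7} \<Longrightarrow> tosym p n = n"
  unfolding tosym_def range_num by (simp only: if_False)

lemma tosym_eqI: "(\<And>i. f (num i) = g (num i)) \<Longrightarrow> (\<And>n. n \<notin> {1..7} \<Longrightarrow> f n = g n) \<Longrightarrow> f = g"
  using range_num by (metis ext imageE)

lemma tosym_pm: "tosym (p \<star> q) = tosym p \<circ> tosym q"
  by (rule tosym_eqI) (simp_all add: tosym_other)

lemma tosym_pid: "tosym pid = id"
  by (rule tosym_eqI) (simp_all add: tosym_other)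

lemma tosym_permutes: assumes "is_perm p" shows "tosym p permutes {1..7}"
proof -
  have "tosym p \<circ> tosym (pinv p) = id" "tosym (pinv p) \<circ> tosym p = id"
    unfolding tosym_pm[symmetric] using pinv[OF assms] tosym_pid by simp_all
  then have "bij (tosym p)" by (rule o_bij[rotated])
  then show ?thesis using tosym_other[of _ p] unfolding permutes_def bij_iff by blast
qed

lemma tosym_inj: "tosym p = tosym q \<Longrightarrow> p = q"
  by (rule perm_eqI) (metis inj_num injD tosym_num)

lemma tosym_surj: assumes f: "f permutes {1..7}" shows "\<exists>p. is_perm p \<and> tosym p = f"
proof -
  define p where "p = table (\<lambda>i. pt_of (f (num i)))"
  have fn: "f (num i) \<in> {1..7}" for i using permutes_in_image[OF f] num_mem by blast
  have "inj (\<lambda>i. pt_of (f (num i)))"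
    by (rule injI) (metis fn num_pt_of inj_num injD permutes_inj[OF f])
  then have "is_perm p" unfolding p_def by (rule is_perm_table)
  moreover have "tosym p = f"
  proof (rule tosym_eqI)
    fix i show "tosym p (num i) = f (num i)" unfolding tosym_num p_def ap_table by (rule num_pt_of[OF fn])
    fix n :: nat assume "n \<notin> {1..7}"
    then show "tosym p n = f n" using tosym_other permutes_not_in[OF f] by metis
  qed
  ultimately show ?thesis by blast
qed

lemma tosym_iso: "tosym \<in> iso permG (sym_group 7)"
proof -
  have "tosym ` {p. is_perm p} = {f. f permutes {1..7}}" using tosym_permutes tosym_surj by blast
  moreover have "inj_on tosym {p. is_perm p}" using tosym_inj by (auto intro: inj_onI)
  ultimately show ?thesis
    unfolding iso_def hom_def bij_betw_def using tosym_permutes tosym_pm by (auto simp: sym_group_def)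
qed

lemma permG_sym: "permG \<cong> sym_group 7" using tosym_iso by (auto simp: is_iso_def)

lemma card_is_perm: "card {p. is_perm p} = 5040"
  using iso_same_card[OF permG_sym] sym_group_card_carrier[of 7] by (simp add: fact_numeral)

lemma group_sym: "group (sym_group 7)" by (rule sym_group_is_group)

lemma group_hom_iso: "group X \<Longrightarrow> group Y \<Longrightarrow> f \<in> iso X Y \<Longrightarrow> group_hom X Y f"
  by (intro group_hom.intro group_hom_axioms.intro) (auto simp: iso_def)

lemma iso_restrict: assumes "f \<in> iso X Y" "Q \<subseteq> carrier X" shows "X\<lparr>carrier := Q\<rparr> \<cong> Y\<lparr>carrier := f ` Q\<rparr>"
proof -
  have "f \<in> iso (X\<lparr>carrier := Q\<rparr>) (Y\<lparr>carrier := f ` Q\<rparr>)"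
    using assms unfolding iso_def hom_def bij_betw_def by (auto intro: inj_on_subset simp: subset_iff)
  then show ?thesis by (auto simp: is_iso_def)
qed

lemma embeds_iso: assumes X: "X \<cong> perms_on Q" "permgrp Q" and B: "permgrp B" "Q \<subseteq> B" and f: "f \<in> iso (perms_on B) Y" "group Y"
  shows "embeds_in X Y"
proof -
  interpret group_hom "perms_on B" Y f by (rule group_hom_iso[OF group_perms_on[OF B(1)] f(2,1)])
  have "subgroup (f ` Q) Y" by (rule subgroup_img_is_subgroup[OF subgroup_perms_on[OF B(1) X(2) B(2)]])
  moreover have "perms_on Q \<cong> Y\<lparr>carrier := f ` Q\<rparr>" using iso_restrict[OF f(1), of Q] B(2) by simp
  ultimately show ?thesis unfolding embeds_in_def using iso_trans[OF X(1)] by blast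
qed

definition Rots :: "perm set" where "Rots = range rot"

lemma inj_rot: "inj rot" by (rule injI) (metis ap_rot_P0)
lemma card_Rots: "card Rots = 7" by (simp add: Rots_def card_image[OF inj_rot] card_pt)
lemma permgrp_Rots: "permgrp Rots"
  unfolding permgrp_def Rots_def using rot_add rot_P0 by auto (metis rangeI rot_P0)

lemma Affine_conj: assumes p: "p \<in> Affine" shows "p \<star> rot j \<star> pinv p \<in> Rots"
proof -
  have is_perm: "is_perm p" using p by (simp add: Affine_def)
  obtain k where k: "p \<star> rot P1 = rot k \<star> p" using p by (auto simp: Affine_def)
  have "p \<star> rot P1 \<star> pinv p = rot k" unfolding k pm_assoc pinv(3)[OF is_perm] by simp
  then have c: "p \<star> rot P1 \<star> pinv p \<in> Rots" by (simp add: Rots_def)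
  show ?thesis
  proof (rule rot_induct[where P="\<lambda>q. p \<star> q \<star> pinv p \<in> Rots"])
    show "p \<star> pid \<star> pinv p \<in> Rots" using pinv(3)[OF is_perm] permgrpD(2)[OF permgrp_Rots] by simp
    fix q assume q: "p \<star> q \<star> pinv p \<in> Rots"
    have "p \<star> (rot P1 \<star> q) \<star> pinv p = (p \<star> rot P1 \<star> pinv p) \<star> (p \<star> q \<star> pinv p)"
      by (metis pm_assoc pid_pm(1) pinv(2)[OF is_perm])
    then show "p \<star> (rot P1 \<star> q) \<star> pinv p \<in> Rots" using permgrpD(3)[OF permgrp_Rots c q] by simp
  qed
qed

lemma normalizerI: assumes "group G" "P \<subseteq> carrier G" "finite P" "k \<in> carrier G"
    "\<And>x. x \<in> P \<Longrightarrow> k \<otimes>\<^bsub>G\<^esub> x \<otimes>\<^bsub>G\<^esub> inv\<^bsub>G\<^esub> k \<in> P"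
  shows "k \<in> normalizer G P"
proof -
  interpret group G by fact
  let ?c = "\<lambda>x. k \<otimes>\<^bsub>G\<^esub> x \<otimes>\<^bsub>G\<^esub> inv\<^bsub>G\<^esub> k"
  have im: "k <#\<^bsub>G\<^esub> P #>\<^bsub>G\<^esub> inv\<^bsub>G\<^esub> k = ?c ` P"
    by (auto simp: l_coset_def r_coset_def)
  have "inj_on ?c P"
  proof (rule inj_onI)
    fix x y assume "x \<in> P" "y \<in> P" "?c x = ?c y"
    then show "x = y" using assms(2,4) by (metis Units_eq Units_l_cancel right_cancel inv_closed m_closed subsetD)
  qed
  then have "?c ` P = P" using assms(3,5) by (intro endo_inj_surj) auto
  then show ?thesis using assms(2,4) im by (simp add: normalizer_def stabilizer_def)
qed

lemma embeds_in_sylow_normalizer_iso: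
  assumes X: "X \<cong> perms_on Q" "permgrp Q" "Q \<subseteq> Affine" and B: "permgrp B" "Q \<subseteq> B" "Rots \<subseteq> B"
    and f: "f \<in> iso (perms_on B) Y" "group Y" and m: "multiplicity 7 (card B) = 1"
  shows "embeds_in_sylow_normalizer 7 X Y"
proof -
  interpret group_hom "perms_on B" Y f by (rule group_hom_iso[OF group_perms_on[OF B(1)] f(2,1)])
  have s: "subgroup (f ` Q) Y" "subgroup (f ` Rots) Y"
    by (rule subgroup_img_is_subgroup[OF subgroup_perms_on[OF B(1)]], (rule X B permgrp_Rots)+)+
  have inj: "inj_on f B" using f(1) by (auto simp: iso_def bij_betw_def)
  have "order Y = card B" using iso_same_card[OF is_isoI[OF f(1)]] by (simp add: order_def)
  moreover have "card (f ` Rots) = 7" using card_image[OF inj_on_subset[OF inj B(3)]] card_Rots by simp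
  ultimately have "sylow_subgroup 7 Y (f ` Rots)" using s(2) m by (simp add: sylow_subgroup_def)
  moreover have "f ` Q \<subseteq> normalizer Y (f ` Rots)"
  proof
    fix y assume "y \<in> f ` Q"
    then obtain q where q: "q \<in> Q" "y = f q" by blast
    have qB: "q \<in> B" using q B by blast
    have okq: "is_perm q" using X(2) q permgrpD(1) by blast
    have pq: "pinv q \<in> B" by (rule permgrp_pinv[OF B(1) qB])
    have "f (pinv q) \<otimes>\<^bsub>Y\<^esub> f q = \<one>\<^bsub>Y\<^esub>" using hom_mult[of "pinv q" q] qB pq pinv(2)[OF okq] hom_one by simp
    then have i: "inv\<^bsub>Y\<^esub> (f q) = f (pinv q)" using qB pq hom_closed by (intro H.inv_equality) auto
    show "y \<in> normalizer Y (f ` Rots)"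
    proof (rule normalizerI[OF f(2)])
      show "f ` Rots \<subseteq> carrier Y" using B(3) hom_closed by auto
      show "y \<in> carrier Y" using q qB hom_closed by auto
      fix x assume "x \<in> f ` Rots"
      then obtain j where j: "x = f (rot j)" by (auto simp: Rots_def)
      have rB: "rot j \<in> B" using B(3) by (auto simp: Rots_def)
      have "y \<otimes>\<^bsub>Y\<^esub> x \<otimes>\<^bsub>Y\<^esub> inv\<^bsub>Y\<^esub> y = f (q \<star> rot j \<star> pinv q)"
        unfolding q j i using qB rB pq permgrpD(3)[OF B(1)] hom_mult[of "q \<star> rot j" "pinv q"] hom_mult[of q "rot j"] by simp
      then show "y \<otimes>\<^bsub>Y\<^esub> x \<otimes>\<^bsub>Y\<^esub> inv\<^bsub>Y\<^esub> y \<in> f ` Rots" using Affine_conj[of q j] q X(3) by auto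
    qed simp
  qed
  moreover have "X \<cong> Y\<lparr>carrier := f ` Q\<rparr>" using iso_trans[OF X(1)] iso_restrict[OF f(1), of Q] B(2) by simp
  ultimately show ?thesis unfolding embeds_in_sylow_normalizer_def using s(1) by blast
qed

text \<open>By Lagrange the index is determined by the two orders, which isomorphisms preserve.\<close>

lemma has_index_iso:
  assumes "group X" "group Y" "X \<cong> Y" "finite (carrier Y)" "has_subgroup_of_index Y n"
  shows "has_subgroup_of_index X n"
proof -
  obtain L where L: "subgroup L Y" "card (rcosets\<^bsub>Y\<^esub> L) = n" using assms(5) by (auto simp: has_subgroup_of_index_def)
  obtain f where f: "f \<in> iso Y X" using group.iso_sym[OF assms(1,3)] by (auto simp: is_iso_def)
  interpret group_hom Y X f by (rule group_hom_iso[OF assms(2,1) f])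
  have s: "subgroup (f ` L) X" by (rule subgroup_img_is_subgroup[OF L(1)])
  have sub: "L \<subseteq> carrier Y" using subgroup.subset[OF L(1)] .
  have "card (f ` L) = card L" using f sub by (intro card_image) (auto simp: iso_def bij_betw_def intro: inj_on_subset)
  moreover have "order X = order Y" using iso_same_card[OF assms(3)] by (simp add: order_def)
  ultimately have "card (rcosets\<^bsub>X\<^esub> (f ` L)) * card L = card (rcosets\<^bsub>Y\<^esub> L) * card L"
    using group.lagrange[OF assms(1) s] group.lagrange[OF assms(2) L(1)] by simp
  moreover have "card L > 0" using subgroup.one_closed[OF L(1)] finite_subset[OF sub assms(4)] by (auto simp: card_gt_0_iff)
  ultimately show ?thesis using s L(2) by (auto simp: has_subgroup_of_index_def)
qed

lemma permgrp_stab: "permgrp Q \<Longrightarrow> permgrp {p\<in>Q. ap p x = x}"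
  by (auto simp: permgrp_def)

lemma seven_dvd: assumes "permgrp Q" "rot P1 \<in> Q" shows "7 dvd card Q"
  using transitive_card[OF assms(1) rot_transitive[OF assms]] by simp

lemma card_pos: "permgrp Q \<Longrightarrow> card Q > 0"
  using permgrpD(2) by (auto simp: card_gt_0_iff)

lemma perms_on_index: assumes Q: "permgrp Q" "rot P1 \<in> Q" shows "has_subgroup_of_index (perms_on Q) 7"
proof -
  let ?L = "{p\<in>Q. ap p P0 = P0}"
  have L: "subgroup ?L (perms_on Q)" by (rule subgroup_perms_on[OF Q(1) permgrp_stab[OF Q(1)]]) auto
  have "card (rcosets\<^bsub>perms_on Q\<^esub> ?L) * card ?L = 7 * card ?L"
    using group.lagrange[OF group_perms_on[OF Q(1)] L] transitive_card[OF Q(1) rot_transitive[OF Q]] by (simp add: order_def)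
  then have "card (rcosets\<^bsub>perms_on Q\<^esub> ?L) = 7 \<or> card ?L = 0" unfolding mult_cancel2 .
  moreover have "card ?L \<noteq> 0" using card_pos[OF permgrp_stab[OF Q(1), of P0]] by (rule less_imp_neq[THEN not_sym])
  ultimately have "card (rcosets\<^bsub>perms_on Q\<^esub> ?L) = 7" by blast
  then show ?thesis using L by (auto simp: has_subgroup_of_index_def)
qed

lemma permgrp_all: "permgrp {p. is_perm p}" by (simp add: permgrp_def is_perm_pm)

lemma multiplicity_7: assumes Q: "permgrp Q" "rot P1 \<in> Q" shows "multiplicity 7 (card Q) = 1"
proof -
  have "card Q dvd 5040" using card_dvd[OF permgrp_all Q(1)] permgrpD(1)[OF Q(1)] card_is_perm by auto
  then have "\<not> 49 dvd card Q" using dvd_trans[of 49 "card Q" 5040] by auto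
  then show ?thesis using seven_dvd[OF Q] by (intro multiplicity_eqI) simp_all
qed

lemma prime_order_subgroup: assumes D: "permgrp D" "card D = 7" and L: "permgrp L" "L \<subseteq> D" "d \<in> L" "d \<noteq> pid" shows "L = D"
proof -
  have "card L dvd 7" using card_dvd[OF D(1) L(1,2)] D(2) by simp
  moreover have "Factorial_Ring.prime (7::nat)" by simp
  ultimately have "card L = 1 \<or> card L = 7" by (metis prime_nat_iff)
  moreover have "card L \<noteq> 1"
  proof
    assume "card L = 1"
    then obtain x where "L = {x}" by (auto simp: card_1_singleton_iff)
    then show False using L(3,4) permgrpD(2)[OF L(1)] by auto
  qed
  ultimately show ?thesis using D(2) L(2) by (metis card_subset_eq finite)
qed

text \<open>A group of prime order 7 is abelian and, acting nontrivially on seven points, transitive.\<close>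

lemma self_centralizing_order_7: assumes D: "permgrp D" "card D = 7" and z: "is_perm z" "\<And>d. d \<in> D \<Longrightarrow> z \<star> d = d \<star> z"
  shows "z \<in> D"
proof -
  have "\<not> D \<subseteq> {pid}" using D(2) card_mono[of "{pid}" D] by auto
  then obtain d where d: "d \<in> D" "d \<noteq> pid" by blast
  have ab: "p \<star> q = q \<star> p" if p: "p \<in> D" and q: "q \<in> D" for p q
  proof (cases "p = pid")
    case False
    have "permgrp {x\<in>D. x \<star> p = p \<star> x}"
      unfolding permgrp_def using permgrpD[OF D(1)] by (auto) (metis pm_assoc)
    then have "{x\<in>D. x \<star> p = p \<star> x} = D"
      by (rule prime_order_subgroup[OF D, where d=p]) (use p False in auto)
    then show ?thesis using q by (metis (mono_tags, lifting) mem_Collect_eq)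
  qed simp
  obtain y where y: "ap d y \<noteq> y" using d(2) perm_eqI[of d pid] by auto
  have inj: "inj_on (\<lambda>p. ap p y) D"
  proof (rule inj_onI)
    fix p q assume pq: "p \<in> D" "q \<in> D" "ap p y = ap q y"
    let ?r = "pinv q \<star> p"
    have okq: "is_perm q" using permgrpD(1)[OF D(1) pq(2)] .
    have r: "?r \<in> D" using permgrp_pinv[OF D(1) pq(2)] permgrpD(3)[OF D(1)] pq(1) by blast
    have "ap ?r y = ap (pinv q \<star> q) y" using pq(3) by simp
    then have "ap ?r y = y" by (simp add: pinv[OF okq] del: ap_pm)
    then have "?r = pid" using prime_order_subgroup[OF D permgrp_stab[OF D(1), of y], of ?r] r d(1) y by auto
    then have "q \<star> ?r = q" by simp
    then show "p = q" by (simp add: pm_assoc[symmetric] pinv[OF okq])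
  qed
  have "(\<lambda>p. ap p y) ` D = UNIV"
    by (rule card_subset_eq) (simp_all add: card_image[OF inj] D(2) card_pt)
  then have tr: "\<exists>p\<in>D. ap p y = x" for x by (metis (mono_tags, lifting) UNIV_I imageE)
  obtain p where p: "p \<in> D" "ap p y = ap z y" using tr by blast
  have "ap z x = ap p x" for x
  proof -
    obtain q where q: "q \<in> D" "ap q y = x" using tr by blast
    have "ap z x = ap (z \<star> q) y" by (simp add: q(2))
    also have "\<dots> = ap q (ap p y)" by (simp add: z(2)[OF q(1)] p(2))
    also have "\<dots> = ap (q \<star> p) y" by simp
    also have "\<dots> = ap p x" by (simp add: ab[OF q(1) p(1)] q(2))
    finally show ?thesis .
  qed
  then have "z = p" by (rule perm_eqI)
  then show ?thesis using p(1) by simp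
qed

text \<open>The order of a permutation group of degree 7 is not divisible by 49, so its Sylow subgroups for 7 have order 7.\<close>

lemma self_centralizing: assumes X: "group X" "X \<cong> perms_on Q" and Q: "permgrp Q" "rot P1 \<in> Q"
  shows "self_centralizing_sylow 7 X"
  unfolding self_centralizing_sylow_def
proof (intro allI impI)
  fix P assume P: "sylow_subgroup 7 X P"
  obtain f where f: "f \<in> iso X (perms_on Q)" using X(2) by (auto simp: is_iso_def)
  interpret group_hom X "perms_on Q" f by (rule group_hom_iso[OF X(1) group_perms_on[OF Q(1)] f])
  have inj: "inj_on f (carrier X)" using f by (auto simp: iso_def bij_betw_def)
  have s: "subgroup P X" and "card P = 7 ^ multiplicity 7 (order X)" using P by (auto simp: sylow_subgroup_def)
  moreover have "order X = card Q" using iso_same_card[OF X(2)] by (simp add: order_def)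
  ultimately have cP: "card P = 7" using multiplicity_7[OF Q] by simp
  have sub: "P \<subseteq> carrier X" using subgroup.subset[OF s] .
  have D: "permgrp (f ` P)" using subgroup_perms_on_permgrp[OF Q(1) subgroup_img_is_subgroup[OF s]] by simp
  have cD: "card (f ` P) = 7" using cP card_image[OF inj_on_subset[OF inj sub]] by simp
  show "centralizer X P = P"
  proof
    show "centralizer X P \<subseteq> P"
    proof
      fix g assume "g \<in> centralizer X P"
      then have g: "g \<in> carrier X" "\<And>s. s \<in> P \<Longrightarrow> g \<otimes>\<^bsub>X\<^esub> s = s \<otimes>\<^bsub>X\<^esub> g" by (auto simp: centralizer_def)
      have "f g \<in> f ` P"
      proof (rule self_centralizing_order_7[OF D cD])
        show "is_perm (f g)" using hom_closed[OF g(1)] permgrpD(1)[OF Q(1)] by simp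
        fix d assume "d \<in> f ` P"
        then obtain s where s: "s \<in> P" "d = f s" by blast
        then have "f (g \<otimes>\<^bsub>X\<^esub> s) = f (s \<otimes>\<^bsub>X\<^esub> g)" using g(2) by simp
        then show "f g \<star> d = d \<star> f g" using s sub g(1) by auto
      qed
      then show "g \<in> P" using inj g(1) sub by (auto dest: inj_onD)
    qed
    have "s \<otimes>\<^bsub>X\<^esub> t = t \<otimes>\<^bsub>X\<^esub> s" if st: "s \<in> P" "t \<in> P" for s t
    proof -
      have ft: "f t \<in> f ` P" "f t \<in> Q" using st sub hom_closed by auto
      have "permgrp {x\<in>f ` P. x \<star> f t = f t \<star> x}"
        unfolding permgrp_def using permgrpD[OF D] by auto (metis pm_assoc)
      then have "f t = pid \<or> {x\<in>f ` P. x \<star> f t = f t \<star> x} = f ` P"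
        using prime_order_subgroup[OF D cD, of "{x\<in>f ` P. x \<star> f t = f t \<star> x}" "f t"] ft by auto
      then have "f s \<star> f t = f t \<star> f s"
        using st by (metis (mono_tags, lifting) imageI mem_Collect_eq pid_pm)
      then have "f (s \<otimes>\<^bsub>X\<^esub> t) = f (t \<otimes>\<^bsub>X\<^esub> s)" using hom_mult[of s t] hom_mult[of t s] st sub by (simp add: subset_iff)
      then show ?thesis using inj st sub G.m_closed by (auto dest!: inj_onD)
    qed
    then show "P \<subseteq> centralizer X P" using sub by (auto simp: centralizer_def)
  qed
qed

text \<open>The stabilizer of \<open>P0\<close> is a subgroup of the cyclic group of the six multiplications.\<close>

lemma Affine_card: assumes Q: "permgrp Q" "rot P1 \<in> Q" "Q \<subseteq> Affine" shows "card Q \<in> {7, 14, 21, 42}"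
proof -
  let ?L = "{p\<in>Q. ap p P0 = P0}"
  let ?M = "{p\<in>Affine. ap p P0 = P0}"
  have M: "?M = set mults" 
  proof
    have "every (\<lambda>p. ap p P0 = P0) mults" by code_simp
    then show "set mults \<subseteq> ?M" using mults_Affine unfolding every_iff by blast
    show "?M \<subseteq> set mults" using Affine_fix0 by blast
  qed
  have "card (set mults) = 6" by (simp add: mults_def scale.simps)
  then have "card ?L dvd 6"
    using card_dvd[OF permgrp_stab[OF permgrp_Affine] permgrp_stab[OF Q(1)], of P0 P0] Q(3) M by auto
  then have "card ?L \<in> {1,2,3,6}"
  proof -
    assume d: "card ?L dvd 6"
    then have "card ?L \<le> 6" by (simp add: dvd_imp_le)
    then have "card ?L \<in> {0,1,2,3,4,5,6}" unfolding insert_iff empty_iff by linarith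
    then show ?thesis using d by (elim insertE emptyE; simp only:; simp)
  qed
  then show ?thesis using transitive_card[OF Q(1) rot_transitive[OF Q(1,2)]] by auto
qed

lemma cycle3: "distinct [a, b, c] \<Longrightarrow> cycle_of_list [a, b, c] x = (if x = a then b else if x = b then c else if x = c then a else x)"
  by (auto simp: transpose_def)

text \<open>The 3-cycles generate the alternating group; one odd permutation then yields all of them.\<close>

lemma alt_or_sym: assumes Q: "permgrp Q" "threes \<subseteq> Q" shows "perms_on Q \<cong> alt_group 7 \<or> perms_on Q \<cong> sym_group 7"
proof -
  interpret group_hom permG "sym_group 7" tosym by (rule group_hom_iso[OF group_permG group_sym tosym_iso])
  have s: "subgroup (tosym ` Q) (sym_group 7)" using subgroup_img_is_subgroup Q(1) subgroup_permG by blast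
  have a: "subgroup (carrier (alt_group 7)) (sym_group 7)" by (rule alt_group_is_subgroup)
  have "three_cycles 7 \<subseteq> tosym ` Q"
  proof
    fix f :: "nat \<Rightarrow> nat" assume "f \<in> three_cycles 7"
    then obtain cs where cs: "f = cycle_of_list cs" "distinct cs" "length cs = 3" "set cs \<subseteq> {1..7}" by auto
    obtain a b c where abc: "cs = [a, b, c]" using stupid_lemma[OF cs(3)] by blast
    have m: "a \<in> {1..7}" "b \<in> {1..7}" "c \<in> {1..7}" using cs(4) abc by auto
    have d: "distinct [a, b, c]" using cs(2) abc by simp
    let ?t = "three_cycle (pt_of a) (pt_of b) (pt_of c)"
    have "distinct [pt_of a, pt_of b, pt_of c]" using d num_pt_of[OF m(1)] num_pt_of[OF m(2)] num_pt_of[OF m(3)] by auto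
    then have t: "?t \<in> Q" using Q(2) unfolding threes_def by blast
    have "tosym ?t = f"
    proof (rule tosym_eqI)
      fix i
      have e: "i = pt_of x \<longleftrightarrow> num i = x" if "x \<in> {1..7}" for x using that num_pt_of by auto
      show "tosym ?t (num i) = f (num i)"
        unfolding cs(1) abc cycle3[OF d] tosym_num three_cycle_def ap_table
          e[OF m(1)] e[OF m(2)] e[OF m(3)] using num_pt_of m by simp
    next
      fix n :: nat assume n: "n \<notin> {1..7}"
      then have "n \<noteq> a" "n \<noteq> b" "n \<noteq> c" using m by blast+
      then show "tosym ?t n = f n" unfolding cs(1) abc cycle3[OF d] tosym_other[OF n] by simp
    qed
    then show "f \<in> tosym ` Q" using t by blast
  qed
  then have "three_cycles 7 \<subseteq> tosym ` Q \<inter> carrier (alt_group 7)" using three_cycles_incl by blast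
  moreover have "subgroup (tosym ` Q \<inter> carrier (alt_group 7)) (alt_group 7)"
  proof -
    have "subgroup (tosym ` Q \<inter> carrier (alt_group 7)) (sym_group 7\<lparr>carrier := carrier (alt_group 7)\<rparr>)"
      by (rule group.subgroup_incl[OF group_sym group.subgroups_Inter_pair[OF group_sym s a] a]) simp
    then show ?thesis by (simp add: alt_group_def)
  qed
  ultimately have "generate (alt_group 7) (three_cycles 7) \<subseteq> tosym ` Q \<inter> carrier (alt_group 7)"
    by (rule group.generate_subgroup_incl[OF alt_group_is_group])
  then have sub: "carrier (alt_group 7) \<subseteq> tosym ` Q" using alt_group_carrier_as_three_cycles[of 7] by blast
  have iso: "perms_on Q \<cong> sym_group 7\<lparr>carrier := tosym ` Q\<rparr>"
    using iso_restrict[OF tosym_iso, of Q] permgrpD(1)[OF Q(1)] by auto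
  show ?thesis
  proof (cases "tosym ` Q \<subseteq> carrier (alt_group 7)")
    case True
    then have "tosym ` Q = carrier (alt_group 7)" using sub by blast
    then show ?thesis using iso by (simp add: alt_group_def)
  next
    case False
    then obtain h where h: "h \<in> tosym ` Q" "h \<notin> carrier (alt_group 7)" by blast
    have hp: "h permutes {1..7}" using h(1) subgroup.subset[OF s] by (auto simp: sym_group_def)
    have "g \<in> tosym ` Q" if g: "g permutes {1..7}" for g
    proof (cases "evenperm g")
      case True
      then show ?thesis using sub g by (auto simp: alt_group_carrier)
    next
      case False
      have pg: "permutation g" "permutation h" using g hp permutation_permutes finite_atLeastAtMost by blast+
      have "evenperm (g \<circ> h)" using False h(2) hp pg by (simp add: evenperm_comp alt_group_carrier)
      then have "g \<circ> h \<in> tosym ` Q" using sub permutes_compose[OF hp g] by (auto simp: alt_group_carrier)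
      moreover have "inv\<^bsub>sym_group 7\<^esub> h \<in> tosym ` Q" by (rule subgroup.m_inv_closed[OF s h(1)])
      ultimately have "(g \<circ> h) \<otimes>\<^bsub>sym_group 7\<^esub> inv\<^bsub>sym_group 7\<^esub> h \<in> tosym ` Q" by (rule subgroup.m_closed[OF s])
      moreover have "g \<otimes>\<^bsub>sym_group 7\<^esub> h \<otimes>\<^bsub>sym_group 7\<^esub> inv\<^bsub>sym_group 7\<^esub> h = g"
      proof -
        have c: "g \<in> carrier (sym_group 7)" "h \<in> carrier (sym_group 7)" using g hp by (simp_all add: sym_group_carrier)
        show ?thesis by (simp only: H.m_assoc[OF c H.inv_closed[OF c(2)]] H.r_inv[OF c(2)] H.r_one[OF c(1)])
      qed
      ultimately show ?thesis by (simp add: sym_group_mult)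
    qed
    then have "carrier (sym_group 7) \<subseteq> tosym ` Q" by (auto simp: sym_group_carrier)
    then have "tosym ` Q = carrier (sym_group 7)" using subgroup.subset[OF s] by blast
    then show ?thesis using iso by simp
  qed
qed


section \<open>Monomial groups and their diagonal subgroups\<close>

definition Diag :: "(pt \<Rightarrow> real^7) \<Rightarrow> sp set \<Rightarrow> (real^7^7) set" where
  "Diag v S = Mat v ` {x\<in>S. fst x = pid}"

lemma permG_all: "perms_on {p. is_perm p} = permG" by (simp add: permG_def)

lemma tosym_iso_all: "tosym \<in> iso (perms_on {p. is_perm p}) (sym_group 7)"
  unfolding permG_all by (rule tosym_iso)

text \<open>The multiplications that preserve the Fano plane are those by the squares 1, 2, 4.\<close>

lemma Fano_Affine_card: assumes Q: "permgrp Q" "rot P1 \<in> Q" "Q \<subseteq> Fano" "Q \<subseteq> Affine" shows "card Q \<in> {7, 7 * 3}"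
proof -
  let ?L = "{p\<in>Q. ap p P0 = P0}" and ?M = "{p\<in>Fano \<inter> Affine. ap p P0 = P0}"
  have g: "permgrp (Fano \<inter> Affine)" using permgrp_Fano permgrp_Affine by (simp add: permgrp_def)
  have "?M = set (filter fano mults)"
  proof
    have "every (\<lambda>p. if ap p P0 = P0 then is_perm p else False) mults" by code_simp
    then show "set (filter fano mults) \<subseteq> ?M"
      using mults_Affine unfolding every_iff by (auto simp: Fano_def split: if_split_asm)
    show "?M \<subseteq> set (filter fano mults)" using Affine_fix0 by (auto simp: Fano_def)
  qed
  moreover have "filter fano mults = map scale [P1, P2, P4]" by code_simp
  ultimately have "card ?M = 3" by (simp add: scale.simps)
  then have "card ?L dvd 3" using card_dvd[OF permgrp_stab[OF g] permgrp_stab[OF Q(1)], of P0 P0] Q(3,4) by auto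
  moreover have "Factorial_Ring.prime (3::nat)" by simp
  ultimately have "card ?L = 1 \<or> card ?L = 3" by (metis prime_nat_iff)
  then show ?thesis using transitive_card[OF Q(1) rot_transitive[OF Q(1,2)]] by auto
qed

definition spG :: "sp monoid" where
  "spG = \<lparr>carrier = {x. is_perm (fst x)}, mult = (\<diamondop>), one = sid\<rparr>"

lemma spG_simps [simp]: "carrier spG = {x. is_perm (fst x)}" "mult spG = (\<diamondop>)" "one spG = sid"
  by (simp_all add: spG_def)

locale monomial_group =
  fixes H :: "(real^7^7) set" and v :: "pt \<Rightarrow> real^7" and S :: "sp set"
  assumes rep: "monomial_rep H v S" and subgroup: "subgroup H orthogonal_group"
begin

lemma basis: "basis7 v" and S: "spgrp S" "cyc7 P1 \<in> S" and H: "H = Mat v ` S"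
  using rep by (auto simp: monomial_rep_def)

lemma group_H: "group (matrix_group H)"
  by (rule group.subgroup_imp_group[OF group_orthogonal subgroup])

lemma Q: "permgrp (fst ` S)" "rot P1 \<in> fst ` S"
proof -
  show "permgrp (fst ` S)" by (rule permgrp_fst[OF S(1)])
  show "rot P1 \<in> fst ` S" using S(2) by (force simp: cyc7_def)
qed

definition line_perm :: "real^7^7 \<Rightarrow> perm" where "line_perm g = fst (inv_into UNIV (Mat v) g)"

lemma line_perm_Mat [simp]: "line_perm (Mat v x) = fst x"
proof -
  have "inj (Mat v)" by (rule injI) (rule Mat_inj[OF basis])
  then show ?thesis by (simp add: line_perm_def)
qed

lemma line_perm_hom: "group_hom (matrix_group H) permG line_perm"
proof (intro group_hom.intro group_hom_axioms.intro group_H group_permG homI)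
  show "line_perm x \<in> carrier permG" if "x \<in> carrier (matrix_group H)" for x
    using that spgrpD(1)[OF S(1)] by (auto simp: H)
  show "line_perm (x \<otimes>\<^bsub>matrix_group H\<^esub> y) = line_perm x \<otimes>\<^bsub>permG\<^esub> line_perm y"
    if "x \<in> carrier (matrix_group H)" "y \<in> carrier (matrix_group H)" for x y
    using that by (auto simp: H Mat_smul[OF basis, symmetric] simp del: smul.simps)
qed

lemma inv_Mat: assumes x: "x \<in> S" shows "inv\<^bsub>matrix_group H\<^esub> (Mat v x) = Mat v (sinv x)"
proof -
  have "sinv x \<diamondop> x = sid" using sinv(2) spgrpD(1)[OF S(1) x] by blast
  then show ?thesis using spgrp_sinv[OF S(1) x] x
    by (intro group.inv_equality[OF group_H]) (auto simp: H Mat_smul[OF basis, symmetric] Mat_sid[OF basis])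
qed

lemma line_perm_kernel: "kernel (matrix_group H) permG line_perm = Diag v S"
  by (auto simp: kernel_def Diag_def H)

lemma line_perm_image: "line_perm ` carrier (matrix_group H) = fst ` S"
  by (simp add: H image_image)

lemma Diag_normal: "Diag v S \<lhd> matrix_group H"
  using group_hom.normal_kernel[OF line_perm_hom] line_perm_kernel by simp

lemma quotient_iso: "matrix_group H Mod Diag v S \<cong> perms_on (fst ` S)"
  using group_hom.FactGroup_image_iso[OF line_perm_hom] unfolding line_perm_kernel line_perm_image .

lemma quotient_group: "group (matrix_group H Mod Diag v S)"
  by (rule normal.factorgroup_is_group[OF Diag_normal])

lemma quotient_order: "order (matrix_group H Mod Diag v S) = card (fst ` S)"
  using iso_same_card[OF quotient_iso] by (simp add: order_def)

lemma Diag_alt: "Diag v S = (\<lambda>b. Mat v (pid, b)) ` diag_signs S"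
  unfolding Diag_def diag_signs_def by (auto simp: image_iff)

lemma card_Diag: "card (Diag v S) = card (diag_signs S)"
  unfolding Diag_alt by (rule card_image) (auto intro!: inj_onI dest: Mat_inj[OF basis])

lemma Diag_elementary: "elementary_abelian 2 (matrix_group (Diag v S))"
proof -
  have sub: "subgroup (Diag v S) (matrix_group H)" using Diag_normal by (simp add: normal_imp_subgroup)
  have g: "group (matrix_group (Diag v S))" using group.subgroup_imp_group[OF group_H sub] by simp
  have m: "Mat v (pid, a) ** Mat v (pid, b) = Mat v (pid, sx a b)" for a b
    by (simp add: Mat_smul[OF basis, symmetric] sx_comm)
  have "comm_group (matrix_group (Diag v S))"
    by (rule group.group_comm_groupI[OF g]) (auto simp: Diag_alt m sx_comm)
  moreover have "x [^]\<^bsub>matrix_group (Diag v S)\<^esub> (2::nat) = \<one>\<^bsub>matrix_group (Diag v S)\<^esub>"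
    if x: "x \<in> carrier (matrix_group (Diag v S))" for x
  proof -
    interpret D: group "matrix_group (Diag v S)" by (rule g)
    obtain b where b: "x = Mat v (pid, b)" using x by (auto simp: Diag_alt)
    have "x [^]\<^bsub>matrix_group (Diag v S)\<^esub> (2::nat) = x ** x"
      using D.nat_pow_Suc[of x 1] D.nat_pow_Suc[of x 0] x by (simp add: numeral_2_eq_2)
    then show ?thesis using Mat_sid[OF basis] by (simp add: b m sid_def)
  qed
  ultimately show ?thesis by (simp add: elementary_abelian_def)
qed

lemma set_mult_def': "A <#>\<^bsub>matrix_group H\<^esub> C = {a ** c |a c. a \<in> A \<and> c \<in> C}"
  by (auto simp: set_mult_def)

text \<open>A complement of matrices corresponds to its set of signed permutations.\<close>

lemma split_iff: "split_extension (matrix_group H) (Diag v S) \<longleftrightarrow> (\<exists>K. complements K S)"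
proof
  assume "split_extension (matrix_group H) (Diag v S)"
  then obtain C where C: "subgroup C (matrix_group H)" "Diag v S \<inter> C = {mat 1}"
    "Diag v S <#>\<^bsub>matrix_group H\<^esub> C = H" by (auto simp: split_extension_def)
  define K where "K = {x\<in>S. Mat v x \<in> C}"
  have CH: "C \<subseteq> H" using subgroup.subset[OF C(1)] by simp
  have "spgrp K"
    unfolding spgrp_def K_def
    using spgrpD[OF S(1)] subgroup.one_closed[OF C(1)] subgroup.m_closed[OF C(1)]
    by (auto simp: Mat_sid[OF basis] Mat_smul[OF basis] simp del: smul.simps)
  moreover have "x = sid" if "x \<in> K" "fst x = pid" for x
  proof -
    have "Mat v x \<in> Diag v S \<inter> C" using that by (auto simp: K_def Diag_def)
    then have "Mat v x = Mat v sid" using C(2) Mat_sid[OF basis] by simp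
    then show ?thesis by (rule Mat_inj[OF basis])
  qed
  moreover have "fst ` S \<subseteq> fst ` K"
  proof
    fix p assume "p \<in> fst ` S"
    then obtain x where x: "x \<in> S" "p = fst x" by blast
    then have "Mat v x \<in> Diag v S <#>\<^bsub>matrix_group H\<^esub> C" using C(3) H by blast
    then obtain a c where ac: "a \<in> Diag v S" "c \<in> C" "Mat v x = a ** c" unfolding set_mult_def' by blast
    obtain y where y: "y \<in> S" "c = Mat v y" using ac(2) CH H by blast
    obtain z where z: "z \<in> S" "fst z = pid" "a = Mat v z" using ac(1) by (auto simp: Diag_def)
    have "Mat v x = Mat v (z \<diamondop> y)" using ac(3) y z by (simp add: Mat_smul[OF basis])
    then have "x = z \<diamondop> y" by (rule Mat_inj[OF basis])
    then have "p = fst y" using x(2) z(2) by simp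
    then show "p \<in> fst ` K" using y ac(2) by (auto simp: K_def)
  qed
  ultimately show "\<exists>K. complements K S" unfolding complements_def K_def by blast
next
  assume "\<exists>K. complements K S"
  then obtain K where K: "spgrp K" "K \<subseteq> S" "\<And>x. x \<in> K \<Longrightarrow> fst x = pid \<Longrightarrow> x = sid" "fst ` S \<subseteq> fst ` K"
    by (auto simp: complements_def)
  let ?C = "Mat v ` K"
  have CH: "?C \<subseteq> H" using K(2) H by blast
  have sub: "subgroup ?C (matrix_group H)"
  proof (rule group.subgroupI[OF group_H])
    fix a assume "a \<in> ?C"
    then obtain x where x: "x \<in> K" "a = Mat v x" by blast
    then have "x \<in> S" using K(2) by blast
    then have "inv\<^bsub>matrix_group H\<^esub> a = Mat v (sinv x)" unfolding x(2) by (rule inv_Mat)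
    then show "inv\<^bsub>matrix_group H\<^esub> a \<in> ?C" using spgrp_sinv[OF K(1) x(1)] by blast
  next
  qed (use CH spgrpD[OF K(1)] in \<open>auto simp: Mat_smul[OF basis, symmetric] simp del: smul.simps\<close>)
  have int: "Diag v S \<inter> ?C = {mat 1}"
  proof
    show "Diag v S \<inter> ?C \<subseteq> {mat 1}"
    proof
      fix a assume "a \<in> Diag v S \<inter> ?C"
      then obtain x y where "x \<in> S" "fst x = pid" "a = Mat v x" "y \<in> K" "a = Mat v y" by (auto simp: Diag_def)
      then have "x = sid" using K(3) Mat_inj[OF basis, of x y] by metis
      then show "a \<in> {mat 1}" using \<open>a = Mat v x\<close> Mat_sid[OF basis] by simp
    qed
    have "Mat v sid \<in> Diag v S" unfolding Diag_def using spgrpD(2)[OF S(1)] by (intro imageI) simp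
    moreover have "Mat v sid \<in> ?C" using spgrpD(2)[OF K(1)] by (rule imageI)
    ultimately show "{mat 1} \<subseteq> Diag v S \<inter> ?C" unfolding Mat_sid[OF basis] by blast
  qed
  have prod: "Diag v S <#>\<^bsub>matrix_group H\<^esub> ?C = H"
  proof
    show "Diag v S <#>\<^bsub>matrix_group H\<^esub> ?C \<subseteq> H"
      unfolding set_mult_def' using K(2) spgrpD(3)[OF S(1)]
      by (auto simp: Diag_def H Mat_smul[OF basis, symmetric] simp del: smul.simps)
    show "H \<subseteq> Diag v S <#>\<^bsub>matrix_group H\<^esub> ?C"
    proof
      fix g assume "g \<in> H"
      then obtain x where x: "x \<in> S" "g = Mat v x" using H by blast
      then obtain y where y: "y \<in> K" "fst y = fst x" using K(4) by (metis (no_types, lifting) image_iff subset_iff)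
      have is_perm: "is_perm (fst y)" using spgrpD(1)[OF K(1) y(1)] .
      let ?z = "x \<diamondop> sinv y"
      have z: "?z \<in> S" using x(1) spgrp_sinv[OF K(1) y(1)] K(2) spgrpD(3)[OF S(1)] by blast
      have "fst ?z = pid" using is_perm y(2) by (simp add: sinv_def pinv)
      then have "Mat v ?z \<in> Diag v S" using z by (auto simp: Diag_def)
      moreover have "g = Mat v ?z ** Mat v y"
        by (simp only: Mat_smul[OF basis, symmetric] smul_assoc sinv(2)[OF is_perm] sid_smul x(2))
      ultimately show "g \<in> Diag v S <#>\<^bsub>matrix_group H\<^esub> ?C" unfolding set_mult_def' using y(1) by blast
    qed
  qed
  have "line_perm \<in> iso (matrix_group ?C) (perms_on (fst ` S))"
    unfolding iso_def
  proof (intro CollectI conjI homI)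
    show "bij_betw line_perm (carrier (matrix_group ?C)) (carrier (perms_on (fst ` S)))"
    proof -
      have "fst ` K = fst ` S" using K(2,4) by blast
      moreover have "inj_on line_perm ?C"
      proof (rule inj_onI)
        fix a b assume "a \<in> ?C" "b \<in> ?C" "line_perm a = line_perm b"
        then obtain x y where xy: "x \<in> K" "y \<in> K" "a = Mat v x" "b = Mat v y" "fst x = fst y" by auto
        have is_perm: "is_perm (fst x)" using spgrpD(1)[OF K(1) xy(1)] .
        have "sinv x \<diamondop> y = sid"
          by (rule K(3)[OF spgrpD(3)[OF K(1) spgrp_sinv[OF K(1) xy(1)] xy(2)]]) (use xy(5) is_perm pinv in \<open>simp add: sinv_def\<close>)
        then have "x \<diamondop> (sinv x \<diamondop> y) = x" by simp
        then have "y = x" by (simp only: smul_assoc[symmetric] sinv(3)[OF is_perm] sid_smul)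
        then show "a = b" using xy by simp
      qed
      ultimately show ?thesis by (simp add: bij_betw_def image_image)
    qed
    show "line_perm x \<in> carrier (perms_on (fst ` S))" if "x \<in> carrier (matrix_group ?C)" for x
      using that K(2) by force
    show "line_perm (x \<otimes>\<^bsub>matrix_group ?C\<^esub> y) = line_perm x \<otimes>\<^bsub>perms_on (fst ` S)\<^esub> line_perm y"
      if "x \<in> carrier (matrix_group ?C)" "y \<in> carrier (matrix_group ?C)" for x y
      using that by (auto simp: Mat_smul[OF basis, symmetric] simp del: smul.simps)
  qed
  then have "matrix_group ?C \<cong> matrix_group H Mod Diag v S"
    using iso_trans[OF is_isoI group.iso_sym[OF quotient_group quotient_iso]] by blast
  then show "split_extension (matrix_group H) (Diag v S)"
    unfolding split_extension_def using Diag_normal sub int prod by auto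
qed

lemma line_irreducible: assumes "N \<subseteq> Diag v S" shows "irreducible_subrep N (span {v i})"
  unfolding irreducible_subrep_def
proof (intro conjI ballI allI impI)
  show "span {v i} \<noteq> {0}" using basis7_nz[OF basis, of i] span_base[of "v i" "{v i}"] by auto
  fix g assume "g \<in> N"
  then obtain b where "g = Mat v (pid, b)" using assms Diag_alt by blast
  then have "g *v v i = sg (bt b i) *\<^sub>R v i" by (simp add: Mat[OF basis])
  then show "(*v) g ` span {v i} \<subseteq> span {v i}"
    by (auto simp: span_singleton matrix_vector_mult_scaleR)
next
  fix W assume W: "subspace W \<and> W \<subseteq> span {v i} \<and> (\<forall>g\<in>N. (*v) g ` W \<subseteq> W)"
  show "W = {0} \<or> W = span {v i}"
  proof (cases "W = {0}")
    case False
    then obtain w where w: "w \<in> W" "w \<noteq> 0" using W subspace_0 by blast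
    then obtain k where k: "w = k *\<^sub>R v i" using W by (auto simp: span_singleton)
    have "inverse k *\<^sub>R w \<in> W" using W w(1) by (intro subspace_scale) auto
    then have "v i \<in> W" using k w(2) by auto
    then show ?thesis using W span_minimal[of "{v i}" W] by auto
  qed simp
qed simp

text \<open>The coordinate lines are irreducible constituents of the diagonal subgroup with distinct characters.\<close>

lemma not_quasi_primitive: assumes "simplex_code \<subseteq> diag_signs S" shows "\<not> quasi_primitive H"
proof
  assume "quasi_primitive H"
  then have "isomorphic_subreps (Diag v S) (span {v P0}) (span {v P1})"
    using Diag_normal line_irreducible[OF subset_refl] unfolding quasi_primitive_def by blast
  then obtain f where f: "linear f" "bij_betw f (span {v P0}) (span {v P1})"
    "\<And>g u. g \<in> Diag v S \<Longrightarrow> u \<in> span {v P0} \<Longrightarrow> f (g *v u) = g *v f u"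
    unfolding isomorphic_subreps_def by blast
  obtain b where b: "b \<in> diag_signs S" "bt b P0 \<noteq> bt b P1" using simplex_separates[of P0 P1] assms by auto
  have v0: "v P0 \<in> span {v P0}" by (simp add: span_base)
  have "f (v P0) \<in> span {v P1}" using f(2) v0 by (auto simp: bij_betw_def)
  then obtain k where k: "f (v P0) = k *\<^sub>R v P1" by (auto simp: span_singleton)
  have "Mat v (pid, b) \<in> Diag v S" using b(1) Diag_alt by blast
  from f(3)[OF this v0] have "f (sg (bt b P0) *\<^sub>R v P0) = Mat v (pid, b) *v f (v P0)" by (simp add: Mat[OF basis])
  then have "(sg (bt b P0) * k) *\<^sub>R v P1 = (k * sg (bt b P1)) *\<^sub>R v P1"
    using f(1) by (simp add: k linear_cmul Mat[OF basis] matrix_vector_mult_scaleR)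
  then have "sg (bt b P0) * k = k * sg (bt b P1)" using basis7_nz[OF basis, of P1] by simp
  then have "k = 0" using b(2) by (auto simp: sg_def split: if_splits)
  then have "f (v P0) = f 0" using k linear_0[OF f(1)] by simp
  then have "v P0 = 0" using f(2) v0 span_zero by (auto simp: bij_betw_def dest: inj_onD)
  then show False using basis7_nz[OF basis] by blast
qed

lemma embeds_sym: "embeds_in (matrix_group H Mod Diag v S) (sym_group 7)"
proof (rule embeds_iso[OF quotient_iso Q(1) permgrp_all])
  show "fst ` S \<subseteq> {p. is_perm p}" using permgrpD(1)[OF Q(1)] by auto
  show "tosym \<in> iso (perms_on {p. is_perm p}) (sym_group 7)" by (rule tosym_iso_all)
qed (rule group_sym)

lemma Rots_sub: "Rots \<subseteq> fst ` S" using rot_in[OF Q] by (auto simp: Rots_def)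

text \<open>The classification of the permutation group gives the quotient, and \<open>evens_complement\<close> the splitting.\<close>

lemma case3_Diag: assumes d: "diag_signs S = evens" shows "case3 H (Diag v S)"
proof -
  let ?X = "matrix_group H Mod Diag v S"
  have c64: "card evens = 64"
  proof -
    have "evens = set (filter (\<lambda>b. \<not> parity b) all_signs)" using all_signs_complete by (auto simp: evens_def)
    moreover have "distinct (filter (\<lambda>b. \<not> parity b) all_signs)" "length (filter (\<lambda>b. \<not> parity b) all_signs) = 64" by code_simp+
    ultimately show ?thesis using distinct_card by metis
  qed
  have m: "multiplicity 7 (card {p. is_perm p}) = 1"
  proof -
    have "rot P1 \<in> {p. is_perm p}" by simp
    then show ?thesis by (rule multiplicity_7[OF permgrp_all])
  qed
  have syl: "embeds_in_sylow_normalizer 7 ?X (sym_group 7) \<and> order ?X \<in> {7, 7 * 2, 7 * 3, 42}" if n: "fst ` S \<subseteq> Affine"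
  proof
    show "embeds_in_sylow_normalizer 7 ?X (sym_group 7)"
      by (rule embeds_in_sylow_normalizer_iso[OF quotient_iso Q(1) n permgrp_all _ _ tosym_iso_all group_sym m])
        (use permgrpD(1)[OF Q(1)] permgrpD(1)[OF permgrp_Rots] in auto)
    show "order ?X \<in> {7, 7 * 2, 7 * 3, 42}" using Affine_card[OF Q n] quotient_order by simp
  qed
  have "(embeds_in_sylow_normalizer 7 ?X (sym_group 7) \<and> order ?X \<in> {7, 7 * 2, 7 * 3, 42} \<or>
         ?X \<cong> PSL_3_2 \<or> ?X \<cong> alt_group 7 \<or> ?X \<cong> sym_group 7)"
    using classification[OF Q]
  proof (elim disjE)
    assume "fst ` S = Fano"
    then have "?X \<cong> PSL_3_2" using iso_trans[OF quotient_iso] group.iso_sym[OF PSL_3_2_Fano(2,1)] by simp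
    then show ?thesis by blast
  next
    assume e: "fst ` S = Fano'"
    have "flip \<in> iso (perms_on Fano') (perms_on Fano)"
      unfolding iso_def hom_def bij_betw_def Fano'_eq
      by (auto simp: flip_pm image_image intro!: inj_onI)
    then have "perms_on Fano' \<cong> perms_on Fano" by (rule is_isoI)
    then have "?X \<cong> PSL_3_2" using iso_trans[OF quotient_iso] iso_trans group.iso_sym[OF PSL_3_2_Fano(2,1)] e by metis
    then show ?thesis by blast
  next
    assume "threes \<subseteq> fst ` S"
    then show ?thesis using alt_or_sym[OF Q(1)] iso_trans[OF quotient_iso] by blast
  qed (use syl in blast)
  moreover have "split_extension (matrix_group H) (Diag v S)"
    using split_iff evens_complement[OF S(1) d] by blast
  ultimately show ?thesis
    unfolding case3_def Let_def
    using Diag_normal Diag_elementary card_Diag d c64 embeds_sym seven_dvd[OF Q] quotient_order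
      has_index_iso[OF quotient_group group_perms_on[OF Q(1)] quotient_iso _ perms_on_index[OF Q]]
      self_centralizing[OF quotient_group quotient_iso Q]
    by simp
qed

text \<open>The quotient consists of collineations, so it is the full collineation group or affine; in the affine case \<open>simplex_complement\<close> splits the extension.\<close>

lemma case2_Diag: assumes d: "diag_signs S = simplex_code" shows "case2 H (Diag v S)"
proof -
  let ?X = "matrix_group H Mod Diag v S"
  have QF: "fst ` S \<subseteq> Fano" by (rule diag_simplex_Fano[OF S(1) d])
  obtain f where f: "f \<in> iso (perms_on Fano) PSL_3_2"
    using group.iso_sym[OF PSL_3_2_Fano(2,1)] by (auto simp: is_iso_def)
  have emb: "embeds_in ?X PSL_3_2"
    by (rule embeds_iso[OF quotient_iso Q(1) permgrp_Fano QF f PSL_3_2_Fano(2)])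
  have m: "multiplicity 7 (card Fano) = 1" by (rule multiplicity_7[OF permgrp_Fano rot_Fano])
  have nF: "fst ` S \<subseteq> Affine \<or> fst ` S = Fano"
    using classification[OF Q] QF three0_threes three0_not_Fano card_Fano card_Fano'
    by (metis card_subset_eq finite subset_iff)
  have syl: "embeds_in_sylow_normalizer 7 ?X PSL_3_2 \<and> order ?X \<in> {7, 7 * 3}" if n: "fst ` S \<subseteq> Affine"
  proof
    show "embeds_in_sylow_normalizer 7 ?X PSL_3_2"
      by (rule embeds_in_sylow_normalizer_iso[OF quotient_iso Q(1) n permgrp_Fano QF _ f PSL_3_2_Fano(2) m])
        (use Rots_sub QF in blast)
    show "order ?X \<in> {7, 7 * 3}" using Fano_Affine_card[OF Q QF n] quotient_order by simp
  qed
  have iso: "?X \<cong> PSL_3_2" if "fst ` S = Fano"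
    using that iso_trans[OF quotient_iso] group.iso_sym[OF PSL_3_2_Fano(2,1)] by simp
  have "split_extension (matrix_group H) (Diag v S)" if "\<not> ?X \<cong> PSL_3_2"
    using that nF iso split_iff simplex_complement[OF S d] by blast
  then show ?thesis
    unfolding case2_def Let_def
    using Diag_normal Diag_elementary card_Diag d card_simplex emb seven_dvd[OF Q] quotient_order nF syl iso
      has_index_iso[OF quotient_group group_perms_on[OF Q(1)] quotient_iso _ perms_on_index[OF Q]]
    by auto
qed

end


section \<open>Every group is listed\<close>

lemma mat1_lines: assumes "irreducible_subrep {mat 1} U" obtains u where "u \<noteq> 0" "U = span {u}"
proof -
  have U: "subspace U" "U \<noteq> {0}" "\<And>W. subspace W \<Longrightarrow> W \<subseteq> U \<Longrightarrow> W = {0} \<or> W = U"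
    using assms by (auto simp: irreducible_subrep_def)
  obtain u where u: "u \<in> U" "u \<noteq> 0" using U(1,2) subspace_0 by blast
  have "span {u} \<subseteq> U" using u(1) U(1) by (intro span_minimal) auto
  moreover have "span {u} \<noteq> {0}" using u(2) span_base[of u "{u}"] by auto
  ultimately have "U = span {u}" using U(3)[OF subspace_span] by blast
  then show ?thesis using that u(2) by blast
qed

lemma isomorphic_lines: assumes "u \<noteq> 0" "w \<noteq> 0" shows "isomorphic_subreps {mat 1} (span {u}) (span {w :: real^'n})"
proof -
  define f where "f x = (x \<bullet> u / (u \<bullet> u)) *\<^sub>R w" for x
  have lin: "linear f"
    by (rule linearI) (simp_all add: f_def inner_add_left add_divide_distrib scaleR_add_left)
  have fu: "f (k *\<^sub>R u) = k *\<^sub>R w" for k using assms(1) by (simp add: f_def)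
  have "bij_betw f (span {u}) (span {w})"
    unfolding bij_betw_def
  proof
    show "inj_on f (span {u})" using assms(2) by (auto intro!: inj_onI simp: span_singleton fu)
    show "f ` span {u} = span {w}" by (auto simp: span_singleton fu image_iff)
  qed
  then show ?thesis using lin unfolding isomorphic_subreps_def by auto
qed

text \<open>The restriction to the trivial subgroup has lines as constituents, the restriction to the whole group is irreducible.\<close>

lemma quasi_primitive_simple: assumes irr: "irreducible_group G" and sim: "\<And>N. N \<lhd> matrix_group G \<Longrightarrow> N = G \<or> N = {mat 1}"
  shows "quasi_primitive G"
  unfolding quasi_primitive_def
proof (intro allI impI)
  fix N U W assume N: "N \<lhd> matrix_group G" and UW: "irreducible_subrep N U \<and> irreducible_subrep N W"
  show "isomorphic_subreps N U W"
  proof (cases "N = G")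
    case True
    have "V = UNIV" if "irreducible_subrep G V" for V
      using that irr unfolding irreducible_group_def irreducible_subrep_def by auto
    then have "U = UNIV" "W = UNIV" using UW True by auto
    then show ?thesis unfolding isomorphic_subreps_def by (intro exI[of _ id]) (auto simp: linear_id)
  next
    case False
    then have n: "N = {mat 1}" using sim[OF N] by blast
    obtain u where u: "u \<noteq> 0" "U = span {u}" using UW n mat1_lines by metis
    obtain w where w: "w \<noteq> 0" "W = span {w}" using UW n mat1_lines by metis
    show ?thesis unfolding n u(2) w(2) by (rule isomorphic_lines[OF u(1) w(1)])
  qed
qed

lemma monomial_rep_flip: assumes "monomial_rep H v S"
  shows "monomial_rep H (\<lambda>i. v (neg i)) (sflip ` S)" "Diag (\<lambda>i. v (neg i)) (sflip ` S) = Diag v S"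
proof -
  have r: "basis7 v" "spgrp S" "cyc7 P1 \<in> S" "H = Mat v ` S" using assms by (auto simp: monomial_rep_def)
  have nn: "neg (neg i) = i" for i by (cases i) simp_all
  have injn: "inj neg" by (rule injI) (metis nn)
  have "range neg = UNIV" using nn by (metis surjI)
  then have rng: "range (\<lambda>i. v (neg i)) = range v" by (metis image_image)
  have b: "basis7 (\<lambda>i. v (neg i))"
    using r(1) injn unfolding basis7_def rng by (auto intro!: injI dest: injD)
  have m: "Mat (\<lambda>i. v (neg i)) (sflip x) = Mat v x" for x
  proof (rule basis7_eqI[OF b])
    fix i
    have "ap (fst (sflip x)) i = neg (ap (fst x) (neg i))" by (simp add: sflip_def flip_def neg_def)
    moreover have "bt (snd (sflip x)) i = bt (snd x) (neg i)" by (simp add: sflip_def neg_def)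
    ultimately show "Mat (\<lambda>i. v (neg i)) (sflip x) *v v (neg i) = Mat v x *v v (neg i)"
      unfolding Mat[OF b] Mat[OF r(1)] by (simp add: nn)
  qed
  show "monomial_rep H (\<lambda>i. v (neg i)) (sflip ` S)"
    unfolding monomial_rep_def using b spgrp_sflip[OF r(2)] cyc7_sflip[OF r(2,3)] r(4) m by (simp add: image_image)
  have "flip p = pid \<longleftrightarrow> p = pid" for p by (metis flip_flip flip_pid)
  then have "fst (sflip x) = pid \<longleftrightarrow> fst x = pid" for x by (simp add: sflip_def)
  then have "{x\<in>sflip ` S. fst x = pid} = sflip ` {x\<in>S. fst x = pid}" by blast
  then show "Diag (\<lambda>i. v (neg i)) (sflip ` S) = Diag v S" unfolding Diag_def by (simp add: image_image m)
qed

lemma fst_sflip: "fst ` sflip ` S = flip ` fst ` S"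
  by (simp add: image_image sflip_def)

lemma matrix_group_carrier: "carrier (matrix_group H) = H" by simp

context monomial_group
begin

lemma inj_line_perm: assumes d: "diag_signs S = {sz}" shows "inj_on line_perm H"
proof (rule inj_onI)
  fix a b assume "a \<in> H" "b \<in> H" "line_perm a = line_perm b"
  then obtain p s t where st: "(p, s) \<in> S" "(p, t) \<in> S" "a = Mat v (p, s)" "b = Mat v (p, t)" by (auto simp: H)
  then show "a = b" using same_perm[OF S(1) st(1,2)] d by (simp add: sx_eq_sz)
qed

lemma line_perm_iso: assumes d: "diag_signs S = {sz}" shows "matrix_group H \<cong> perms_on (fst ` S)"
proof -
  interpret h: group_hom "matrix_group H" permG line_perm by (rule line_perm_hom)
  note inj = inj_line_perm[OF d]
  have "line_perm x \<in> fst ` S" if "x \<in> H" for x using that line_perm_image by (metis imageI matrix_group_carrier)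
  then have "line_perm \<in> iso (matrix_group H) (perms_on (fst ` S))"
    unfolding iso_def bij_betw_def using inj line_perm_image h.hom_mult by (auto intro!: homI)
  then show ?thesis by (rule is_isoI)
qed

lemma normal_Fano: assumes N: "N \<lhd> matrix_group H" and F: "fst ` S = Fano"
  shows "line_perm ` N = {pid} \<or> line_perm ` N = Fano"
proof (cases "line_perm ` N = {pid}")
  case False
  interpret h: group_hom "matrix_group H" permG line_perm by (rule line_perm_hom)
  have sub: "subgroup N (matrix_group H)" by (rule normal_imp_subgroup[OF N])
  have g: "permgrp (line_perm ` N)" using h.subgroup_img_is_subgroup[OF sub] subgroup_permG by blast
  have NH: "N \<subseteq> H" using subgroup.subset[OF sub] by simp
  have "line_perm ` N \<subseteq> Fano" using NH line_perm_image F by auto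
  moreover have "x \<star> p \<star> pinv x \<in> line_perm ` N" if px: "p \<in> line_perm ` N" "x \<in> Fano" for p x
  proof -
    obtain n where n: "n \<in> N" "p = line_perm n" using px by blast
    obtain z where z: "z \<in> S" "fst z = x" using px(2) F by (metis imageE)
    obtain y where y: "y \<in> S" "n = Mat v y" using n NH H by blast
    have "Mat v z \<otimes>\<^bsub>matrix_group H\<^esub> n \<otimes>\<^bsub>matrix_group H\<^esub> inv\<^bsub>matrix_group H\<^esub> (Mat v z) \<in> N"
      using normal.inv_op_closed2[OF N, of "Mat v z" n] n z H by auto
    then have "Mat v (z \<diamondop> y \<diamondop> sinv z) \<in> N"
      unfolding inv_Mat[OF z(1)] by (simp add: y(2) Mat_smul[OF basis] del: smul.simps)
    then have "line_perm (Mat v (z \<diamondop> y \<diamondop> sinv z)) \<in> line_perm ` N" by (rule imageI)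
    then show ?thesis using z(2) n(2) y(2) by (simp add: sinv_def)
  qed
  moreover obtain p where "p \<in> line_perm ` N" "p \<noteq> pid" using False permgrpD(2)[OF g] by blast
  ultimately show ?thesis using Fano_simple[OF g] by blast
qed simp

lemma case1_Fano: assumes irr: "irreducible_group H" and d: "diag_signs S = {sz}" and F: "fst ` S = Fano"
  shows "quasi_primitive H" "case1 H"
proof -
  note inj = inj_line_perm[OF d]
  have sim: "N = H \<or> N = {mat 1}" if N: "N \<lhd> matrix_group H" for N
  proof -
    have sub: "subgroup N (matrix_group H)" by (rule normal_imp_subgroup[OF N])
    have NH: "N \<subseteq> H" using subgroup.subset[OF sub] by simp
    have one: "mat 1 \<in> N" using subgroup.one_closed[OF sub] by simp
    from normal_Fano[OF N F] show ?thesis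
    proof
      assume e: "line_perm ` N = {pid}"
      have "n = mat 1" if "n \<in> N" for n
        using inj_onD[OF inj, of n "mat 1"] that one NH e by (metis imageI singletonD subsetD)
      then show ?thesis using one by blast
    next
      assume "line_perm ` N = Fano"
      then have "line_perm ` N = line_perm ` H" using line_perm_image F by simp
      then have "N = H" using inj_on_image_eq_iff[OF inj NH subset_refl] by blast
      then show ?thesis by blast
    qed
  qed
  show "quasi_primitive H" by (rule quasi_primitive_simple[OF irr sim])
  have iso: "matrix_group H \<cong> perms_on Fano" using line_perm_iso[OF d] F by simp
  have "order (matrix_group H) = 168" using iso_same_card[OF iso] card_Fano by (simp add: order_def)
  then have "simple_group (matrix_group H)"
    using sim by (intro simple_group.intro simple_group_axioms.intro group_H) auto
  moreover have "matrix_group H \<cong> PSL_2_7" using iso_trans[OF iso group.iso_sym[OF PSL_2_7_Fano(2,1)]] .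
  ultimately show "case1 H" by (simp add: case1_def)
qed

lemma flipped: "monomial_group H (\<lambda>i. v (neg i)) (sflip ` S)"
  using monomial_rep_flip(1)[OF rep] subgroup by (rule monomial_group.intro)

lemma minus_one: "- mat 1 \<in> H \<longleftrightarrow> ones \<in> diag_signs S"
proof
  assume "- mat 1 \<in> H"
  then obtain x where x: "x \<in> S" "Mat v x = Mat v (pid, ones)" unfolding H Mat_ones[OF basis] by auto
  then show "ones \<in> diag_signs S" using Mat_inj[OF basis x(2)] by (simp add: diag_signs_def)
next
  assume "ones \<in> diag_signs S"
  then show "- mat 1 \<in> H" unfolding H Mat_ones[OF basis, symmetric] by (auto simp: diag_signs_def)
qed

lemma listed: assumes fii: "finite_irreducible_imprimitive H" and n: "- mat 1 \<notin> H" shows "listed H"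
proof -
  have irr: "irreducible_group H" using fii by (simp add: finite_irreducible_imprimitive_def)
  have no: "ones \<notin> diag_signs S" using n minus_one by simp
  interpret F: monomial_group H "\<lambda>i. v (neg i)" "sflip ` S" by (rule flipped)
  show ?thesis
    using S no
  proof (cases rule: diag_without_ones)
    case 1
    have "\<not> (\<forall>p b. (p, b) \<in> S \<longrightarrow> b \<in> const_signs)"
      using sum_fixed_reducible[OF basis S(1)] irr H by blast
    then have "fst ` S = Fano \<or> fst ` S = Fano'"
      using classification[OF Q] trivial_diag_Affine[OF S 1] trivial_diag_threes[OF S 1] by (metis fst_conv image_eqI subsetD)
    then have "quasi_primitive H \<and> case1 H"
    proof
      assume "fst ` S = Fano"
      then show ?thesis using case1_Fano[OF irr 1] by blast
    next
      assume e: "fst ` S = Fano'"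
      have "diag_signs (sflip ` S) = {sz}" using 1 by (simp add: diag_signs_sflip)
      moreover have "fst ` sflip ` S = Fano" unfolding fst_sflip e Fano'_eq by (simp add: image_image)
      ultimately show ?thesis using F.case1_Fano[OF irr] by blast
    qed
    then show ?thesis using fii by (simp add: listed_def)
  next
    case 2
    then show ?thesis using fii case2_Diag not_quasi_primitive by (auto simp: listed_def)
  next
    case 3
    then have "diag_signs (sflip ` S) = simplex_code" by (simp add: diag_signs_sflip simplex_code'_flip)
    then show ?thesis using fii F.case2_Diag F.not_quasi_primitive by (auto simp: listed_def)
  next
    case 4
    then show ?thesis using fii case3_Diag not_quasi_primitive simplex_evens by (auto simp: listed_def)
  qed
qed

end

lemma listed_no_minus: assumes "finite_irreducible_imprimitive H" "- mat 1 \<notin> H" shows "listed H"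
proof -
  obtain v S where r: "monomial_rep H v S" by (rule monomial_exists[OF assms(1)])
  interpret monomial_group H v S
    by (rule monomial_group.intro[OF r]) (use assms(1) in \<open>simp add: finite_irreducible_imprimitive_def\<close>)
  show ?thesis by (rule listed[OF assms])
qed

section \<open>Groups containing the negative of the identity\<close>

lemma det_minus: "det (- A :: real^7^7) = - det A"
proof -
  have "- A = (- mat 1) ** A" by (simp add: mat_neg_mult)
  moreover have "det (- mat 1 :: real^7^7) = -1"
  proof -
    have "(- mat 1 :: real^7^7) = (\<chi> i. (-1) *s (mat 1 :: real^7^7) $ i)" by (simp add: vec_eq_iff)
    then show ?thesis using det_rows_mul[of "\<lambda>_. -1" "\<lambda>i. (mat 1 :: real^7^7) $ i"] by simp
  qed
  ultimately show ?thesis by (simp add: det_mul)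
qed

lemma det_orth: "orthogonal_matrix (Q :: real^'n^'n) \<Longrightarrow> det Q = 1 \<or> det Q = -1"
  by (rule det_orthogonal_matrix)

locale minus_one_group =
  fixes G :: "(real^7^7) set"
  assumes fii: "finite_irreducible_imprimitive G" and m1: "- mat 1 \<in> G"
begin

definition "H = {g\<in>G. det g = 1}"

lemma G: "subgroup G orthogonal_group" "finite G" "irreducible_group G" "imprimitive G"
  using fii by (auto simp: finite_irreducible_imprimitive_def)

lemma neg_in: "g \<in> G \<Longrightarrow> - g \<in> G"
  using subgroup_orth(2)[OF G(1) m1, of g] by (simp add: mat_neg_mult)

lemma cases: assumes "g \<in> G" shows "g \<in> H \<or> - g \<in> H"
  using det_orth[OF transpose_group(1)[OF G(1) assms]] assms neg_in by (auto simp: H_def det_minus)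

lemma sub: "subgroup H orthogonal_group"
proof (rule finite_orth_subgroupI)
  show "H \<subseteq> {Q. orthogonal_matrix Q}" using transpose_group(1)[OF G(1)] by (auto simp: H_def)
qed (use G(2) subgroup_orth[OF G(1)] in \<open>auto simp: H_def det_mul\<close>)

lemma irr: "irreducible_group H"
  unfolding irreducible_group_def irreducible_subrep_def
proof (intro conjI allI impI)
  show "UNIV \<noteq> {0 :: real^7}" using G(3) by (simp add: irreducible_group_def irreducible_subrep_def)
  fix W :: "(real^7) set"
  assume W: "subspace W \<and> W \<subseteq> UNIV \<and> (\<forall>g\<in>H. (*v) g ` W \<subseteq> W)"
  have "(*v) g ` W \<subseteq> W" if g: "g \<in> G" for g
  proof (cases "g \<in> H")
    case False
    then have "- g \<in> H" using cases[OF g] by blast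
    have "g *v w \<in> W" if "w \<in> W" for w
    proof -
      have "(- g) *v w \<in> W" using W \<open>- g \<in> H\<close> that by blast
      moreover have "(- g) *v w = - (g *v w)" using matrix_vector_mult_diff_rdistrib[of 0 g w] by simp
      ultimately have "- (- (g *v w)) \<in> W" using W subspace_neg by metis
      then show ?thesis by simp
    qed
    then show ?thesis by blast
  qed (use W in blast)
  then have inv: "\<forall>g\<in>G. (*v) g ` W \<subseteq> W" by blast
  have "\<And>U. subspace U \<Longrightarrow> (\<forall>g\<in>G. (*v) g ` U \<subseteq> U) \<Longrightarrow> U = {0} \<or> U = UNIV"
    using G(3) unfolding irreducible_group_def irreducible_subrep_def by blast
  from this[OF _ inv] show "W = {0} \<or> W = UNIV" using W by fast
qed (auto simp: H_def)

lemma imp: "imprimitive H"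
proof -
  have "H \<subseteq> G" by (auto simp: H_def)
  then show ?thesis using G(4) unfolding imprimitive_def by (meson subsetD)
qed

lemma listed_H: "listed H"
proof (rule listed_no_minus)
  show "finite_irreducible_imprimitive H"
    using sub irr imp G(2) by (auto simp: finite_irreducible_imprimitive_def H_def)
  show "- mat 1 \<notin> H" by (simp add: H_def det_minus)
qed

lemma generated: "G = generate orthogonal_group (insert (- mat 1) H)"
proof
  show "generate orthogonal_group (insert (- mat 1) H) \<subseteq> G"
    by (rule group.generate_subgroup_incl[OF group_orthogonal _ G(1)]) (use m1 in \<open>auto simp: H_def\<close>)
  show "G \<subseteq> generate orthogonal_group (insert (- mat 1) H)"
  proof
    fix g assume g: "g \<in> G"
    show "g \<in> generate orthogonal_group (insert (- mat 1) H)"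
    proof (cases "g \<in> H")
      case True
      then show ?thesis by (intro generate.incl) simp
    next
      case False
      then have "- g \<in> H" using cases[OF g] by blast
      then have "- mat 1 \<otimes>\<^bsub>orthogonal_group\<^esub> - g \<in> generate orthogonal_group (insert (- mat 1) H)"
        by (intro generate.eng generate.incl) auto
      then show ?thesis by (simp add: mat_neg_mult)
    qed
  qed
qed

text \<open>The dimension is odd, so exactly one of \<open>g\<close> and \<open>- g\<close> has determinant 1.\<close>

lemma direct_product: "matrix_group G \<cong> integer_mod_group 2 \<times>\<times> matrix_group H"
proof -
  define f where "f g = (if det g = 1 then (0::int, g) else (1, - g))" for g :: "real^7^7"
  have d: "det g = 1 \<or> det g = -1" if "g \<in> G" for g using det_orth[OF transpose_group(1)[OF G(1) that]] .
  have "f \<in> iso (matrix_group G) (integer_mod_group 2 \<times>\<times> matrix_group H)"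
    unfolding iso_def
  proof (intro CollectI conjI homI)
    fix x y assume "x \<in> carrier (matrix_group G)" "y \<in> carrier (matrix_group G)"
    then have xy: "x \<in> G" "y \<in> G" by simp_all
    show "f (x \<otimes>\<^bsub>matrix_group G\<^esub> y) = f x \<otimes>\<^bsub>integer_mod_group 2 \<times>\<times> matrix_group H\<^esub> f y"
      using d[OF xy(1)] d[OF xy(2)] by (auto simp: f_def det_mul DirProd_def mat_neg_mult)
  next
    fix x assume "x \<in> carrier (matrix_group G)"
    then have x: "x \<in> G" by simp
    show "f x \<in> carrier (integer_mod_group 2 \<times>\<times> matrix_group H)"
      using d[OF x] x neg_in by (auto simp: f_def carrier_integer_mod_group H_def det_minus)
  next
    show "bij_betw f (carrier (matrix_group G)) (carrier (integer_mod_group 2 \<times>\<times> matrix_group H))"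
    proof (rule bij_betw_byWitness[where f'="\<lambda>(z, h). if z = 0 then h else - h"])
      show "\<forall>a\<in>carrier (matrix_group G). (case f a of (z, h) \<Rightarrow> if z = 0 then h else - h) = a"
        by (simp add: f_def)
      show "\<forall>a\<in>carrier (integer_mod_group 2 \<times>\<times> matrix_group H). f (case a of (z, h) \<Rightarrow> if z = 0 then h else - h) = a"
        by (auto simp: f_def carrier_integer_mod_group H_def det_minus)
      show "f ` carrier (matrix_group G) \<subseteq> carrier (integer_mod_group 2 \<times>\<times> matrix_group H)"
      proof
        fix y assume "y \<in> f ` carrier (matrix_group G)"
        then obtain x where x: "x \<in> G" "y = f x" by auto
        show "y \<in> carrier (integer_mod_group 2 \<times>\<times> matrix_group H)"
          using d[OF x(1)] x neg_in by (auto simp: f_def carrier_integer_mod_group H_def det_minus)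
      qed
      show "(\<lambda>(z, h). if z = 0 then h else - h) ` carrier (integer_mod_group 2 \<times>\<times> matrix_group H) \<subseteq> carrier (matrix_group G)"
        using neg_in by (auto simp: H_def)
    qed
  qed
  then show ?thesis by (rule is_isoI)
qed

end

theorem every_group_listed: assumes "finite_irreducible_imprimitive (G :: (real^7^7) set)"
  shows "\<exists>H. listed H \<and> (G = H \<or> G = generate orthogonal_group (insert (- mat 1) H) \<and>
           matrix_group G \<cong> integer_mod_group 2 \<times>\<times> matrix_group H)"
proof (cases "- mat 1 \<in> G")
  case True
  interpret minus_one_group G using assms True by (rule minus_one_group.intro)
  show ?thesis using listed_H generated direct_product by blast
next
  case False
  then show ?thesis using listed_no_minus[OF assms] by blast
qed


section \<open>Realization of all cases\<close>

fun coord :: "pt \<Rightarrow> 7" where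
  "coord P0 = 0" | "coord P1 = 1" | "coord P2 = 2" | "coord P3 = 3" | "coord P4 = 4" | "coord P5 = 5" | "coord P6 = 6"

definition std_basis :: "pt \<Rightarrow> real^7" where "std_basis i = axis (coord i) 1"

lemma coord_inject: "coord i = coord j \<longleftrightarrow> i = j"
  by (cases i; cases j) simp_all

lemma coord_surj: "\<exists>i. k = coord i"
  using UNIV_7[of k] by (metis coord.simps empty_iff insert_iff)

lemma std_inner: "std_basis i \<bullet> std_basis j = (if i = j then 1 else 0)"
  by (simp add: std_basis_def inner_axis_axis coord_inject)

lemma basis7_std: "basis7 std_basis"
proof -
  have "inj std_basis" by (rule injI) (simp add: std_basis_def axis_eq_axis coord_inject)
  moreover have "range std_basis \<subseteq> Basis" by (auto simp: std_basis_def axis_in_Basis_iff)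
  then have "independent (range std_basis)" by (rule independent_mono[OF independent_Basis])
  ultimately show ?thesis by (simp add: basis7_def)
qed

lemma orthogonal_Mat: assumes "is_perm (fst x)" shows "orthogonal_matrix (Mat std_basis x)"
proof -
  let ?M = "Mat std_basis x"
  have col: "column (coord i) ?M = sg (bt (snd x) i) *\<^sub>R std_basis (ap (fst x) i)" for i
    using Mat[OF basis7_std, of x i] by (simp add: std_basis_def matrix_vector_mult_basis)
  have "transpose ?M ** ?M = mat 1"
    unfolding matrix_mult_transpose_dot_column vec_eq_iff
  proof (intro allI)
    fix k l :: 7
    obtain i j where ij: "k = coord i" "l = coord j" using coord_surj by metis
    have "inj (ap (fst x))" using assms is_perm_iff by blast
    then show "(\<chi> i j. column i ?M \<bullet> column j ?M) $ k $ l = (mat 1 :: real^7^7) $ k $ l"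
      by (simp add: ij col std_inner mat_def coord_inject inj_eq)
  qed
  then show ?thesis by (simp add: orthogonal_matrix)
qed

abbreviation matrices :: "sp set \<Rightarrow> (real^7^7) set" where "matrices S \<equiv> Mat std_basis ` S"

lemma span_sg: "span {sg b *\<^sub>R u} = span {u :: real^7}"
proof
  show "span {sg b *\<^sub>R u} \<subseteq> span {u}" by (intro span_minimal) (auto intro: span_scale span_base)
  have "sg b *\<^sub>R (sg b *\<^sub>R u) \<in> span {sg b *\<^sub>R u}" by (intro span_scale span_base) simp
  then have "u \<in> span {sg b *\<^sub>R u}" by simp
  then show "span {u} \<subseteq> span {sg b *\<^sub>R u}" by (intro span_minimal) auto
qed

lemma imprimitive_matrices: assumes S: "spgrp S" shows "imprimitive (matrices S)"
proof -
  let ?L = "\<lambda>i. span {std_basis i}"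
  have inj: "inj ?L"
  proof (rule injI)
    fix i j assume "?L i = ?L j"
    then have "std_basis i \<in> ?L j" using span_base[of "std_basis i" "{std_basis i}"] by simp
    then obtain k where "std_basis i = k *\<^sub>R std_basis j" by (auto simp: span_singleton)
    then show "i = j" using basis7_indep(1)[OF basis7_std, of 1 i k j] by simp
  qed
  have "span (\<Union>(range ?L)) = UNIV"
  proof -
    have "range std_basis \<subseteq> \<Union>(range ?L)" using span_base by fastforce
    then show ?thesis using basis7_span[OF basis7_std] span_mono by blast
  qed
  moreover have "?L i \<inter> span (\<Union>(range ?L - {?L i})) = {0}" for i
  proof -
    have "\<Union>(range ?L - {?L i}) \<subseteq> span (range std_basis - {std_basis i})"
    proof
      fix x assume "x \<in> \<Union>(range ?L - {?L i})"
      then obtain j where j: "x \<in> ?L j" "?L j \<noteq> ?L i" by blast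
      then have "std_basis j \<in> range std_basis - {std_basis i}" by auto
      then show "x \<in> span (range std_basis - {std_basis i})" using j(1) span_mono[of "{std_basis j}" "range std_basis - {std_basis i}"] by auto
    qed
    then have s: "span (\<Union>(range ?L - {?L i})) \<subseteq> span (range std_basis - {std_basis i})"
      using span_minimal[OF _ subspace_span] by blast
    have "x = 0" if x: "x \<in> ?L i" "x \<in> span (range std_basis - {std_basis i})" for x
    proof (rule ccontr)
      assume "x \<noteq> 0"
      obtain k where k: "x = k *\<^sub>R std_basis i" using x(1) by (auto simp: span_singleton)
      have "inverse k *\<^sub>R x \<in> span (range std_basis - {std_basis i})" using x(2) by (rule span_scale)
      then have "std_basis i \<in> span (range std_basis - {std_basis i})" using k \<open>x \<noteq> 0\<close> by auto
      then show False using basis7_std by (auto simp: basis7_def dependent_def)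
    qed
    then show ?thesis using s span_zero by blast
  qed
  moreover have "(\<lambda>V. (*v) (Mat std_basis x) ` V) ` range ?L = range ?L" if x: "x \<in> S" for x
  proof -
    have "(*v) (Mat std_basis x) ` ?L i = ?L (ap (fst x) i)" for i
    proof -
      have "(*v) (Mat std_basis x) ` ?L i = span ((*v) (Mat std_basis x) ` {std_basis i})"
        by (rule linear_span_image[OF matrix_vector_mul_linear, symmetric])
      also have "\<dots> = span {sg (bt (snd x) i) *\<^sub>R std_basis (ap (fst x) i)}" by (simp add: Mat[OF basis7_std])
      also have "\<dots> = ?L (ap (fst x) i)"
        by (rule span_sg)
      finally show ?thesis .
    qed
    moreover have "surj (ap (fst x))" using spgrpD(1)[OF S x] by (simp add: is_perm_bij bij_def)
    then have "?L ` range (ap (fst x)) = range ?L" by simp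
    moreover have "(\<lambda>V. (*v) (Mat std_basis x) ` V) ` range ?L = ?L ` range (ap (fst x))"
      unfolding image_image calculation(1) ..
    ultimately show ?thesis by simp
  qed
  moreover have "?L i \<noteq> {0}" for i
    using basis7_nz[OF basis7_std, of i] span_base[of "std_basis i" "{std_basis i}"] by auto
  moreover have "card (range ?L) > 1" using card_image[OF inj] card_pt by simp
  ultimately show ?thesis
    unfolding imprimitive_def by (intro exI[of _ "range ?L"] conjI ballI; (elim imageE)?) (simp_all only: finite_imageI finite subspace_span not_False_eq_True)
qed

lemma concrete: assumes S: "spgrp S" "cyc7 P1 \<in> S" and irr: "irreducible_group (matrices S)"
  shows "finite_irreducible_imprimitive (matrices S)" "monomial_group (matrices S) std_basis S"
proof -
  have sub: "subgroup (matrices S) orthogonal_group"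
  proof (rule finite_orth_subgroupI)
    show "matrices S \<subseteq> {Q. orthogonal_matrix Q}" using orthogonal_Mat spgrpD(1)[OF S(1)] by blast
    show "mat 1 \<in> matrices S" using spgrpD(2)[OF S(1)] Mat_sid[OF basis7_std] by (metis imageI)
    show "x ** y \<in> matrices S" if "x \<in> matrices S" "y \<in> matrices S" for x y
      using that spgrpD(3)[OF S(1)] by (auto simp: Mat_smul[OF basis7_std, symmetric] simp del: smul.simps)
  qed simp
  then show "finite_irreducible_imprimitive (matrices S)"
    using irr imprimitive_matrices[OF S(1)] by (simp add: finite_irreducible_imprimitive_def)
  show "monomial_group (matrices S) std_basis S"
    by (rule monomial_group.intro[OF _ sub]) (simp add: monomial_rep_def basis7_std S)
qed

lemma listed_by_simplex: assumes S: "spgrp S" "cyc7 P1 \<in> S" "diag_signs S = simplex_code"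
  shows "monomial_group (matrices S) std_basis S" "listed_by (matrices S) (Diag std_basis S)" "card (Diag std_basis S) = 8"
proof -
  have irr: "irreducible_group (matrices S)" by (rule irreducible_diagonal[OF basis7_std S(1,2)]) (simp add: S(3))
  show m: "monomial_group (matrices S) std_basis S" by (rule concrete(2)[OF S(1,2) irr])
  note fii = concrete(1)[OF S(1,2) irr] and d = S(3)
  interpret monomial_group "matrices S" std_basis S by (rule m)
  show "listed_by (matrices S) (Diag std_basis S)"
    using fii case2_Diag[OF d] not_quasi_primitive d by (simp add: listed_by_def)
  show "card (Diag std_basis S) = 8" using card_Diag d card_simplex by simp
qed

lemma listed_by_evens: assumes S: "spgrp S" "cyc7 P1 \<in> S" "diag_signs S = evens"
  shows "monomial_group (matrices S) std_basis S" "listed_by (matrices S) (Diag std_basis S)" "card (Diag std_basis S) = 64"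
proof -
  have irr: "irreducible_group (matrices S)"
    by (rule irreducible_diagonal[OF basis7_std S(1,2)]) (simp add: S(3) simplex_evens)
  show m: "monomial_group (matrices S) std_basis S" by (rule concrete(2)[OF S(1,2) irr])
  note fii = concrete(1)[OF S(1,2) irr] and d = S(3)
  interpret monomial_group "matrices S" std_basis S by (rule m)
  have c: "case3 (matrices S) (Diag std_basis S)" by (rule case3_Diag[OF d])
  then show "card (Diag std_basis S) = 64" by (simp add: case3_def)
  show "listed_by (matrices S) (Diag std_basis S)"
    using fii c not_quasi_primitive d simplex_evens by (simp add: listed_by_def)
qed

lemma semidirect_simplex: assumes Q: "permgrp Q" "rot P1 \<in> Q" "Q \<subseteq> Fano"
  shows "spgrp (semidirect simplex_code Q)" "cyc7 P1 \<in> semidirect simplex_code Q" "diag_signs (semidirect simplex_code Q) = simplex_code"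
    "fst ` semidirect simplex_code Q = Q"
  using spgrp_simplex[OF Q(1,3)] cyc7_semidirect[OF sz_simplex Q(2)] diag_semidirect[OF Q(1)] fst_semidirect[OF sz_simplex] by auto

lemma semidirect_evens: assumes Q: "permgrp Q" "rot P1 \<in> Q"
  shows "spgrp (semidirect evens Q)" "cyc7 P1 \<in> semidirect evens Q" "diag_signs (semidirect evens Q) = evens" "fst ` semidirect evens Q = Q"
proof -
  have z: "sz \<in> evens" using simplex_evens sz_simplex by blast
  show "spgrp (semidirect evens Q)" "cyc7 P1 \<in> semidirect evens Q" "diag_signs (semidirect evens Q) = evens" "fst ` semidirect evens Q = Q"
    using spgrp_evens[OF Q(1)] cyc7_semidirect[OF z Q(2)] diag_semidirect[OF Q(1)] fst_semidirect[OF z] by auto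
qed

lemma ex_case2: assumes Q: "permgrp Q" "rot P1 \<in> Q" "Q \<subseteq> Fano"
  shows "\<exists>H A. listed_by H A \<and> card A = 8 \<and> order (matrix_group H Mod A) = card Q"
proof -
  note s = semidirect_simplex[OF Q]
  note l = listed_by_simplex[OF s(1-3)]
  show ?thesis using l monomial_group.quotient_order[OF l(1)] s(4) by metis
qed

lemma ex_case3: assumes Q: "permgrp Q" "rot P1 \<in> Q"
  shows "\<exists>H A. listed_by H A \<and> card A = 64 \<and> order (matrix_group H Mod A) = card Q \<and> matrix_group H Mod A \<cong> perms_on Q"
proof -
  note s = semidirect_evens[OF Q]
  note l = listed_by_evens[OF s(1-3)]
  show ?thesis using l monomial_group.quotient_order[OF l(1)] monomial_group.quotient_iso[OF l(1)] s(4) by metis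
qed

lemma ex_quasi_primitive: "\<exists>H. listed H \<and> quasi_primitive H"
proof -
  note irr = irreducible_Twisted[OF basis7_std]
  note c = concrete[OF spgrp_Twisted Twisted_gens(1) irr]
  interpret monomial_group "matrices Twisted" std_basis Twisted by (rule c(2))
  have sub: "Fano \<subseteq> fst ` Twisted"
    by (rule fst_contains_Fano[OF spgrp_Twisted Twisted_gens(1)]) (use Twisted_gens(2) in \<open>simp add: twist_gen_def\<close>)
  have "fst ` Twisted \<subseteq> Fano"
  proof -
    have "fst (sprod xs) \<in> Fano" if "set xs \<subseteq> {cyc7 P1, twist_gen}" for xs
      using that
      by (induction xs) (use permgrpD(2,3)[OF permgrp_Fano] rot_Fano invol_Fano in \<open>auto simp: cyc7_def twist_gen_def simp del: smul.simps\<close>)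
    then show ?thesis by (auto simp: Twisted_def)
  qed
  then have "fst ` Twisted = Fano" using sub by blast
  then have q: "quasi_primitive (matrices Twisted)" "case1 (matrices Twisted)" using case1_Fano[OF irr diag_Twisted] by blast+
  then show ?thesis using c(1) unfolding listed_def by auto
qed

text \<open>The rotation is a square of a rotation, hence even.\<close>

lemma ex_alt: "\<exists>H A. listed_by H A \<and> card A = 64 \<and> matrix_group H Mod A \<cong> alt_group 7"
proof -
  let ?Q = "{p. is_perm p \<and> tosym p \<in> carrier (alt_group 7)}"
  interpret A: group "alt_group 7" by (rule alt_group_is_group)
  have Q: "permgrp ?Q"
    unfolding permgrp_def
  proof (intro conjI ballI)
    show "pid \<in> ?Q" using A.one_closed by (simp add: tosym_pid alt_group_one)
    fix p q assume "p \<in> ?Q" "q \<in> ?Q"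
    then show "p \<star> q \<in> ?Q" using A.m_closed[of "tosym p" "tosym q"] by (simp add: tosym_pm alt_group_mult is_perm_pm)
  qed simp
  have "rot P1 = rot P4 \<star> rot P4" unfolding rot_add by (simp add: rot.simps)
  then have e: "tosym (rot P1) = tosym (rot P4) \<circ> tosym (rot P4)" using tosym_pm by simp
  have p4: "tosym (rot P4) permutes {1..7}" by (rule tosym_permutes) simp
  then have "permutation (tosym (rot P4))" using permutation_permutes by blast
  then have "evenperm (tosym (rot P1))" unfolding e by (simp add: evenperm_comp)
  then have c: "rot P1 \<in> ?Q" using tosym_permutes[of "rot P1"] by (simp add: alt_group_carrier)
  have "tosym ` ?Q = carrier (alt_group 7)"
  proof
    show "carrier (alt_group 7) \<subseteq> tosym ` ?Q"
    proof
      fix f assume f: "f \<in> carrier (alt_group 7)"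
      then have "f permutes {1..7}" by (simp add: alt_group_carrier)
      then obtain p where "is_perm p" "tosym p = f" using tosym_surj by blast
      then show "f \<in> tosym ` ?Q" using f by blast
    qed
  qed blast
  then have "perms_on ?Q \<cong> alt_group 7" using iso_restrict[OF tosym_iso, of ?Q] by (auto simp: alt_group_def)
  then show ?thesis using ex_case3[OF Q c] iso_trans by blast
qed

lemma ex_sym: "\<exists>H A. listed_by H A \<and> card A = 64 \<and> matrix_group H Mod A \<cong> sym_group 7"
proof -
  have "perms_on {p. is_perm p} \<cong> sym_group 7" unfolding permG_all by (rule permG_sym)
  then show ?thesis using ex_case3[OF permgrp_all, of] iso_trans is_perm_rot by blast
qed

lemma perms_on_Fano_PSL: "perms_on Fano \<cong> PSL_3_2" by (rule group.iso_sym[OF PSL_3_2_Fano(2,1)])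

lemma ex_PSL: "\<exists>H A. listed_by H A \<and> card A = 64 \<and> matrix_group H Mod A \<cong> PSL_3_2"
  using ex_case3[OF permgrp_Fano rot_Fano] iso_trans perms_on_Fano_PSL by blast

section \<open>Uniqueness of the two extensions\<close>

lemma (in monomial_group) iso_spG: "matrix_group H \<cong> spG\<lparr>carrier := S\<rparr>"
proof -
  have "Mat v \<in> iso (spG\<lparr>carrier := S\<rparr>) (matrix_group H)"
    unfolding iso_def bij_betw_def
    by (auto intro!: homI inj_onI dest: Mat_inj[OF basis] simp: H Mat_smul[OF basis] simp del: smul.simps)
  moreover have "group (spG\<lparr>carrier := S\<rparr>)"
  proof (rule groupI)
    fix x assume "x \<in> carrier (spG\<lparr>carrier := S\<rparr>)"
    then show "\<exists>y\<in>carrier (spG\<lparr>carrier := S\<rparr>). y \<otimes>\<^bsub>spG\<lparr>carrier := S\<rparr>\<^esub> x = \<one>\<^bsub>spG\<lparr>carrier := S\<rparr>\<^esub>"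
      using spgrp_sinv[OF S(1)] sinv(2) spgrpD(1)[OF S(1)] by (intro bexI[of _ "sinv x"]) (auto simp del: smul.simps)
  qed (use spgrpD[OF S(1)] in \<open>auto simp: smul_assoc simp del: smul.simps\<close>)
  ultimately show ?thesis using group.iso_sym is_isoI by blast
qed

context monomial_group
begin

text \<open>Its image in the transitive permutation group has exponent 2 and is normalized by the 7-cycle, so \<open>normalized_exponent2\<close> applies.\<close>

lemma abelian_normal_diagonal:
  assumes A: "A \<lhd> matrix_group H" "elementary_abelian 2 (matrix_group A)"
  shows "A \<subseteq> Diag v S"
proof -
  interpret h: group_hom "matrix_group H" permG line_perm by (rule line_perm_hom)
  have sub: "subgroup A (matrix_group H)" by (rule normal_imp_subgroup[OF A(1)])
  have AH: "A \<subseteq> H" using subgroup.subset[OF sub] by simp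
  have B: "permgrp (line_perm ` A)" using h.subgroup_img_is_subgroup[OF sub] subgroup_permG by blast
  have "line_perm ` A = {pid}"
  proof (rule normalized_exponent2[OF B])
    fix p assume "p \<in> line_perm ` A"
    then obtain a where a: "a \<in> A" "p = line_perm a" by blast
    then obtain y where y: "y \<in> S" "a = Mat v y" using AH H by blast
    have "Mat v (cyc7 P1) \<otimes>\<^bsub>matrix_group H\<^esub> a \<otimes>\<^bsub>matrix_group H\<^esub> inv\<^bsub>matrix_group H\<^esub> (Mat v (cyc7 P1)) \<in> A"
      using normal.inv_op_closed2[OF A(1), of "Mat v (cyc7 P1)" a] a(1) S(2) H by auto
    then have "Mat v (cyc7 P1 \<diamondop> y \<diamondop> sinv (cyc7 P1)) \<in> A"
      unfolding inv_Mat[OF S(2)] by (simp add: y(2) Mat_smul[OF basis] del: smul.simps)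
    then have "line_perm (Mat v (cyc7 P1 \<diamondop> y \<diamondop> sinv (cyc7 P1))) \<in> line_perm ` A" by (rule imageI)
    then show "rot P1 \<star> p \<star> rot P6 \<in> line_perm ` A" using a(2) y(2) by (simp add: sinv_def cyc7_def)
    interpret A: group "matrix_group A" using group.subgroup_imp_group[OF group_H sub] by simp
    have "a [^]\<^bsub>matrix_group A\<^esub> (2::nat) = \<one>\<^bsub>matrix_group A\<^esub>" using A(2) a(1) by (simp add: elementary_abelian_def)
    then have "a ** a = mat 1" using a(1) A.nat_pow_Suc[of a 1] A.nat_pow_Suc[of a 0] by (simp add: numeral_2_eq_2)
    then have "Mat v (y \<diamondop> y) = Mat v sid" by (simp add: y(2) Mat_smul[OF basis] Mat_sid[OF basis])
    then have "y \<diamondop> y = sid" by (rule Mat_inj[OF basis])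
    then have "fst (y \<diamondop> y) = pid" by simp
    then show "p \<star> p = pid" using a(2) y(2) by simp
  qed
  then show ?thesis using AH unfolding Diag_def H by force
qed

text \<open>Conversely, the image of the diagonal subgroup in the simple quotient is normal of exponent 2, hence trivial.\<close>

lemma diagonal_eq:
  assumes A: "A \<lhd> matrix_group H" "elementary_abelian 2 (matrix_group A)" and q: "matrix_group H Mod A \<cong> PSL_3_2"
  shows "A = Diag v S"
proof
  show "A \<subseteq> Diag v S" by (rule abelian_normal_diagonal[OF A])
  interpret N: normal A "matrix_group H" by (rule A(1))
  obtain f where f: "f \<in> iso (matrix_group H Mod A) (perms_on Fano)"
    using iso_trans[OF q PSL_3_2_Fano(1)] by (auto simp: is_iso_def)
  define k where "k g = f (A #>\<^bsub>matrix_group H\<^esub> g)" for g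
  have fh: "f \<in> hom (matrix_group H Mod A) (perms_on Fano)" using f by (simp add: iso_def)
  have qh: "(\<lambda>g. A #>\<^bsub>matrix_group H\<^esub> g) \<in> hom (matrix_group H) (matrix_group H Mod A)" by (rule N.r_coset_hom_Mod)
  have kh: "group_hom (matrix_group H) (perms_on Fano) k"
    using hom_compose[OF qh fh] unfolding k_def comp_def
    by (intro group_hom.intro group_hom_axioms.intro group_H group_perms_on permgrp_Fano)
  interpret k: group_hom "matrix_group H" "perms_on Fano" k by (rule kh)
  have onto: "k ` H = Fano"
  proof -
    have "f ` carrier (matrix_group H Mod A) = Fano" using f by (auto simp: iso_def bij_betw_def)
    moreover have "carrier (matrix_group H Mod A) = (\<lambda>g. A #>\<^bsub>matrix_group H\<^esub> g) ` H"
      by (auto simp: FactGroup_def RCOSETS_def)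
    ultimately show ?thesis by (simp add: k_def image_image)
  qed
  have DH: "Diag v S \<subseteq> H" by (auto simp: Diag_def H)
  have Dsub: "subgroup (Diag v S) (matrix_group H)" by (rule normal_imp_subgroup[OF Diag_normal])
  let ?D = "k ` Diag v S"
  have D: "permgrp ?D" "?D \<subseteq> Fano"
    using subgroup_perms_on_permgrp[OF permgrp_Fano k.subgroup_img_is_subgroup[OF Dsub]] by auto
  have square: "p \<star> p = pid" if p: "p \<in> ?D" for p
  proof -
    obtain d where d: "p = k d" "d \<in> Diag v S" using p by blast
    obtain b where "d = Mat v (pid, b)" using d(2) unfolding Diag_alt by blast
    then have b: "p = k (Mat v (pid, b))" "Mat v (pid, b) \<in> Diag v S" using d by auto
    have "Mat v (pid, b) ** Mat v (pid, b) = mat 1"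
      using Mat_sid[OF basis] by (simp add: Mat_smul[OF basis, symmetric] sid_def)
    then have "k (Mat v (pid, b)) \<star> k (Mat v (pid, b)) = k (mat 1)"
      using k.hom_mult[of "Mat v (pid, b)" "Mat v (pid, b)"] b(2) DH by auto
    then show ?thesis using b(1) k.hom_one by simp
  qed
  have "?D = {pid}"
  proof (rule ccontr)
    assume "?D \<noteq> {pid}"
    then obtain p where p: "p \<in> ?D" "p \<noteq> pid" using permgrpD(2)[OF D(1)] by blast
    have "?D = Fano"
    proof (rule Fano_simple[OF D _ p])
      fix q x assume q: "q \<in> ?D" and x: "x \<in> Fano"
      obtain d where d: "d \<in> Diag v S" "q = k d" using q by blast
      obtain g where g: "g \<in> H" "x = k g" using x onto by blast
      have i: "k (inv\<^bsub>matrix_group H\<^esub> g) = pinv x"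
      proof -
        have okx: "is_perm x" using x by (simp add: Fano_def)
        have gc: "g \<in> carrier (matrix_group H)" using g(1) by simp
        have "k (inv\<^bsub>matrix_group H\<^esub> g) \<star> x = k (inv\<^bsub>matrix_group H\<^esub> g \<otimes>\<^bsub>matrix_group H\<^esub> g)"
          unfolding g(2) using k.hom_mult[OF N.inv_closed[OF gc] gc] by simp
        also have "\<dots> = pid" unfolding N.l_inv[OF gc] using k.hom_one by simp
        finally have e: "k (inv\<^bsub>matrix_group H\<^esub> g) \<star> x = pid" .
        have "k (inv\<^bsub>matrix_group H\<^esub> g) = k (inv\<^bsub>matrix_group H\<^esub> g) \<star> (x \<star> pinv x)" by (simp add: pinv(3)[OF okx])
        then show ?thesis by (simp only: pm_assoc[symmetric] e pid_pm)
      qed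
      have c: "g \<otimes>\<^bsub>matrix_group H\<^esub> d \<otimes>\<^bsub>matrix_group H\<^esub> inv\<^bsub>matrix_group H\<^esub> g \<in> Diag v S"
        using normal.inv_op_closed2[OF Diag_normal, of g d] g d by simp
      have dH: "d \<in> carrier (matrix_group H)" "g \<in> carrier (matrix_group H)" using d DH g by auto
      have "k (g \<otimes>\<^bsub>matrix_group H\<^esub> d \<otimes>\<^bsub>matrix_group H\<^esub> inv\<^bsub>matrix_group H\<^esub> g) = x \<star> q \<star> pinv x"
        unfolding k.hom_mult[OF N.m_closed[OF dH(2,1)] N.inv_closed[OF dH(2)]] k.hom_mult[OF dH(2,1)] i g(2)[symmetric] d(2)[symmetric]
        by simp
      then show "x \<star> q \<star> pinv x \<in> ?D" using c by (metis imageI)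
    qed
    then have "rot P1 \<star> rot P1 = pid" using square rot_Fano by blast
    then show False unfolding rot_add by (simp add: rot.simps pid_def)
  qed
  then have kd: "k d = pid" if "d \<in> Diag v S" for d using that by blast
  show "Diag v S \<subseteq> A"
  proof
    fix d assume d: "d \<in> Diag v S"
    have dH: "d \<in> carrier (matrix_group H)" using d DH by auto
    have "f (A #>\<^bsub>matrix_group H\<^esub> d) = f (A #>\<^bsub>matrix_group H\<^esub> mat 1)"
      using kd[OF d] k.hom_one by (simp add: k_def)
    moreover have "A #>\<^bsub>matrix_group H\<^esub> d \<in> carrier (matrix_group H Mod A)"
      "A #>\<^bsub>matrix_group H\<^esub> mat 1 \<in> carrier (matrix_group H Mod A)"
      using dH N.one_closed by (auto simp: FactGroup_def RCOSETS_def)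
    ultimately have "A #>\<^bsub>matrix_group H\<^esub> d = A #>\<^bsub>matrix_group H\<^esub> mat 1"
      using f by (auto simp: iso_def bij_betw_def dest: inj_onD)
    moreover have "d \<in> A #>\<^bsub>matrix_group H\<^esub> d" by (rule N.rcos_self[OF dH N.is_subgroup])
    moreover have "A #>\<^bsub>matrix_group H\<^esub> mat 1 = A"
      using N.coset_mult_one[of A] N.subset by simp
    ultimately show "d \<in> A" by simp
  qed
qed

text \<open>With the all-ones word a cyclic code has order 2, 16 or 128.\<close>

lemma diag_card_8: assumes c: "card (diag_signs S) = 8" shows "diag_signs S = simplex_code \<or> diag_signs S = simplex_code'"
proof -
  have inj: "inj_on (sx ones) X" for X by (rule inj_onI) (metis sx_simps(4))
  have no: "ones \<notin> diag_signs S"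
  proof
    assume o: "ones \<in> diag_signs S"
    let ?E = "diag_signs S \<inter> evens"
    have sp: "diag_signs S = ?E \<union> sx ones ` ?E"
    proof
      show "diag_signs S \<subseteq> ?E \<union> sx ones ` ?E"
      proof
        fix b assume b: "b \<in> diag_signs S"
        show "b \<in> ?E \<union> sx ones ` ?E"
        proof (cases "parity b")
          case True
          then have "sx ones b \<in> ?E" using diag_signs_sx[OF S(1) o b] ones_odd by (simp add: evens_def parity_sx)
          then have "sx ones (sx ones b) \<in> sx ones ` ?E" by (rule imageI)
          then show ?thesis by simp
        qed (use b in \<open>simp add: evens_def\<close>)
      qed
      show "?E \<union> sx ones ` ?E \<subseteq> diag_signs S" using diag_signs_sx[OF S(1) o] by auto
    qed
    have dj: "?E \<inter> sx ones ` ?E = {}" using ones_odd by (auto simp: evens_def parity_sx)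
    have "card (diag_signs S) = card ?E + card (sx ones ` ?E)" using card_Un_disjoint[OF _ _ dj] sp by simp
    then have c4: "card ?E = 4" using c card_image[OF inj] by simp
    have c': "card simplex_code' = 8"
      unfolding simplex_code'_def using card_simplex
      by (subst card_image) (auto intro!: inj_onI signs_eqI dest: arg_cong[where f="\<lambda>b. sperm b (scale P6)"] simp: scale6_scale6)
    show False using S
    proof (cases rule: cyclic_codes)
      case 4
      then have "?E = evens" by blast
      then show False using c4 card_mono[OF _ simplex_evens] card_simplex by simp
    qed (use c4 c' card_simplex in auto)
  qed
  show ?thesis using S no
  proof (cases rule: diag_without_ones)
    case 1
    then show ?thesis using c by simp
  next
    case 4
    have "simplex_code \<noteq> evens"
    proof -
      have "\<not> linear_word (Signs True True False False False False False) \<and> \<not> parity (Signs True True False False False False False)" by code_simp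
      then show ?thesis unfolding simplex_code_def evens_def by blast
    qed
    then have "card simplex_code < card evens" using simplex_evens by (intro psubset_card_mono) auto
    then show ?thesis using 4 c card_simplex by simp
  qed auto
qed

lemma split_Octo: "S = Octo \<Longrightarrow> \<not> split_extension (matrix_group H) (Diag v S)"
  using split_iff Octo_nonsplit by blast

lemma split_semidirect: "S = semidirect simplex_code Fano \<Longrightarrow> split_extension (matrix_group H) (Diag v S)"
  using split_iff simplex_Fano_complement by blast

end

text \<open>The subgroup \<open>A\<close> is the diagonal subgroup, with a simplex code as its sign vectors; reversal of the basis reduces to the
first of the two codes, and the order of the quotient leaves only the full collineation group.\<close>

lemma PSL_extension_cases:
  assumes l: "listed_by H A" and c: "card A = 8" and q: "matrix_group H Mod A \<cong> PSL_3_2"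
  shows "\<exists>v S. monomial_group H v S \<and> A = Diag v S \<and> (S = semidirect simplex_code Fano \<or> S = Octo)"
proof -
  have fii: "finite_irreducible_imprimitive H" and c2: "case2 H A \<or> case3 H A" using l by (auto simp: listed_by_def)
  have A: "A \<lhd> matrix_group H" "elementary_abelian 2 (matrix_group A)"
    using c2 by (auto simp: case2_def case3_def)
  obtain v S where r: "monomial_rep H v S" by (rule monomial_exists[OF fii])
  have sub: "subgroup H orthogonal_group" using fii by (simp add: finite_irreducible_imprimitive_def)
  interpret m: monomial_group H v S by (rule monomial_group.intro[OF r sub])
  have AD: "A = Diag v S" by (rule m.diagonal_eq[OF A q])
  have key: "T = semidirect simplex_code Fano \<or> T = Octo"
    if t: "monomial_group H w T" "A = Diag w T" "diag_signs T = simplex_code" for w T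
  proof -
    interpret t: monomial_group H w T by (rule t(1))
    have "card (fst ` T) = card Fano"
      using iso_same_card[OF t.quotient_iso] iso_same_card[OF iso_trans[OF q PSL_3_2_Fano(1)]] t(2) by simp
    then have "fst ` T = Fano" using diag_simplex_Fano[OF t.S(1) t(3)] by (metis card_subset_eq finite)
    then show ?thesis by (rule extension_cases[OF t.S t(3)])
  qed
  have "card (diag_signs S) = 8" using m.card_Diag AD c by simp
  from m.diag_card_8[OF this] show ?thesis
  proof
    assume "diag_signs S = simplex_code"
    then show ?thesis using key[OF m.monomial_group_axioms AD] m.monomial_group_axioms AD by blast
  next
    assume "diag_signs S = simplex_code'"
    then have "diag_signs (sflip ` S) = simplex_code" by (simp add: diag_signs_sflip simplex_code'_flip)
    moreover have "A = Diag (\<lambda>i. v (neg i)) (sflip ` S)" using monomial_rep_flip(2)[OF r] AD by simp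
    ultimately show ?thesis using key[OF m.flipped] m.flipped by blast
  qed
qed

lemma semidirect_not_iso_Octo: "\<not> spG\<lparr>carrier := semidirect simplex_code Fano\<rparr> \<cong> spG\<lparr>carrier := Octo\<rparr>"
proof
  let ?S = "semidirect simplex_code Fano"
  assume "spG\<lparr>carrier := ?S\<rparr> \<cong> spG\<lparr>carrier := Octo\<rparr>"
  then obtain f where f: "f \<in> iso (spG\<lparr>carrier := ?S\<rparr>) (spG\<lparr>carrier := Octo\<rparr>)" by (auto simp: is_iso_def)
  have S: "spgrp ?S" by (rule semidirect_simplex(1)[OF permgrp_Fano rot_Fano]) simp
  have hom: "\<And>x y. x \<in> ?S \<Longrightarrow> y \<in> ?S \<Longrightarrow> f (x \<diamondop> y) = f x \<diamondop> f y" and bij: "inj_on f ?S" "f ` ?S = Octo"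
    using f by (auto simp: iso_def hom_def bij_betw_def simp del: smul.simps)
  obtain s where s: "(order4, s) \<in> Octo" using order4_facts(1) fst_Octo by (metis (no_types, lifting) image_iff prod.collapse)
  obtain x where x: "x \<in> ?S" "f x = (order4, s)" using s bij(2) by (metis (no_types, lifting) image_iff)
  have square: "ssq y \<in> ?S" "f (ssq y) = ssq (f y)" if "y \<in> ?S" for y
    using spgrpD(3)[OF S that that] hom[OF that that] by (simp_all add: ssq_def del: smul.simps)
  have f1: "f sid = sid"
  proof -
    have "f sid \<in> Octo" using bij(2) spgrpD(2)[OF S] by blast
    then have is_perm: "is_perm (fst (f sid))" using spgrpD(1)[OF spgrp_Octo] by blast
    have "f sid \<diamondop> f sid = f sid \<diamondop> sid" using hom[OF spgrpD(2)[OF S] spgrpD(2)[OF S]] by simp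
    then show ?thesis by (rule smul_cancel[OF is_perm])
  qed
  note q1 = square[OF x(1)]
  note q2 = square[OF q1(1)]
  note q3 = square[OF q2(1)]
  have o: "ssq (ssq (order4, s)) \<noteq> sid" "ssq (ssq (ssq (order4, s))) = sid" using Octo_order8[OF s] by blast+
  have "f (ssq (ssq (ssq x))) = f sid" using q1 q2 q3 o(2) x(2) f1 by simp
  then have "ssq (ssq (ssq x)) = sid" using q3(1) spgrpD(2)[OF S] inj_onD[OF bij(1)] by blast
  then have "ssq (ssq x) = sid" by (rule semidirect_no_order8[OF x(1)])
  then show False using q1 q2 o(1) x(2) f1 by simp
qed

theorem two_extensions:
  "\<exists>H1 A1 H2 A2.
       listed_by H1 A1 \<and> card A1 = 8 \<and> matrix_group H1 Mod A1 \<cong> PSL_3_2 \<and>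
       split_extension (matrix_group H1) A1 \<and>
       listed_by H2 A2 \<and> card A2 = 8 \<and> matrix_group H2 Mod A2 \<cong> PSL_3_2 \<and>
       \<not> split_extension (matrix_group H2) A2 \<and>
       \<not> matrix_group H1 \<cong> matrix_group H2 \<and>
       (\<forall>H A. listed_by H A \<and> card A = 8 \<and> matrix_group H Mod A \<cong> PSL_3_2 \<longrightarrow>
          (if split_extension (matrix_group H) A then matrix_group H \<cong> matrix_group H1
           else matrix_group H \<cong> matrix_group H2))"
proof -
  let ?S1 = "semidirect simplex_code Fano" and ?S2 = Octo
  note s1 = semidirect_simplex[OF permgrp_Fano rot_Fano subset_refl]
  note l1 = listed_by_simplex[OF s1(1-3)]
  note l2 = listed_by_simplex[OF spgrp_Octo cyc7_Octo diag_Octo]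
  interpret m1: monomial_group "matrices ?S1" std_basis ?S1 by (rule l1(1))
  interpret m2: monomial_group "matrices ?S2" std_basis ?S2 by (rule l2(1))
  have q1: "matrix_group (matrices ?S1) Mod Diag std_basis ?S1 \<cong> PSL_3_2"
    using iso_trans[OF m1.quotient_iso] perms_on_Fano_PSL s1(4) by simp
  have q2: "matrix_group (matrices ?S2) Mod Diag std_basis ?S2 \<cong> PSL_3_2"
    using iso_trans[OF m2.quotient_iso] perms_on_Fano_PSL fst_Octo by simp
  have i1: "spG\<lparr>carrier := ?S1\<rparr> \<cong> matrix_group (matrices ?S1)" by (rule group.iso_sym[OF m1.group_H m1.iso_spG])
  have i2: "spG\<lparr>carrier := ?S2\<rparr> \<cong> matrix_group (matrices ?S2)" by (rule group.iso_sym[OF m2.group_H m2.iso_spG])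
  have ni: "\<not> matrix_group (matrices ?S1) \<cong> matrix_group (matrices ?S2)"
    using iso_trans[OF iso_trans[OF i1] m2.iso_spG] semidirect_not_iso_Octo by blast
  have un: "if split_extension (matrix_group H) A then matrix_group H \<cong> matrix_group (matrices ?S1)
           else matrix_group H \<cong> matrix_group (matrices ?S2)"
    if h: "listed_by H A" "card A = 8" "matrix_group H Mod A \<cong> PSL_3_2" for H A
  proof -
    obtain v S where S: "monomial_group H v S" "A = Diag v S" "S = ?S1 \<or> S = ?S2"
      using PSL_extension_cases[OF h] by blast
    interpret m: monomial_group H v S by (rule S(1))
    show ?thesis
    proof (cases "S = ?S1")
      case True
      then show ?thesis using m.split_semidirect S(2) iso_trans[OF m.iso_spG] i1 by simp
    next
      case False
      then show ?thesis using m.split_Octo S(2,3) iso_trans[OF m.iso_spG] i2 by simp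
    qed
  qed
  show ?thesis
    using l1(2,3) q1 m1.split_semidirect l2(2,3) q2 m2.split_Octo ni un by blast
qed

lemma ex_orders8: "\<forall>n \<in> {7, 7 * 3}. \<exists>H A. listed_by H A \<and> card A = 8 \<and> order (matrix_group H Mod A) = n"
proof -
  have "\<exists>H A. listed_by H A \<and> card A = 8 \<and> order (matrix_group H Mod A) = 7 * length K"
    if "K \<in> set [[P1],[P1,P2,P4]]" for K
  proof -
    have "K \<in> set [[P1],[P1,P6],[P1,P2,P4],[P1,P2,P3,P4,P5,P6]]" using that by auto
    note a = affine_grp[OF this]
    show ?thesis using ex_case2[OF a(1,2) affine_Fano[OF that]] a(3) by simp
  qed
  from this[of "[P1]"] this[of "[P1,P2,P4]"] show ?thesis by simp
qed

lemma ex_orders64: "\<forall>n \<in> {7, 7 * 2, 7 * 3, 42}. \<exists>H A. listed_by H A \<and> card A = 64 \<and> order (matrix_group H Mod A) = n"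
proof -
  have "\<exists>H A. listed_by H A \<and> card A = 64 \<and> order (matrix_group H Mod A) = 7 * length K"
    if "K \<in> set [[P1],[P1,P6],[P1,P2,P4],[P1,P2,P3,P4,P5,P6]]" for K
    using affine_grp[OF that] ex_case3[of "set (affine_list K)"] by metis
  from this[of "[P1]"] this[of "[P1,P6]"] this[of "[P1,P2,P4]"] this[of "[P1,P2,P3,P4,P5,P6]"] show ?thesis by simp
qed

theorem theorem1:
  shows "PSL_3_2 \<cong> PSL_2_7 \<and>
    (\<forall>G :: (real^7^7) set. finite_irreducible_imprimitive G \<longrightarrow>
       (\<exists>H. listed H \<and>
          (G = H \<or>
           G = generate orthogonal_group (insert (- mat 1) H) \<and>
           matrix_group G \<cong> integer_mod_group 2 \<times>\<times> matrix_group H))) \<and>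
    (\<exists>H. listed H \<and> quasi_primitive H) \<and>
    (\<forall>n \<in> {7, 7 * 3}. \<exists>H A. listed_by H A \<and> card A = 8 \<and> order (matrix_group H Mod A) = n) \<and>
    (\<exists>H1 A1 H2 A2.
       listed_by H1 A1 \<and> card A1 = 8 \<and> matrix_group H1 Mod A1 \<cong> PSL_3_2 \<and>
       split_extension (matrix_group H1) A1 \<and>
       listed_by H2 A2 \<and> card A2 = 8 \<and> matrix_group H2 Mod A2 \<cong> PSL_3_2 \<and>
       \<not> split_extension (matrix_group H2) A2 \<and>
       \<not> matrix_group H1 \<cong> matrix_group H2 \<and>
       (\<forall>H A. listed_by H A \<and> card A = 8 \<and> matrix_group H Mod A \<cong> PSL_3_2 \<longrightarrow>
          (if split_extension (matrix_group H) A then matrix_group H \<cong> matrix_group H1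
           else matrix_group H \<cong> matrix_group H2))) \<and>
    (\<forall>n \<in> {7, 7 * 2, 7 * 3, 42}.
       \<exists>H A. listed_by H A \<and> card A = 64 \<and> order (matrix_group H Mod A) = n) \<and>
    (\<exists>H A. listed_by H A \<and> card A = 64 \<and> matrix_group H Mod A \<cong> PSL_3_2) \<and>
    (\<exists>H A. listed_by H A \<and> card A = 64 \<and> matrix_group H Mod A \<cong> alt_group 7) \<and>
    (\<exists>H A. listed_by H A \<and> card A = 64 \<and> matrix_group H Mod A \<cong> sym_group 7)"
  using PSL_3_2_PSL_2_7 every_group_listed ex_quasi_primitive ex_orders8 two_extensions ex_orders64 ex_PSL ex_alt ex_sym
  by (intro conjI allI impI)

end
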